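(* Let $(M,g)$ be a compact, oriented Riemannian manifold of dimension $4$, $(N,h,J)$ a compact Kähler manifold with Kähler form $\omega=h(J\cdot,\cdot)$, and $\phi:M\to N$ a smooth map. Then $$E(\phi)\geq\frac12\Big|\int_M\phi^*(\omega\wedge\omega)\Big|,$$ where $E(\phi)=\frac12\int_M|\phi^*\omega|^2\,{\ast 1}$, with equality if and only if $\phi^*\omega$ is self-dual or anti-self-dual. The right hand side is a homotopy invariant of $\phi$.
   Context: $\ast$ is the Hodge star operator of $M$ and $\ast 1$ its volume form; the pointwise norm on $p$-forms is induced by $\langle\alpha,\beta\rangle=\frac1{p!}\sum_{i_1,\dots,i_p}\alpha(e_{i_1},\dots,e_{i_p})\beta(e_{i_1},\dots,e_{i_p})$ for a local orthonormal frame. A $2$-form $\alpha$ on $M$ is self-dual if $\ast\alpha=\alpha$ and anti-self-dual if $\ast\alpha=-\alpha$. *)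

theory Defs
  imports "HOL-Analysis.Analysis"
begin

text \<open>
  A manifold is a Hausdorff, second countable space (a type) together with a smooth atlas.
  A tangent vector at a point is the family of its components with respect to the charts
  around that point; tensors are functions of such tangent vectors.
\<close>

section \<open>Smooth functions on open subsets of normed spaces\<close>

fun ck_on :: "nat \<Rightarrow> 'e::real_normed_vector set \<Rightarrow> ('e \<Rightarrow> 'f::real_normed_vector) \<Rightarrow> bool" where
  "ck_on 0 S f \<longleftrightarrow> continuous_on S f"
| "ck_on (Suc k) S f \<longleftrightarrow> (\<forall>x\<in>S. f differentiable (at x)) \<and>
     (\<forall>v. ck_on k S (\<lambda>x. frechet_derivative f (at x) v))"

definition smooth_on :: "'e::real_normed_vector set \<Rightarrow> ('e \<Rightarrow> 'f::real_normed_vector) \<Rightarrow> bool" where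
  "smooth_on S f \<longleftrightarrow> (\<forall>k. ck_on k S f)"

section \<open>Smooth manifolds and maps\<close>

type_synonym ('a, 'e) chart = "'a set \<times> ('a \<Rightarrow> 'e)"

abbreviation cdom :: "('a, 'e) chart \<Rightarrow> 'a set" where "cdom c \<equiv> fst c"
abbreviation cmap :: "('a, 'e) chart \<Rightarrow> 'a \<Rightarrow> 'e" where "cmap c \<equiv> snd c"
abbreviation cimg :: "('a, 'e) chart \<Rightarrow> 'e set" where "cimg c \<equiv> cmap c ` cdom c"
abbreviation cinv :: "('a, 'e) chart \<Rightarrow> 'e \<Rightarrow> 'a" where "cinv c \<equiv> inv_into (cdom c) (cmap c)"

definition is_chart :: "('a::topological_space, 'e::euclidean_space) chart \<Rightarrow> bool" where
  "is_chart c \<longleftrightarrow> open (cdom c) \<and> open (cimg c) \<and>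
     homeomorphism (cdom c) (cimg c) (cmap c) (cinv c)"

definition transition :: "('a, 'e) chart \<Rightarrow> ('a, 'e) chart \<Rightarrow> 'e \<Rightarrow> 'e" where
  "transition c c' = cmap c' \<circ> cinv c"

definition smooth_atlas ::
  "('a::{t2_space, second_countable_topology}, 'e::euclidean_space) chart set \<Rightarrow> bool" where
  "smooth_atlas A \<longleftrightarrow> (\<forall>c\<in>A. is_chart c) \<and> (\<Union>c\<in>A. cdom c) = UNIV \<and>
     (\<forall>c\<in>A. \<forall>c'\<in>A. smooth_on (cmap c ` (cdom c \<inter> cdom c')) (transition c c'))"

definition oriented_atlas ::
  "('a::{t2_space, second_countable_topology}, real^'n) chart set \<Rightarrow> bool" where
  "oriented_atlas A \<longleftrightarrow> smooth_atlas A \<and>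
     (\<forall>c\<in>A. \<forall>c'\<in>A. \<forall>y \<in> cmap c ` (cdom c \<inter> cdom c').
        det (matrix (frechet_derivative (transition c c') (at y))) > 0)"

definition holomorphic_atlas ::
  "('a::{t2_space, second_countable_topology}, complex^'m) chart set \<Rightarrow> bool" where
  "holomorphic_atlas A \<longleftrightarrow> smooth_atlas A \<and>
     (\<forall>c\<in>A. \<forall>c'\<in>A. \<forall>y \<in> cmap c ` (cdom c \<inter> cdom c'). \<forall>v.
        frechet_derivative (transition c c') (at y) (\<i> *s v) =
          \<i> *s frechet_derivative (transition c c') (at y) v)"

definition smooth_map ::
  "('a::topological_space, 'e::euclidean_space) chart set \<Rightarrow>
   ('b::topological_space, 'f::euclidean_space) chart set \<Rightarrow> ('a \<Rightarrow> 'b) \<Rightarrow> bool" where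
  "smooth_map A B \<phi> \<longleftrightarrow> continuous_on UNIV \<phi> \<and>
     (\<forall>c\<in>A. \<forall>c'\<in>B. smooth_on (cmap c ` (cdom c \<inter> \<phi> -` cdom c')) (cmap c' \<circ> \<phi> \<circ> cinv c))"

definition smooth_function ::
  "('a::topological_space, 'e::euclidean_space) chart set \<Rightarrow> ('a \<Rightarrow> real) \<Rightarrow> bool" where
  "smooth_function A f \<longleftrightarrow> (\<forall>c\<in>A. smooth_on (cimg c) (f \<circ> cinv c))"

section \<open>Tangent vectors\<close>

type_synonym ('a, 'e) tangent = "('a, 'e) chart \<Rightarrow> 'e"

text \<open>The value 0 on irrelevant charts makes tangent vectors extensional.\<close>

definition tangent_space ::
  "('a, 'e::euclidean_space) chart set \<Rightarrow> 'a \<Rightarrow> ('a, 'e) tangent set" where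
  "tangent_space A p = {v.
     (\<forall>c\<in>A. \<forall>c'\<in>A. p \<in> cdom c \<longrightarrow> p \<in> cdom c' \<longrightarrow>
        v c' = frechet_derivative (transition c c') (at (cmap c p)) (v c)) \<and>
     (\<forall>c. c \<notin> A \<or> p \<notin> cdom c \<longrightarrow> v c = 0)}"

text \<open>The tangent vector at \<open>p\<close> whose components in the chart \<open>c\<close> are \<open>u\<close>.\<close>

definition coord_vec ::
  "('a, 'e::euclidean_space) chart set \<Rightarrow> ('a, 'e) chart \<Rightarrow> 'a \<Rightarrow> 'e \<Rightarrow> ('a, 'e) tangent" where
  "coord_vec A c p u = (\<lambda>c'. if c' \<in> A \<and> p \<in> cdom c'
     then frechet_derivative (transition c c') (at (cmap c p)) u else 0)"

definition chart_at :: "('a, 'e) chart set \<Rightarrow> 'a \<Rightarrow> ('a, 'e) chart" where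
  "chart_at A p = (SOME c. c \<in> A \<and> p \<in> cdom c)"

text \<open>The differential; by the chain rule it does not depend on the chart used at \<open>p\<close>.\<close>

definition tangent_map ::
  "('a, 'e::euclidean_space) chart set \<Rightarrow> ('b, 'f::euclidean_space) chart set \<Rightarrow> ('a \<Rightarrow> 'b) \<Rightarrow>
   'a \<Rightarrow> ('a, 'e) tangent \<Rightarrow> ('b, 'f) tangent" where
  "tangent_map A B \<phi> p v = (let c = chart_at A p in
     (\<lambda>c'. if c' \<in> B \<and> \<phi> p \<in> cdom c'
        then frechet_derivative (cmap c' \<circ> \<phi> \<circ> cinv c) (at (cmap c p)) (v c) else 0))"

section \<open>Covariant 2-tensors, 2-forms and 4-forms\<close>

type_synonym ('a, 'e) field2 =
  "'a \<Rightarrow> ('a, 'e) tangent \<Rightarrow> ('a, 'e) tangent \<Rightarrow> real"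

type_synonym ('a, 'e) field4 =
  "'a \<Rightarrow> ('a, 'e) tangent \<Rightarrow> ('a, 'e) tangent \<Rightarrow> ('a, 'e) tangent \<Rightarrow> ('a, 'e) tangent \<Rightarrow> real"

definition local2 ::
  "('a, 'e::euclidean_space) chart set \<Rightarrow> ('a, 'e) chart \<Rightarrow> ('a, 'e) field2 \<Rightarrow>
   'e \<Rightarrow> 'e \<Rightarrow> 'e \<Rightarrow> real" where
  "local2 A c \<alpha> y u v = (let p = cinv c y in \<alpha> p (coord_vec A c p u) (coord_vec A c p v))"

definition smooth_field2 ::
  "('a, 'e::euclidean_space) chart set \<Rightarrow> ('a, 'e) field2 \<Rightarrow> bool" where
  "smooth_field2 A \<alpha> \<longleftrightarrow> (\<forall>c\<in>A. \<forall>u v. smooth_on (cimg c) (\<lambda>y. local2 A c \<alpha> y u v))"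

text \<open>
  The exterior derivative of a 2-form in a chart, on the constant coordinate fields
  \<open>u\<close>, \<open>v\<close>, \<open>w\<close> (whose brackets vanish).
\<close>

definition local_ext_deriv2 ::
  "('a, 'e::euclidean_space) chart set \<Rightarrow> ('a, 'e) chart \<Rightarrow> ('a, 'e) field2 \<Rightarrow>
   'e \<Rightarrow> 'e \<Rightarrow> 'e \<Rightarrow> 'e \<Rightarrow> real" where
  "local_ext_deriv2 A c \<alpha> y u v w =
     frechet_derivative (\<lambda>z. local2 A c \<alpha> z v w) (at y) u
     - frechet_derivative (\<lambda>z. local2 A c \<alpha> z u w) (at y) v
     + frechet_derivative (\<lambda>z. local2 A c \<alpha> z u v) (at y) w"

definition closed_form2 ::
  "('a, 'e::euclidean_space) chart set \<Rightarrow> ('a, 'e) field2 \<Rightarrow> bool" where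
  "closed_form2 A \<alpha> \<longleftrightarrow> (\<forall>c\<in>A. \<forall>y\<in>cimg c. \<forall>u v w. local_ext_deriv2 A c \<alpha> y u v w = 0)"

text \<open>The wedge product as the signed sum over (2,2)-shuffles, i.e. with the normalisation
  \<open>1 / (2! 2!)\<close> in front of the sum over all permutations.\<close>

definition wedge2 :: "('a, 'e) field2 \<Rightarrow> ('a, 'e) field2 \<Rightarrow> ('a, 'e) field4" where
  "wedge2 \<alpha> \<beta> p a b c d =
     \<alpha> p a b * \<beta> p c d - \<alpha> p a c * \<beta> p b d + \<alpha> p a d * \<beta> p b c
   + \<alpha> p b c * \<beta> p a d - \<alpha> p b d * \<beta> p a c + \<alpha> p c d * \<beta> p a b"

definition pullback2 ::
  "('a, 'e::euclidean_space) chart set \<Rightarrow> ('b, 'f::euclidean_space) chart set \<Rightarrow> ('a \<Rightarrow> 'b) \<Rightarrow>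
   ('b, 'f) field2 \<Rightarrow> ('a, 'e) field2" where
  "pullback2 A B \<phi> \<alpha> p u v =
     \<alpha> (\<phi> p) (tangent_map A B \<phi> p u) (tangent_map A B \<phi> p v)"

definition pullback4 ::
  "('a, 'e::euclidean_space) chart set \<Rightarrow> ('b, 'f::euclidean_space) chart set \<Rightarrow> ('a \<Rightarrow> 'b) \<Rightarrow>
   ('b, 'f) field4 \<Rightarrow> ('a, 'e) field4" where
  "pullback4 A B \<phi> \<eta> p a b c d =
     \<eta> (\<phi> p) (tangent_map A B \<phi> p a) (tangent_map A B \<phi> p b)
       (tangent_map A B \<phi> p c) (tangent_map A B \<phi> p d)"

section \<open>Riemannian and Kaehler metrics\<close>

definition riemannian_metric ::
  "('a, 'e::euclidean_space) chart set \<Rightarrow> ('a, 'e) field2 \<Rightarrow> bool" where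
  "riemannian_metric A g \<longleftrightarrow> smooth_field2 A g \<and>
     (\<forall>p. \<forall>u\<in>tangent_space A p. \<forall>v\<in>tangent_space A p.
        g p u v = g p v u \<and>
        (u \<noteq> (\<lambda>_. 0) \<longrightarrow> g p u u > 0) \<and>
        (\<forall>w\<in>tangent_space A p. \<forall>a b.
           g p (\<lambda>c. a *\<^sub>R u c + b *\<^sub>R v c) w = a * g p u w + b * g p v w))"

definition kaehler_form ::
  "('b, 'f) field2 \<Rightarrow> ('b \<Rightarrow> ('b, 'f) tangent \<Rightarrow> ('b, 'f) tangent) \<Rightarrow> ('b, 'f) field2" where
  "kaehler_form h J p u v = h p (J p u) v"

text \<open>
  \<open>J\<close> is the complex structure induced by the holomorphic atlas (multiplication by \<open>\<i>\<close>
  in every chart), \<open>h\<close> is Hermitian, and the Kaehler form is closed.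
\<close>

definition kaehler_manifold ::
  "('b::{t2_space, second_countable_topology}, complex^'m) chart set \<Rightarrow> ('b, complex^'m) field2 \<Rightarrow>
   ('b \<Rightarrow> ('b, complex^'m) tangent \<Rightarrow> ('b, complex^'m) tangent) \<Rightarrow> bool" where
  "kaehler_manifold B h J \<longleftrightarrow> holomorphic_atlas B \<and> riemannian_metric B h \<and>
     (\<forall>p. \<forall>v\<in>tangent_space B p. J p v = (\<lambda>c. \<i> *s v c)) \<and>
     (\<forall>p. \<forall>u\<in>tangent_space B p. \<forall>v\<in>tangent_space B p. h p (J p u) (J p v) = h p u v) \<and>
     closed_form2 B (kaehler_form h J)"

section \<open>Oriented Riemannian 4-manifolds\<close>

definition oriented_orthonormal_frame ::
  "('a, real^4) chart set \<Rightarrow> ('a, real^4) field2 \<Rightarrow> 'a \<Rightarrow> (4 \<Rightarrow> ('a, real^4) tangent) \<Rightarrow> bool" where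
  "oriented_orthonormal_frame A g p e \<longleftrightarrow>
     (\<forall>i. e i \<in> tangent_space A p) \<and>
     (\<forall>i j. g p (e i) (e j) = (if i = j then 1 else 0)) \<and>
     (\<forall>c\<in>A. p \<in> cdom c \<longrightarrow> det (\<chi> i j. e j c $ i) > 0)"

text \<open>The notions defined below from this frame do not depend on its choice.\<close>

definition frame_at ::
  "('a, real^4) chart set \<Rightarrow> ('a, real^4) field2 \<Rightarrow> 'a \<Rightarrow> 4 \<Rightarrow> ('a, real^4) tangent" where
  "frame_at A g p = (SOME e. oriented_orthonormal_frame A g p e)"

definition volume_form ::
  "('a, real^4) chart set \<Rightarrow> ('a, real^4) field2 \<Rightarrow> ('a, real^4) field4" where
  "volume_form A g p a b c d = (let e = frame_at A g p in
     det ((\<chi> i. vector [g p (e i) a, g p (e i) b, g p (e i) c, g p (e i) d]) :: real^4^4))"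

definition form2_inner ::
  "('a, real^4) chart set \<Rightarrow> ('a, real^4) field2 \<Rightarrow> ('a, real^4) field2 \<Rightarrow> ('a, real^4) field2 \<Rightarrow>
   'a \<Rightarrow> real" where
  "form2_inner A g \<alpha> \<beta> p = (let e = frame_at A g p in
     1 / fact 2 * (\<Sum>i\<in>UNIV. \<Sum>j\<in>UNIV. \<alpha> p (e i) (e j) * \<beta> p (e i) (e j)))"

definition form2_norm ::
  "('a, real^4) chart set \<Rightarrow> ('a, real^4) field2 \<Rightarrow> ('a, real^4) field2 \<Rightarrow> 'a \<Rightarrow> real" where
  "form2_norm A g \<alpha> p = sqrt (form2_inner A g \<alpha> \<alpha> p)"

text \<open>
  The Hodge star on 2-forms: \<open>(\<star>\<alpha>)\<^sub>k\<^sub>l = 1/2 \<Sum>\<^sub>i\<^sub>j \<alpha>\<^sub>i\<^sub>j \<epsilon>\<^sub>i\<^sub>j\<^sub>k\<^sub>l\<close> in an oriented orthonormal frame;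
  e.g. \<open>(\<star>\<alpha>)(e\<^sub>3, e\<^sub>4) = \<alpha>(e\<^sub>1, e\<^sub>2)\<close>.
\<close>

definition hodge2 ::
  "('a, real^4) chart set \<Rightarrow> ('a, real^4) field2 \<Rightarrow> ('a, real^4) field2 \<Rightarrow> ('a, real^4) field2" where
  "hodge2 A g \<alpha> p u v = (let e = frame_at A g p in
     1 / 2 * (\<Sum>i\<in>UNIV. \<Sum>j\<in>UNIV. \<alpha> p (e i) (e j) * volume_form A g p (e i) (e j) u v))"

definition self_dual ::
  "('a, real^4) chart set \<Rightarrow> ('a, real^4) field2 \<Rightarrow> ('a, real^4) field2 \<Rightarrow> bool" where
  "self_dual A g \<alpha> \<longleftrightarrow> (\<forall>p. \<forall>u\<in>tangent_space A p. \<forall>v\<in>tangent_space A p.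
     hodge2 A g \<alpha> p u v = \<alpha> p u v)"

definition anti_self_dual ::
  "('a, real^4) chart set \<Rightarrow> ('a, real^4) field2 \<Rightarrow> ('a, real^4) field2 \<Rightarrow> bool" where
  "anti_self_dual A g \<alpha> \<longleftrightarrow> (\<forall>p. \<forall>u\<in>tangent_space A p. \<forall>v\<in>tangent_space A p.
     hodge2 A g \<alpha> p u v = - \<alpha> p u v)"

section \<open>Integration over compact oriented 4-manifolds\<close>

definition partition_of_unity ::
  "('a::topological_space, 'e::euclidean_space) chart set \<Rightarrow> ('a, 'e) chart set \<Rightarrow>
   (('a, 'e) chart \<Rightarrow> 'a \<Rightarrow> real) \<Rightarrow> bool" where
  "partition_of_unity A C \<rho> \<longleftrightarrow> finite C \<and> C \<subseteq> A \<and>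
     (\<forall>c\<in>C. smooth_function A (\<rho> c) \<and> (\<forall>p. \<rho> c p \<ge> 0) \<and> closure {p. \<rho> c p \<noteq> 0} \<subseteq> cdom c) \<and>
     (\<forall>p. (\<Sum>c\<in>C. \<rho> c p) = 1)"

definition local4 ::
  "('a, real^4) chart set \<Rightarrow> ('a, real^4) chart \<Rightarrow> ('a, real^4) field4 \<Rightarrow> real^4 \<Rightarrow> real" where
  "local4 A c \<eta> y = (let p = cinv c y; d = (\<lambda>i. coord_vec A c p (axis i 1))
     in \<eta> p (d 1) (d 2) (d 3) (d 4))"

text \<open>
  For a continuous 4-form on a compact manifold with oriented atlas \<open>A\<close>, finite partitions of
  unity exist and all of them give the same value.
\<close>

definition form_integral ::
  "('a::topological_space, real^4) chart set \<Rightarrow> ('a, real^4) field4 \<Rightarrow> real" where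
  "form_integral A \<eta> = (THE I. \<exists>C \<rho>. partition_of_unity A C \<rho> \<and>
     I = (\<Sum>c\<in>C. integral (cimg c) (\<lambda>y. \<rho> c (cinv c y) * local4 A c \<eta> y)))"

definition energy ::
  "('a::topological_space, real^4) chart set \<Rightarrow> ('a, real^4) field2 \<Rightarrow>
   ('b, 'f::euclidean_space) chart set \<Rightarrow> ('b, 'f) field2 \<Rightarrow> ('a \<Rightarrow> 'b) \<Rightarrow> real" where
  "energy A g B \<omega> \<phi> = 1 / 2 * form_integral A (\<lambda>p a b c d.
     (form2_norm A g (pullback2 A B \<phi> \<omega>) p)\<^sup>2 * volume_form A g p a b c d)"

end

theory Submission
  imports Defs
begin

text \<open>
  In an oriented orthonormal frame write \<open>\<alpha> = \<phi>\<^sup>*\<omega>\<close> and \<open>\<alpha> \<and> \<alpha> = w \<cdot> vol\<close>. Then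
  \<open>|\<alpha>|\<^sup>2 \<mp> w\<close> is the sum of the squares of \<open>\<alpha>\<^sub>1\<^sub>2 \<mp> \<alpha>\<^sub>3\<^sub>4\<close>, \<open>\<alpha>\<^sub>1\<^sub>3 \<plusminus> \<alpha>\<^sub>2\<^sub>4\<close>, \<open>\<alpha>\<^sub>1\<^sub>4 \<mp> \<alpha>\<^sub>2\<^sub>3\<close>, which vanish
  exactly when \<open>\<star>\<alpha> = \<plusminus>\<alpha>\<close>; integrating these continuous nonnegative densities gives the inequality
  and the equality case.

  For the homotopy invariance, suppose two smooth maps agree outside a compact part of one source chart
  and map that part into a convex piece of one target chart. There \<open>\<omega> = d\<theta>\<close>, and with
  \<open>a = f\<^sup>*\<theta>\<close>, \<open>a' = f'\<^sup>*\<theta>\<close> the difference of the integrands is \<open>d(a - a') \<and> d(a + a')\<close>, whose integral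
  vanishes because \<open>a - a'\<close> has compact support. Interpolating chart by chart, any two smooth maps
  whose graphs lie in a sufficiently small neighbourhood of the graph of a continuous map \<open>g\<close> have the
  same integral; the same interpolation, towards polynomials, produces smooth maps in every such
  neighbourhood. Hence the integral extends to a locally constant function along a continuous homotopy.
\<close>

section \<open>Functions of class C^k\<close>

text \<open>The given homotopy is only continuous, so Stokes' theorem on the cylinder over M is out
  of reach; maps are compared through nearby smooth maps instead. Nearness means that the graph lies
  in an open subset of the product of M and N. This uses no distance on N, and compactness turns it
  into a uniform bound in each chart. One smooth map is changed into another one chart at a time.
  Two facts make this work: interpolating towards f' does nothing at points where the two maps
  already agree, and the neighbourhood is shrunk beforehand so that all intermediate maps stay in
  the convex coordinate pieces. Two definitions shape the rest. \<open>form_integral\<close> is a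
  definite description, so no integral can be evaluated before partitions of unity are shown to
  exist and to give the same value. \<open>ck_on\<close> controls derivatives in fixed directions
  only, so chain rules and forms with moving arguments are expanded in a basis before their
  smoothness is read off.\<close>

lemma frechet_derivative_cong_open:
  assumes "open S" "x \<in> S" "\<And>y. y \<in> S \<Longrightarrow> f y = g y"
  shows "frechet_derivative f (at x) = frechet_derivative g (at x)"
proof -
  have "(f has_derivative D) (at x) \<longleftrightarrow> (g has_derivative D) (at x)" for D
    using has_derivative_transform_within_open[OF _ assms(1,2)] assms(3) by metis
  then show ?thesis by (simp add: frechet_derivative_def)
qed

lemma differentiable_cong_open:
  assumes "open S" "x \<in> S" "\<And>y. y \<in> S \<Longrightarrow> f y = g y" "f differentiable (at x)"
  shows "g differentiable (at x)"
  using assms has_derivative_transform_within_open[of f _ x UNIV S g]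
  unfolding differentiable_def by metis

lemma frechet_derivative_eqI:
  assumes "(f has_derivative D) (at x)"
  shows "frechet_derivative f (at x) v = D v"
  using frechet_derivative_at[OF assms] by simp

lemma differentiable_has_frechet:
  "f differentiable (at x) \<Longrightarrow> (f has_derivative frechet_derivative f (at x)) (at x)"
  by (simp add: frechet_derivative_works)

lemma ck_on_cong:
  assumes "open S" "\<And>x. x \<in> S \<Longrightarrow> f x = g x" "ck_on k S f"
  shows "ck_on k S g"
  using assms(2,3)
proof (induction k arbitrary: f g)
  case 0
  then show ?case using continuous_on_cong by fastforce
next
  case (Suc k)
  then have "\<forall>x\<in>S. g differentiable (at x)"
    using differentiable_cong_open[OF assms(1)] by (metis ck_on.simps(2))
  moreover have "frechet_derivative f (at x) v = frechet_derivative g (at x) v" if "x \<in> S" for x v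
    using frechet_derivative_cong_open[OF assms(1) that] Suc.prems(1) by metis
  ultimately show ?case
    using Suc.IH[of "\<lambda>x. frechet_derivative f (at x) _" "\<lambda>x. frechet_derivative g (at x) _"] Suc.prems(2)
    by auto
qed

lemma ck_on_subset: "ck_on k S f \<Longrightarrow> T \<subseteq> S \<Longrightarrow> ck_on k T f"
proof (induction k arbitrary: f)
  case 0 then show ?case by (auto intro: continuous_on_subset)
next
  case (Suc k) then show ?case by (metis ck_on.simps(2) subsetD)
qed

lemma ck_on_Suc_lower: "ck_on (Suc k) S f \<Longrightarrow> ck_on k S f"
proof (induction k arbitrary: f)
  case 0
  then show ?case
    by (auto intro!: continuous_at_imp_continuous_on differentiable_imp_continuous_within)
next
  case (Suc k)
  then show ?case by (metis ck_on.simps(2))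
qed

lemma ck_on_le: "ck_on k S f \<Longrightarrow> j \<le> k \<Longrightarrow> ck_on j S f"
proof (induction k)
  case (Suc k) then show ?case using ck_on_Suc_lower[of k S f] by (cases "j = Suc k") auto
qed simp

lemma ck_on_continuous: "ck_on k S f \<Longrightarrow> continuous_on S f"
  using ck_on_le[of k S f 0] by simp

lemma ck_on_local:
  assumes "\<And>x. x \<in> S \<Longrightarrow> \<exists>T. open T \<and> x \<in> T \<and> ck_on k T f"
  shows "ck_on k S f"
  using assms
proof (induction k arbitrary: f)
  case 0
  then show ?case
    by (metis ck_on.simps(1) continuous_at_imp_continuous_on continuous_on_eq_continuous_at)
next
  case (Suc k)
  have "ck_on k S (\<lambda>x. frechet_derivative f (at x) v)" for v
  proof (rule Suc.IH)
    fix x assume "x \<in> S"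
    then obtain T where "open T" "x \<in> T" "ck_on (Suc k) T f" using Suc.prems by blast
    then show "\<exists>T. open T \<and> x \<in> T \<and> ck_on k T (\<lambda>x. frechet_derivative f (at x) v)"
      by auto
  qed
  moreover have "f differentiable (at x)" if "x \<in> S" for x
    using Suc.prems[OF that] by auto
  ultimately show ?case by simp
qed

section \<open>Sums, products, compositions and inverses of C^k functions\<close>

lemma ck_on_const [simp]: "ck_on k S (\<lambda>x. a)"
  by (induction k arbitrary: a) (auto simp: frechet_derivative_eqI[OF has_derivative_const])

lemma ck_on_bounded_linear:
  assumes "bounded_linear f" shows "ck_on k S f"
proof (cases k)
  case 0
  then show ?thesis using assms by (simp add: linear_continuous_on)
next
  case (Suc j)
  have "(f has_derivative f) (at x)" for x
    using assms by (rule bounded_linear_imp_has_derivative)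
  then have "frechet_derivative f (at x) v = f v" "f differentiable (at x)" for x v
    using frechet_derivative_eqI by (blast, blast intro: differentiableI)
  then show ?thesis using Suc by simp
qed

lemma ck_on_id [simp]: "ck_on k S (\<lambda>x. x)"
  by (simp add: ck_on_bounded_linear)

lemma ck_on_compose_linear:
  assumes "open S" "bounded_linear L" "ck_on k S f" shows "ck_on k S (\<lambda>x. L (f x))"
  using assms(3)
proof (induction k arbitrary: f)
  case 0 then show ?case
    using assms(2) by (simp add: bounded_linear.continuous_on)
next
  case (Suc k)
  have D: "((\<lambda>x. L (f x)) has_derivative (\<lambda>v. L (frechet_derivative f (at x) v))) (at x)" if "x \<in> S" for x
    using Suc.prems that by (auto intro!: bounded_linear.has_derivative[OF assms(2)] differentiable_has_frechet)
  have "ck_on k S (\<lambda>x. frechet_derivative (\<lambda>x. L (f x)) (at x) v)" for v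
  proof (rule ck_on_cong[OF assms(1)])
    show "ck_on k S (\<lambda>x. L (frechet_derivative f (at x) v))" using Suc by simp
  qed (simp add: frechet_derivative_eqI[OF D])
  then show ?case using D by (auto intro: differentiableI)
qed

lemma ck_on_add:
  assumes "open S" "ck_on k S f" "ck_on k S g" shows "ck_on k S (\<lambda>x. f x + g x)"
  using assms(2,3)
proof (induction k arbitrary: f g)
  case 0 then show ?case by (auto intro: continuous_intros)
next
  case (Suc k)
  have D: "((\<lambda>x. f x + g x) has_derivative
      (\<lambda>v. frechet_derivative f (at x) v + frechet_derivative g (at x) v)) (at x)" if "x \<in> S" for x
    using Suc.prems that by (auto intro!: has_derivative_add differentiable_has_frechet)
  have "ck_on k S (\<lambda>x. frechet_derivative (\<lambda>x. f x + g x) (at x) v)" for v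
  proof (rule ck_on_cong[OF assms(1)])
    show "ck_on k S (\<lambda>x. frechet_derivative f (at x) v + frechet_derivative g (at x) v)"
      using Suc by simp
  qed (simp add: frechet_derivative_eqI[OF D])
  then show ?case using D by (auto intro: differentiableI)
qed

lemma ck_on_sum:
  assumes "open S" "\<And>i. i \<in> I \<Longrightarrow> ck_on k S (f i)" shows "ck_on k S (\<lambda>x. \<Sum>i\<in>I. f i x)"
  using assms(2)
  by (induction I rule: infinite_finite_induct) (auto intro!: ck_on_add assms(1))

lemma ck_on_bilinear:
  assumes "open S" "bounded_bilinear b" "ck_on k S f" "ck_on k S g"
  shows "ck_on k S (\<lambda>x. b (f x) (g x))"
  using assms(3,4)
proof (induction k arbitrary: f g)
  case 0 then show ?case using assms(2) by (simp add: bounded_bilinear.continuous_on)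
next
  case (Suc k)
  have D: "((\<lambda>x. b (f x) (g x)) has_derivative
      (\<lambda>v. b (f x) (frechet_derivative g (at x) v) + b (frechet_derivative f (at x) v) (g x))) (at x)"
    if "x \<in> S" for x
    using Suc.prems that
    by (auto intro!: bounded_bilinear.FDERIV[OF assms(2)] differentiable_has_frechet)
  have "ck_on k S (\<lambda>x. frechet_derivative (\<lambda>x. b (f x) (g x)) (at x) v)" for v
  proof (rule ck_on_cong[OF assms(1)])
    have "ck_on k S f" "ck_on k S g"
      using Suc.prems ck_on_Suc_lower by blast+
    then show "ck_on k S (\<lambda>x. b (f x) (frechet_derivative g (at x) v) +
        b (frechet_derivative f (at x) v) (g x))"
      using Suc.prems by (intro ck_on_add[OF assms(1)] Suc.IH) auto
  qed (simp add: frechet_derivative_eqI[OF D])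
  then show ?case using D by (auto intro: differentiableI)
qed

lemmas ck_on_scaleR = ck_on_bilinear[OF _ bounded_bilinear_scaleR]
lemmas ck_on_mult = ck_on_bilinear[OF _ bounded_bilinear_mult]
lemmas ck_on_inner = ck_on_compose_linear[OF _ bounded_linear_inner_left]

lemma ck_on_minus: "open S \<Longrightarrow> ck_on k S f \<Longrightarrow> ck_on k S (\<lambda>x. - f x)"
  by (rule ck_on_compose_linear[OF _ bounded_linear_minus[OF bounded_linear_ident]])

lemma ck_on_diff: "open S \<Longrightarrow> ck_on k S f \<Longrightarrow> ck_on k S g \<Longrightarrow> ck_on k S (\<lambda>x. f x - g x)"
  using ck_on_add[OF _ _ ck_on_minus] by fastforce

lemma ck_on_componentwise:
  fixes f :: "'a::real_normed_vector \<Rightarrow> 'b::euclidean_space"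
  assumes "open S" "\<And>b. b \<in> Basis \<Longrightarrow> ck_on k S (\<lambda>x. f x \<bullet> b)"
  shows "ck_on k S f"
proof -
  have "ck_on k S (\<lambda>x. \<Sum>b\<in>Basis. (f x \<bullet> b) *\<^sub>R b)"
    using assms by (intro ck_on_sum ck_on_scaleR) auto
  then show ?thesis by (simp add: euclidean_representation)
qed

text \<open>In the chain rule the direction fed to the derivative of \<open>g\<close> moves with
  \<open>x\<close>, while \<open>ck_on\<close> knows fixed directions only. Expanding that direction
  along \<open>Basis\<close> leaves products of C^k functions; this is why the middle space is
  Euclidean.\<close>

lemma ck_on_compose:
  fixes f :: "'a::real_normed_vector \<Rightarrow> 'b::euclidean_space"
  assumes "open S" "ck_on k S f" "ck_on k T g" "f ` S \<subseteq> T"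
  shows "ck_on k S (\<lambda>x. g (f x))"
  using assms(2,3)
proof (induction k arbitrary: g)
  case 0 then show ?case
    using assms(4) by (auto intro: continuous_on_compose2)
next
  case (Suc k)
  have D: "((\<lambda>x. g (f x)) has_derivative
      (\<lambda>v. frechet_derivative g (at (f x)) (frechet_derivative f (at x) v))) (at x)" if "x \<in> S" for x
    using Suc.prems that assms(4)
    by (auto intro!: has_derivative_compose[of f _ x UNIV g] differentiable_has_frechet)
  have E: "frechet_derivative (\<lambda>x. g (f x)) (at x) v =
     (\<Sum>b\<in>Basis. (frechet_derivative f (at x) v \<bullet> b) *\<^sub>R frechet_derivative g (at (f x)) b)"
    if "x \<in> S" for x v
  proof -
    have "linear (frechet_derivative g (at (f x)))"
      using Suc.prems(2) that assms(4) by (auto intro!: linear_frechet_derivative)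
    then show ?thesis
      unfolding frechet_derivative_eqI[OF D[OF that]]
      by (subst euclidean_representation[of "frechet_derivative f (at x) v", symmetric])
         (simp add: linear_sum linear_cmul)
  qed
  have "ck_on k S (\<lambda>x. frechet_derivative (\<lambda>x. g (f x)) (at x) v)" for v
  proof (rule ck_on_cong[OF assms(1)])
    have "ck_on k S f" using Suc.prems ck_on_Suc_lower by blast
    then show "ck_on k S (\<lambda>x. \<Sum>b\<in>Basis. (frechet_derivative f (at x) v \<bullet> b) *\<^sub>R
        frechet_derivative g (at (f x)) b)"
      using Suc.prems
      by (intro ck_on_sum[OF assms(1)] ck_on_scaleR[OF assms(1)] ck_on_inner[OF assms(1)] Suc.IH) auto
  qed (simp add: E)
  then show ?case using D by (auto intro: differentiableI)
qed

text \<open>The derivative of 1/f contains 1/f again, but needed one order of smoothness lower, so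
  the induction on \<open>k\<close> closes.\<close>

lemma ck_on_inverse:
  fixes f :: "'a::real_normed_vector \<Rightarrow> real"
  assumes "open S" "ck_on k S f" "\<And>x. x \<in> S \<Longrightarrow> f x \<noteq> 0"
  shows "ck_on k S (\<lambda>x. inverse (f x))"
  using assms(2)
proof (induction k)
  case 0 then show ?case using assms(3) by (auto intro: continuous_on_inverse)
next
  case (Suc k)
  have D: "((\<lambda>x. inverse (f x)) has_derivative
      (\<lambda>v. - (inverse (f x) * frechet_derivative f (at x) v * inverse (f x)))) (at x)" if "x \<in> S" for x
    using Suc.prems that assms(3)
    by (intro Deriv.has_derivative_inverse differentiable_has_frechet) auto
  have "ck_on k S (\<lambda>x. frechet_derivative (\<lambda>x. inverse (f x)) (at x) v)" for v
  proof (rule ck_on_cong[OF assms(1)])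
    have "ck_on k S f" using Suc.prems ck_on_Suc_lower by blast
    then show "ck_on k S (\<lambda>x. - (inverse (f x) * frechet_derivative f (at x) v * inverse (f x)))"
      using Suc by (intro ck_on_minus[OF assms(1)] ck_on_mult[OF assms(1)]) auto
  qed (simp add: frechet_derivative_eqI[OF D])
  then show ?case using D by (auto intro: differentiableI)
qed

lemma ck_on_polynomial_function:
  fixes f :: "'a::euclidean_space \<Rightarrow> 'b::euclidean_space"
  assumes "open S" "polynomial_function f" shows "ck_on k S f"
proof (rule ck_on_componentwise[OF assms(1)])
  fix b :: 'b assume "b \<in> Basis"
  then have "real_polynomial_function (\<lambda>x. f x \<bullet> b)"
    using assms(2) polynomial_function_iff_Basis_inner by blast
  then show "ck_on k S (\<lambda>x. f x \<bullet> b)"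
    by induction (auto intro: ck_on_add ck_on_mult ck_on_bounded_linear assms(1))
qed

lemma smooth_onI: "(\<And>k. ck_on k S f) \<Longrightarrow> smooth_on S f"
  by (simp add: smooth_on_def)

lemma smooth_onD: "smooth_on S f \<Longrightarrow> ck_on k S f"
  by (simp add: smooth_on_def)

lemma smooth_on_differentiable: "smooth_on S f \<Longrightarrow> x \<in> S \<Longrightarrow> f differentiable (at x)"
  using smooth_onD[of S f 1] by simp

lemma smooth_on_subset: "smooth_on S f \<Longrightarrow> T \<subseteq> S \<Longrightarrow> smooth_on T f"
  by (rule smooth_onI) (rule ck_on_subset[OF smooth_onD])

lemma smooth_on_cong: "open S \<Longrightarrow> (\<And>x. x \<in> S \<Longrightarrow> f x = g x) \<Longrightarrow> smooth_on S f \<Longrightarrow> smooth_on S g"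
  by (rule smooth_onI) (rule ck_on_cong[OF _ _ smooth_onD])

lemma smooth_on_local:
  "(\<And>x. x \<in> S \<Longrightarrow> \<exists>T. open T \<and> x \<in> T \<and> smooth_on T f) \<Longrightarrow> smooth_on S f"
  unfolding smooth_on_def by (metis ck_on_local)

lemma smooth_on_compose:
  fixes f :: "'a::real_normed_vector \<Rightarrow> 'b::euclidean_space"
  shows "open S \<Longrightarrow> smooth_on S f \<Longrightarrow> smooth_on T g \<Longrightarrow> f ` S \<subseteq> T \<Longrightarrow> smooth_on S (\<lambda>x. g (f x))"
  by (rule smooth_onI) (rule ck_on_compose[OF _ smooth_onD smooth_onD])

section \<open>A smooth bump function\<close>

text \<open>\<open>flat_exp 0\<close> is the classical smooth function that is flat at 0. The
  negative powers make the family closed under differentiation, so that smoothness at 0 is proved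
  for all members by a single induction.\<close>

definition flat_exp :: "nat \<Rightarrow> real \<Rightarrow> real" where
  "flat_exp n x = (if x > 0 then exp (- inverse x) * inverse x ^ n else 0)"

lemma flat_exp_pos: "x > 0 \<Longrightarrow> flat_exp n x > 0"
  by (simp add: flat_exp_def)

text \<open>With y = 1/x this is the fact that the exponential outgrows every power.\<close>

lemma flat_exp_tendsto_0: "(flat_exp n \<longlongrightarrow> 0) (at_right 0)"
proof -
  have "(((\<lambda>y::real. y ^ n / exp y) \<circ> inverse) \<longlongrightarrow> 0) (at_right 0)"
    unfolding o_def
    by (rule filterlim_compose[OF tendsto_power_div_exp_0 filterlim_inverse_at_top_right])
  moreover have "\<forall>\<^sub>F x in at_right 0. ((\<lambda>y::real. y ^ n / exp y) \<circ> inverse) x = flat_exp n x"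
    by (rule eventually_at_right_less[THEN eventually_mono]) (auto simp: flat_exp_def exp_minus divide_simps)
  ultimately show ?thesis by (rule Lim_transform_eventually)
qed

lemma flat_exp_deriv:
  "(flat_exp n has_real_derivative flat_exp (n + 2) x - n * flat_exp (n + 1) x) (at x)"
proof -
  consider "x > 0" | "x < 0" | "x = 0" by linarith
  then show ?thesis
  proof cases
    case 1
    have "((\<lambda>x. exp (- inverse x) * inverse x ^ n) has_real_derivative
        flat_exp (n + 2) x - n * flat_exp (n + 1) x) (at x)"
      using 1 by (auto intro!: derivative_eq_intros
          simp: flat_exp_def algebra_simps power2_eq_square)
        (cases n; simp add: algebra_simps)
    then show ?thesis
      by (rule has_field_derivative_transform_within_open[where S = "{0<..}"])
         (use 1 in \<open>auto simp: flat_exp_def\<close>)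
  next
    case 2
    have "((\<lambda>x. 0) has_real_derivative flat_exp (n + 2) x - n * flat_exp (n + 1) x) (at x)"
      using 2 by (simp add: flat_exp_def)
    then show ?thesis
      by (rule has_field_derivative_transform_within_open[where S = "{..<0}"])
         (use 2 in \<open>auto simp: flat_exp_def\<close>)
  next
    case 3
    \<comment> \<open>The difference quotient at 0 is \<open>flat_exp (Suc n)\<close> on the right
      and 0 on the left, so the limit at 0 is used with the next index.\<close>
    have "((\<lambda>h. flat_exp n h / h) \<longlongrightarrow> 0) (at 0)"
    proof (rule filterlim_split_at)
      show "((\<lambda>h. flat_exp n h / h) \<longlongrightarrow> 0) (at_left 0)"
        by (rule Lim_transform_eventually[OF tendsto_const])
           (rule eventually_at_leftI[of "-1"], auto simp: flat_exp_def)
      show "((\<lambda>h. flat_exp n h / h) \<longlongrightarrow> 0) (at_right 0)"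
        by (rule Lim_transform_eventually[OF flat_exp_tendsto_0[of "Suc n"]])
           (rule eventually_at_right_less[THEN eventually_mono], auto simp: flat_exp_def field_simps)
    qed
    then have "(flat_exp n has_real_derivative 0) (at 0)"
      by (simp add: DERIV_def flat_exp_def)
    then show ?thesis using 3 by (simp add: flat_exp_def)
  qed
qed

lemma ck_on_flat_exp: "ck_on k UNIV (flat_exp n)"
proof (induction k arbitrary: n)
  case 0
  show ?case using DERIV_isCont[OF flat_exp_deriv] by (auto intro!: continuous_at_imp_continuous_on)
next
  case (Suc k)
  have "(flat_exp n has_derivative (\<lambda>v. (flat_exp (n + 2) x - n * flat_exp (n + 1) x) * v)) (at x)" for x
    using flat_exp_deriv[of n x] by (simp add: has_field_derivative_def)
  note D = this
  have "ck_on k UNIV (\<lambda>x. (flat_exp (n + 2) x - n * flat_exp (n + 1) x) * v)" for v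
    by (intro ck_on_mult ck_on_diff Suc ck_on_const open_UNIV)
  then show ?case using D frechet_derivative_eqI[OF D] by (auto intro: differentiableI)
qed

lemma exists_smooth_bump:
  fixes a :: "'a::euclidean_space"
  assumes "0 < r" "r < s"
  obtains \<beta> :: "'a \<Rightarrow> real" where "smooth_on UNIV \<beta>" "\<And>x. 0 \<le> \<beta> x" "\<And>x. \<beta> x \<le> 1"
    "\<And>x. x \<in> cball a r \<Longrightarrow> \<beta> x = 1" "\<And>x. x \<notin> ball a s \<Longrightarrow> \<beta> x = 0"
proof
  \<comment> \<open>The squared distance is used because the distance itself is not smooth at the
    centre. \<open>u\<close> lives inside radius s and \<open>v\<close> outside radius r; as r < s
    they never vanish together, and u / (u + v) is the bump.\<close>
  define q where "q = (\<lambda>x::'a. (x - a) \<bullet> (x - a))"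
  define u where "u = (\<lambda>x. flat_exp 0 (s\<^sup>2 - q x))"
  define v where "v = (\<lambda>x. flat_exp 0 (q x - r\<^sup>2))"
  have q: "q x = (dist a x)\<^sup>2" for x
    by (simp add: q_def dist_norm power2_norm_eq_inner norm_minus_commute[of a x])
  have rs: "r\<^sup>2 < s\<^sup>2" using assms by (simp add: power_strict_mono)
  have nn: "0 \<le> u x" "0 \<le> v x" for x by (auto simp: u_def v_def flat_exp_def)
  have pos: "u x + v x > 0" for x
  proof (cases "q x < s\<^sup>2")
    case True
    then have "u x > 0" by (simp add: u_def flat_exp_pos)
    then show ?thesis using nn[of x] by linarith
  next
    case False
    then have "v x > 0" using rs by (simp add: v_def flat_exp_pos)
    then show ?thesis using nn[of x] by linarith
  qed
  have ckq: "ck_on k UNIV q" for k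
    unfolding q_def by (intro ck_on_bilinear[OF _ bounded_bilinear_inner] ck_on_diff) auto
  have "ck_on k UNIV u" "ck_on k UNIV v" for k
    unfolding u_def v_def
    by (intro ck_on_compose[OF _ _ ck_on_flat_exp] ck_on_diff ckq ck_on_const; simp)+
  then have "ck_on k UNIV (\<lambda>x. u x * inverse (u x + v x))" for k
    using pos by (intro ck_on_mult ck_on_inverse ck_on_add) (auto simp: less_le)
  then show "smooth_on UNIV (\<lambda>x. u x * inverse (u x + v x))"
    by (rule smooth_onI)
  show "0 \<le> u x * inverse (u x + v x)" "u x * inverse (u x + v x) \<le> 1" for x
    using nn[of x] pos[of x] by (auto simp: field_simps)
  show "u x * inverse (u x + v x) = 1" if "x \<in> cball a r" for x
  proof -
    have "q x \<le> r\<^sup>2" using that by (simp add: q power_mono)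
    then have "v x = 0" by (simp add: v_def flat_exp_def)
    then show ?thesis using pos[of x] by simp
  qed
  show "u x * inverse (u x + v x) = 0" if "x \<notin> ball a s" for x
  proof -
    have "s\<^sup>2 \<le> q x" using that assms by (simp add: q power_mono)
    then show ?thesis by (simp add: u_def flat_exp_def)
  qed
qed

section \<open>Parameter integrals and symmetry of second derivatives\<close>

text \<open>Differentiation under the integral asks for a derivative that is continuous as a bounded
  linear map, whereas \<open>ck_on\<close> yields continuity direction by direction; on a
  finite-dimensional domain these agree.\<close>

lemma continuous_on_Blinfun_frechet:
  fixes F :: "'a::t2_space \<Rightarrow> 'e::euclidean_space \<Rightarrow> 'f::real_normed_vector"
  assumes "\<And>x. x \<in> S \<Longrightarrow> linear (F x)" "\<And>v. continuous_on S (\<lambda>x. F x v)"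
  shows "continuous_on S (\<lambda>x. Blinfun (F x))"
proof (rule continuous_on_blinfun_componentwise)
  fix i :: 'e assume "i \<in> Basis"
  have "continuous_on S (\<lambda>x. F x i)" by (rule assms(2))
  then show "continuous_on S (\<lambda>x. blinfun_apply (Blinfun (F x)) i)"
    by (rule continuous_on_cong[THEN iffD1, rotated -1])
       (auto simp: bounded_linear_Blinfun_apply assms(1) linear_conv_bounded_linear[symmetric])
qed

text \<open>Leibniz' rule, with the derivative packed as a bounded linear map and evaluated at
  \<open>v\<close> afterwards. \<open>T\<close> is open around the closed strip because
  \<open>ck_on\<close> uses two-sided derivatives, also at t = 0 and t = 1.\<close>

lemma integral_param_derivative:
  fixes G :: "real \<times> 'e::euclidean_space \<Rightarrow> 'f::banach"
  assumes "open T" "{0..1} \<times> W \<subseteq> T" "open W" "convex W" "ck_on (Suc 0) T G" "y \<in> W"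
  shows "(\<lambda>y. integral {0..1} (\<lambda>t. G (t, y))) differentiable (at y)"
    and "frechet_derivative (\<lambda>y. integral {0..1} (\<lambda>t. G (t, y))) (at y) v =
      integral {0..1} (\<lambda>t. frechet_derivative G (at (t, y)) (0, v))"
proof -
  have dif: "G differentiable (at (t, y))" if "y \<in> W" "t \<in> {0..1}" for t y
  proof -
    have "(t, y) \<in> T" using that assms(2) by blast
    then show ?thesis using assms(5) by simp
  qed
  have Gy: "((\<lambda>z. G (t, z)) has_derivative (\<lambda>v. frechet_derivative G (at (t, y)) (0, v))) (at y)"
    if "y \<in> W" "t \<in> {0..1}" for t y
  proof -
    have P: "((\<lambda>z. (t, z)) has_derivative (\<lambda>v. (0, v))) (at y)"
      by (auto intro!: derivative_eq_intros)
    show ?thesis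
      by (rule has_derivative_compose[OF P differentiable_has_frechet[OF dif[OF that]]])
  qed
  have lin: "linear (\<lambda>v. frechet_derivative G (at (t, y)) (0, v))" if "y \<in> W" "t \<in> {0..1}" for t y
    using Gy[OF that] has_derivative_linear by blast
  define B where "B y t = Blinfun (\<lambda>v. frechet_derivative G (at (t, y)) (0, v))" for y t
  have Bapp: "blinfun_apply (B y t) v = frechet_derivative G (at (t, y)) (0, v)"
    if "y \<in> W" "t \<in> {0..1}" for t y v
    unfolding B_def using lin[OF that] by (simp add: bounded_linear_Blinfun_apply linear_conv_bounded_linear)
  have Bcont: "continuous_on (W \<times> cbox 0 1) (\<lambda>(y, t). B y t)"
    unfolding B_def case_prod_unfold
  proof (rule continuous_on_Blinfun_frechet)
    show "linear (\<lambda>v. frechet_derivative G (at (snd x, fst x)) (0, v))" if "x \<in> W \<times> cbox 0 1" for x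
      using lin that by auto
    fix v
    have "continuous_on T (\<lambda>p. frechet_derivative G (at p) (0, v))"
      using assms(5) by simp
    then show "continuous_on (W \<times> cbox 0 1) (\<lambda>x. frechet_derivative G (at (snd x, fst x)) (0, v))"
      by (rule continuous_on_compose2) (use assms(2) in \<open>auto intro!: continuous_intros\<close>)
  qed
  have GC: "continuous_on T G" using ck_on_continuous[OF assms(5)] .
  have int: "(\<lambda>t. G (t, y)) integrable_on cbox 0 1" if "y \<in> W" for y
    using assms(2) that
    by (intro integrable_continuous continuous_on_compose2[OF GC] continuous_intros) auto
  have D: "((\<lambda>y. integral (cbox 0 1) (\<lambda>t. G (t, y))) has_derivative
      blinfun_apply (integral (cbox 0 1) (B y))) (at y)" if "y \<in> W" for y
  proof -
    have "((\<lambda>y. integral (cbox 0 1) (\<lambda>t. G (t, y))) has_derivative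
      blinfun_apply (integral (cbox 0 1) (B y))) (at y within W)"
    proof (rule leibniz_rule[OF _ int Bcont that assms(4)])
      fix x t assume "x \<in> W" "t \<in> cbox 0 (1::real)"
      then have "blinfun_apply (B x t) = (\<lambda>v. frechet_derivative G (at (t, x)) (0, v))"
        using Bapp by fastforce
      with Gy[of x t] \<open>x \<in> W\<close> \<open>t \<in> cbox 0 1\<close>
      show "((\<lambda>y. G (t, y)) has_derivative blinfun_apply (B x t)) (at x within W)"
        by (auto intro: has_derivative_at_withinI)
    qed
    then show ?thesis using that assms(3) at_within_open by metis
  qed
  have Bint: "B y integrable_on cbox 0 1" if "y \<in> W" for y
  proof (rule integrable_continuous)
    have "continuous_on (cbox 0 1) (\<lambda>t. (case (y, t) of (y, t) \<Rightarrow> B y t))"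
      by (rule continuous_on_compose2[OF Bcont]) (use that in \<open>auto intro!: continuous_intros\<close>)
    then show "continuous_on (cbox 0 1) (B y)" by simp
  qed
  have E: "frechet_derivative (\<lambda>y. integral {0..1} (\<lambda>t. G (t, y))) (at y) v =
     integral {0..1} (\<lambda>t. frechet_derivative G (at (t, y)) (0, v))" if "y \<in> W" for y v
  proof -
    have "frechet_derivative (\<lambda>y. integral {0..1} (\<lambda>t. G (t, y))) (at y) v =
       blinfun_apply (integral (cbox 0 1) (B y)) v"
      using frechet_derivative_eqI[OF D[OF that]] by simp
    also have "\<dots> = integral (cbox 0 1) (\<lambda>t. blinfun_apply (B y t) v)"
      using integral_linear[OF Bint[OF that] blinfun.bounded_linear_left[of v]]
      by (simp add: o_def)
    also have "\<dots> = integral {0..1} (\<lambda>t. frechet_derivative G (at (t, y)) (0, v))"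
      using Bapp[OF that] by (auto intro!: integral_cong)
    finally show ?thesis .
  qed
  show "(\<lambda>y. integral {0..1} (\<lambda>t. G (t, y))) differentiable (at y)"
    using D[OF assms(6)] by (auto intro: differentiableI)
  show "frechet_derivative (\<lambda>y. integral {0..1} (\<lambda>t. G (t, y))) (at y) v =
      integral {0..1} (\<lambda>t. frechet_derivative G (at (t, y)) (0, v))"
    by (rule E[OF assms(6)])
qed

text \<open>Differentiating gives an integral of the same shape, with \<open>G\<close> replaced by
  its derivative in the direction \<open>(0, v)\<close>; hence the induction is over arbitrary
  \<open>G\<close>.\<close>

lemma ck_on_integral_param:
  fixes G :: "real \<times> 'e::euclidean_space \<Rightarrow> 'f::banach"
  assumes "open T" "{0..1} \<times> W \<subseteq> T" "open W" "convex W" "ck_on k T G"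
  shows "ck_on k W (\<lambda>y. integral {0..1} (\<lambda>t. G (t, y)))"
  using assms(5)
proof (induction k arbitrary: G)
  case 0
  have "continuous_on (W \<times> cbox 0 1) (\<lambda>(y, t). G (t, y))"
    unfolding case_prod_unfold using assms(2)
    by (intro continuous_on_compose2[OF 0[unfolded ck_on.simps]] continuous_intros) auto
  then show ?case using integral_continuous_on_param by fastforce
next
  case (Suc k)
  have "ck_on (Suc 0) T G" using Suc.prems by (rule ck_on_le) simp
  note D = integral_param_derivative[OF assms(1-4) this]
  have "ck_on k W (\<lambda>y. frechet_derivative (\<lambda>y. integral {0..1} (\<lambda>t. G (t, y))) (at y) v)" for v
  proof (rule ck_on_cong[OF assms(3)])
    show "ck_on k W (\<lambda>y. integral {0..1} (\<lambda>t. frechet_derivative G (at (t, y)) (0, v)))"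
      using Suc.IH[of "\<lambda>p. frechet_derivative G (at p) (0, v)"] Suc.prems by simp
  qed (simp add: D(2))
  then show ?case using D(1) by simp
qed

lemma has_vector_derivative_along_line:
  assumes "f differentiable (at (x + s *\<^sub>R u))"
  shows "((\<lambda>s. f (x + s *\<^sub>R u)) has_vector_derivative frechet_derivative f (at (x + s *\<^sub>R u)) u) (at s within X)"
proof -
  have "((\<lambda>s. x + s *\<^sub>R u) has_derivative (\<lambda>h. h *\<^sub>R u)) (at s within X)"
    by (auto intro!: derivative_eq_intros)
  from has_derivative_compose[OF this differentiable_has_frechet[OF assms]]
  show ?thesis
    unfolding has_vector_derivative_def
    by (simp add: linear_cmul linear_frechet_derivative[OF assms])
qed

text \<open>The increment \<open>f (x + s u + t v) - f (x + t v)\<close> is the integral of \<open>\<partial>\<^sub>u f\<close> along the segment;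
  differentiating it under the integral sign in \<open>t\<close>, and then in \<open>s\<close>, gives both mixed derivatives.\<close>

lemma symmetric_second_derivative:
  fixes f :: "'a::real_normed_vector \<Rightarrow> 'b::euclidean_space"
  assumes "open S" "ck_on 2 S f" "x \<in> S"
  shows "frechet_derivative (\<lambda>y. frechet_derivative f (at y) u) (at x) v =
         frechet_derivative (\<lambda>y. frechet_derivative f (at y) v) (at x) u"
proof -
  define Du where "Du w y = frechet_derivative f (at y) w" for w y
  define DD where "DD w z y = frechet_derivative (Du w) (at y) z" for w z y
  have ck: "f differentiable (at y)" "Du w differentiable (at y)" if "y \<in> S" for w y
    using assms(2) that by (auto simp: numeral_2_eq_2 Du_def[abs_def])
  have contD: "continuous_on S (Du w)" for w
    using assms(2) ck_on_continuous[of 1 S "Du w"] by (auto simp: numeral_2_eq_2 Du_def[abs_def])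
  have contDD: "continuous_on S (DD w z)" for w z
    using assms(2) by (auto simp: numeral_2_eq_2 DD_def[abs_def] Du_def[abs_def])
  obtain r where r: "r > 0" "ball x r \<subseteq> S" using assms(1,3) open_contains_ball by blast
  \<comment> \<open>Chosen so that x + s u + t v stays in the ball of radius r for |s|, |t| <= d.
    The summand 1 makes the estimate strict and keeps the quotient meaningful when u and v are both
    0.\<close>
  define d where "d = r / (norm u + norm v + 1)"
  have d: "d > 0" using r by (simp add: d_def add_nonneg_pos)
  have inS: "x + s *\<^sub>R u + t *\<^sub>R v \<in> S" if "\<bar>s\<bar> \<le> d" "\<bar>t\<bar> \<le> d" for s t
  proof -
    have "norm (s *\<^sub>R u + t *\<^sub>R v) \<le> d * norm u + d * norm v"
      using that by (intro order_trans[OF norm_triangle_ineq] add_mono) (auto intro: mult_right_mono)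
    also have "\<dots> < d * (norm u + norm v + 1)" using d by (simp add: algebra_simps)
    also have "\<dots> = r" by (simp add: d_def add_nonneg_pos order_less_imp_not_eq2)
    finally have "dist (x + (s *\<^sub>R u + t *\<^sub>R v)) x < r" by (simp only: dist_norm add_diff_cancel_left')
    then have "dist x (x + s *\<^sub>R u + t *\<^sub>R v) < r" by (simp add: dist_commute add.assoc)
    then show ?thesis using r by auto
  qed
  have main: "Du v (x + s *\<^sub>R u) - Du v x = integral {0..s} (\<lambda>r. DD u v (x + r *\<^sub>R u))"
    if s: "s \<in> {0..d}" for s
  proof -
    have ftc: "((\<lambda>r. Du u (x + r *\<^sub>R u + t *\<^sub>R v)) has_integral
        f (x + s *\<^sub>R u + t *\<^sub>R v) - f (x + t *\<^sub>R v)) {0..s}" if t: "t \<in> {-d..d}" for t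
    proof -
      have "((\<lambda>r. f ((x + t *\<^sub>R v) + r *\<^sub>R u)) has_vector_derivative
          Du u ((x + t *\<^sub>R v) + r *\<^sub>R u)) (at r within {0..s})" if "r \<in> {0..s}" for r
        unfolding Du_def
        by (rule has_vector_derivative_along_line, rule ck)
           (use inS[of r t] that s t in \<open>auto simp: algebra_simps\<close>)
      from fundamental_theorem_of_calculus[OF _ this] s show ?thesis
        by (simp add: algebra_simps)
    qed
    have "((\<lambda>t. integral (cbox 0 s) (\<lambda>r. Du u (x + r *\<^sub>R u + t *\<^sub>R v))) has_vector_derivative
        integral (cbox 0 s) (\<lambda>r. DD u v (x + r *\<^sub>R u + 0 *\<^sub>R v))) (at 0 within {-d..d})"
    proof (rule leibniz_rule_vector_derivative)
      show "(\<lambda>r. Du u (x + r *\<^sub>R u + t *\<^sub>R v)) integrable_on cbox 0 s" if "t \<in> {-d..d}" for t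
        using ftc[OF that] by auto
      show "((\<lambda>t. Du u (x + r *\<^sub>R u + t *\<^sub>R v)) has_vector_derivative
          DD u v (x + r *\<^sub>R u + t *\<^sub>R v)) (at t within {-d..d})"
        if "t \<in> {-d..d}" "r \<in> cbox 0 s" for t r
        unfolding DD_def
        by (rule has_vector_derivative_along_line, rule ck, rule inS) (use that s in auto)
      show "continuous_on ({-d..d} \<times> cbox 0 s) (\<lambda>(t, r). DD u v (x + r *\<^sub>R u + t *\<^sub>R v))"
        unfolding case_prod_unfold
        by (rule continuous_on_compose2[OF contDD])
           (use s in \<open>auto intro!: continuous_intros inS\<close>)
    qed (use d in auto)
    then have "((\<lambda>t. integral {0..s} (\<lambda>r. Du u (x + r *\<^sub>R u + t *\<^sub>R v))) has_vector_derivative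
        integral {0..s} (\<lambda>r. DD u v (x + r *\<^sub>R u))) (at 0 within {-d..d})"
      by simp
    then have "((\<lambda>t. f (x + s *\<^sub>R u + t *\<^sub>R v) - f (x + t *\<^sub>R v)) has_vector_derivative
        integral {0..s} (\<lambda>r. DD u v (x + r *\<^sub>R u))) (at 0 within {-d..d})"
      by (rule has_vector_derivative_transform[rotated 2]) (use d integral_unique[OF ftc] in auto)
    then have 1: "((\<lambda>t. f (x + s *\<^sub>R u + t *\<^sub>R v) - f (x + t *\<^sub>R v)) has_vector_derivative
        integral {0..s} (\<lambda>r. DD u v (x + r *\<^sub>R u))) (at 0)"
      using at_within_Icc_at[of "-d" 0 d] d by simp
    have "((\<lambda>t. f (x + s *\<^sub>R u + t *\<^sub>R v) - f (x + t *\<^sub>R v)) has_vector_derivative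
        Du v (x + s *\<^sub>R u + 0 *\<^sub>R v) - Du v (x + 0 *\<^sub>R v)) (at 0)"
      unfolding Du_def
      by (intro has_vector_derivative_diff has_vector_derivative_along_line ck)
         (use inS[of s 0] inS[of 0 0] d s in auto)
    from vector_derivative_unique_at[OF this 1] show ?thesis by simp
  qed
  \<comment> \<open>\<open>main\<close> covers s >= 0, so both derivatives at 0 are one-sided; on a
    nondegenerate interval such a derivative is still unique.\<close>
  have "((\<lambda>s. integral {0..s} (\<lambda>r. DD u v (x + r *\<^sub>R u))) has_vector_derivative
      DD u v (x + 0 *\<^sub>R u)) (at 0 within {0..d})"
    by (rule integral_has_vector_derivative, rule continuous_on_compose2[OF contDD])
       (use inS[of _ 0] d in \<open>auto intro!: continuous_intros\<close>)
  then have "((\<lambda>s. integral {0..s} (\<lambda>r. DD u v (x + r *\<^sub>R u))) has_vector_derivative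
      DD u v x) (at 0 within {0..d})" by simp
  then have "((\<lambda>s. Du v (x + s *\<^sub>R u) - Du v x) has_vector_derivative DD u v x) (at 0 within {0..d})"
    by (rule has_vector_derivative_transform[rotated 2]) (use d main in auto)
  moreover have "((\<lambda>s. Du v (x + s *\<^sub>R u) - Du v x) has_vector_derivative DD v u (x + 0 *\<^sub>R u) - 0) (at 0 within {0..d})"
    unfolding DD_def
    by (intro has_vector_derivative_diff has_vector_derivative_along_line ck has_vector_derivative_const)
       (use assms(3) in auto)
  ultimately have "DD u v x = DD v u x"
    using vector_derivative_unique_within_closed_interval[of 0 d 0] d by simp
  then show ?thesis by (simp add: DD_def Du_def[abs_def])
qed

section \<open>Linear algebra in dimension four\<close>

lemma vector_4 [simp]:
  "(vector [x, y, z, w] :: 'a::zero^4) $ 1 = x"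
  "(vector [x, y, z, w] :: 'a::zero^4) $ 2 = y"
  "(vector [x, y, z, w] :: 'a::zero^4) $ 3 = z"
  "(vector [x, y, z, w] :: 'a::zero^4) $ 4 = w"
  unfolding vector_def by simp_all

lemma det_4:
  "det (A::'a::comm_ring_1^4^4) =
    A$1$1*A$2$2*A$3$3*A$4$4 - A$1$1*A$2$2*A$3$4*A$4$3 - A$1$1*A$2$3*A$3$2*A$4$4 + A$1$1*A$2$3*A$3$4*A$4$2
  + A$1$1*A$2$4*A$3$2*A$4$3 - A$1$1*A$2$4*A$3$3*A$4$2 - A$1$2*A$2$1*A$3$3*A$4$4 + A$1$2*A$2$1*A$3$4*A$4$3
  + A$1$2*A$2$3*A$3$1*A$4$4 - A$1$2*A$2$3*A$3$4*A$4$1 - A$1$2*A$2$4*A$3$1*A$4$3 + A$1$2*A$2$4*A$3$3*A$4$1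
  + A$1$3*A$2$1*A$3$2*A$4$4 - A$1$3*A$2$1*A$3$4*A$4$2 - A$1$3*A$2$2*A$3$1*A$4$4 + A$1$3*A$2$2*A$3$4*A$4$1
  + A$1$3*A$2$4*A$3$1*A$4$2 - A$1$3*A$2$4*A$3$2*A$4$1 - A$1$4*A$2$1*A$3$2*A$4$3 + A$1$4*A$2$1*A$3$3*A$4$2
  + A$1$4*A$2$2*A$3$1*A$4$3 - A$1$4*A$2$2*A$3$3*A$4$1 - A$1$4*A$2$3*A$3$1*A$4$2 + A$1$4*A$2$3*A$3$2*A$4$1"
proof -
  have f1: "finite {2::4, 3, 4}" "1 \<notin> {2::4, 3, 4}" by auto
  have f2: "finite {3::4, 4}" "2 \<notin> {3::4, 4}" by auto
  have f3: "finite {4::4}" "3 \<notin> {4::4}" by auto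
  show ?thesis
    unfolding det_def UNIV_4
    unfolding sum_over_permutations_insert[OF f1]
    unfolding sum_over_permutations_insert[OF f2]
    unfolding sum_over_permutations_insert[OF f3]
    unfolding permutes_sing
    by (simp add: sign_swap_id permutation_swap_id permutation_compose sign_compose sign_id swap_id_eq)
qed

text \<open>The value of b wedge b on four vectors, that is twice the Pfaffian of the matrix of
  \<open>b\<close> on them: each of the three ways to pair the vectors occurs in two
  shuffles.\<close>

definition wedge_sq :: "('v \<Rightarrow> 'v \<Rightarrow> real) \<Rightarrow> 'v \<Rightarrow> 'v \<Rightarrow> 'v \<Rightarrow> 'v \<Rightarrow> real" where
  "wedge_sq b w x y z = 2 * (b w x * b y z - b w y * b x z + b w z * b x y)"

lemma vec4_expand:
  fixes u :: "real^4"
  shows "u = u$1 *\<^sub>R axis 1 1 + u$2 *\<^sub>R axis 2 1 + u$3 *\<^sub>R axis 3 1 + u$4 *\<^sub>R axis 4 1"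
  by (simp add: vec_eq_iff forall_4 axis_def)

text \<open>Skewness is polarised from \<open>b u u = 0\<close>; bilinearity then leaves the six
  components with i < j, each against a 2 by 2 minor of (u, v).\<close>

lemma alternating_4:
  fixes b :: "real^4 \<Rightarrow> real^4 \<Rightarrow> real"
  assumes "bilinear b" "\<And>u. b u u = 0"
  shows "b u v =
      b (axis 1 1) (axis 2 1) * (u$1 * v$2 - u$2 * v$1) + b (axis 1 1) (axis 3 1) * (u$1 * v$3 - u$3 * v$1)
    + b (axis 1 1) (axis 4 1) * (u$1 * v$4 - u$4 * v$1) + b (axis 2 1) (axis 3 1) * (u$2 * v$3 - u$3 * v$2)
    + b (axis 2 1) (axis 4 1) * (u$2 * v$4 - u$4 * v$2) + b (axis 3 1) (axis 4 1) * (u$3 * v$4 - u$4 * v$3)"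
proof -
  have skew: "b y x = - b x y" for x y
    using assms(2)[of "x + y"] assms(2)[of x] assms(2)[of y]
    by (simp add: bilinear_ladd[OF assms(1)] bilinear_radd[OF assms(1)])
  note bs = bilinear_ladd[OF assms(1)] bilinear_radd[OF assms(1)]
    bilinear_lmul[OF assms(1)] bilinear_rmul[OF assms(1)] assms(2)
    skew[of "axis 1 1" "axis 2 1"] skew[of "axis 1 1" "axis 3 1"] skew[of "axis 1 1" "axis 4 1"]
    skew[of "axis 2 1" "axis 3 1"] skew[of "axis 2 1" "axis 4 1"] skew[of "axis 3 1" "axis 4 1"]
  show ?thesis
    by (subst vec4_expand[of u], subst vec4_expand[of v]) (simp add: bs algebra_simps)
qed

text \<open>The law Pf(E^T B E) = det E Pf B in dimension 4, verified as a polynomial identity in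
  the entries of \<open>E\<close> and the six components of \<open>b\<close>. It serves both for
  changes of chart and for passing from coordinate vectors to an orthonormal frame.\<close>

lemma wedge_sq_det:
  fixes b :: "real^4 \<Rightarrow> real^4 \<Rightarrow> real" and E :: "real^4^4"
  assumes "bilinear b" "\<And>u. b u u = 0"
  shows "wedge_sq b (column 1 E) (column 2 E) (column 3 E) (column 4 E) =
    det E * wedge_sq b (axis 1 1) (axis 2 1) (axis 3 1) (axis 4 1)"
proof -
  have c: "column j E $ i = E $ i $ j" for i j by (simp add: column_def)
  note ex = alternating_4[OF assms, of "column i E" "column j E" for i j, unfolded c]
  show ?thesis
    unfolding wedge_sq_def det_4 ex[of 1 2] ex[of 1 3] ex[of 1 4] ex[of 2 3] ex[of 2 4] ex[of 3 4]
    by algebra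
qed

text \<open>Subtracting the projection and normalising adds one vector at a time. The induction runs
  over subsets of the index type, which carries no order; fewer than \<open>CARD('n)\<close> vectors
  never span, so a new vector to start from exists.\<close>

lemma gram_schmidt:
  fixes G :: "real^'n \<Rightarrow> real^'n \<Rightarrow> real"
  assumes "bilinear G" "\<And>u v. G u v = G v u" "\<And>u. u \<noteq> 0 \<Longrightarrow> G u u > 0"
  obtains e :: "'n \<Rightarrow> real^'n" where "\<And>i j. G (e i) (e j) = (if i = j then 1 else 0)"
proof -
  note bs = bilinear_ladd[OF assms(1)] bilinear_radd[OF assms(1)] bilinear_lsub[OF assms(1)]
    bilinear_lmul[OF assms(1)] bilinear_rmul[OF assms(1)]
  have "\<exists>e::'n \<Rightarrow> real^'n. \<forall>i\<in>I. \<forall>j\<in>I. G (e i) (e j) = (if i = j then 1 else 0)" for I :: "'n set"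
  proof (induction I rule: finite_induct[OF finite])
    case (2 k I)
    then obtain e where e: "\<And>i j. i \<in> I \<Longrightarrow> j \<in> I \<Longrightarrow> G (e i) (e j) = (if i = j then 1 else 0)"
      by blast
    have "card (e ` I) \<le> card I" by (simp add: card_image_le)
    also have "card I < card (insert k I)" using 2 by simp
    also have "\<dots> \<le> CARD('n)" by (rule card_mono) auto
    finally have "dim (span (e ` I)) < DIM(real^'n)"
      using dim_le_card'[of "e ` I"] by simp
    then have "span (e ` I) \<noteq> UNIV" by (metis dim_UNIV less_irrefl)
    then obtain x where x: "x \<notin> span (e ` I)" by auto
    define y where "y = x - (\<Sum>i\<in>I. G x (e i) *\<^sub>R e i)"
    have "(\<Sum>i\<in>I. G x (e i) *\<^sub>R e i) \<in> span (e ` I)"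
      by (intro span_sum span_scale span_base) auto
    then have "y \<noteq> 0" using x by (auto simp: y_def)
    then have pos: "G y y > 0" by (rule assms(3))
    have orth: "G y (e j) = 0" if "j \<in> I" for j
    proof -
      have lin: "linear (\<lambda>z. G z (e j))" using assms(1) by (simp add: bilinear_def)
      have "G (\<Sum>i\<in>I. G x (e i) *\<^sub>R e i) (e j) = (\<Sum>i\<in>I. G x (e i) * G (e i) (e j))"
        by (subst linear_sum[OF lin]) (simp add: bs)
      also have "\<dots> = (\<Sum>i\<in>I. if i = j then G x (e i) else 0)"
        by (rule sum.cong) (auto simp: e that)
      also have "\<dots> = G x (e j)" using that 2 by simp
      finally show ?thesis by (simp add: y_def bs)
    qed
    then have orth': "G (e j) y = 0" if "j \<in> I" for j using that assms(2)[of y "e j"] by simp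
    define e' where "e' = e(k := (1 / sqrt (G y y)) *\<^sub>R y)"
    have "G (e' i) (e' j) = (if i = j then 1 else 0)" if "i \<in> insert k I" "j \<in> insert k I" for i j
      using that 2(2) e orth orth' pos by (auto simp: e'_def bs)
    then show ?case by blast
  qed auto
  then show ?thesis using that by (metis UNIV_I)
qed

section \<open>Gram matrix and dual frame of an orthonormal frame\<close>

lemma bilinear_matrix_form:
  fixes G :: "real^'n \<Rightarrow> real^'n \<Rightarrow> real"
  assumes "bilinear G"
  shows "G u v = (\<Sum>i\<in>UNIV. \<Sum>j\<in>UNIV. u$i * v$j * G (axis i 1) (axis j 1))"
proof -
  have r: "w = (\<Sum>i\<in>UNIV. w$i *\<^sub>R axis i 1)" for w :: "real^'n"
    using basis_expansion[of w] by (simp add: scalar_mult_eq_scaleR)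
  have "G u v = G (\<Sum>i\<in>UNIV. u$i *\<^sub>R axis i 1) (\<Sum>i\<in>UNIV. v$i *\<^sub>R axis i 1)" using r by metis
  also have "\<dots> = (\<Sum>i\<in>UNIV. \<Sum>j\<in>UNIV. u$i * v$j * G (axis i 1) (axis j 1))"
    by (simp add: bilinear_sum[OF assms] sum.cartesian_product bilinear_lmul[OF assms]
        bilinear_rmul[OF assms] mult.assoc mult.left_commute)
  finally show ?thesis .
qed

context
  fixes G :: "real^4 \<Rightarrow> real^4 \<Rightarrow> real" and E :: "real^4^4"
  assumes G: "bilinear G"
    and ortho: "\<And>i j. G (column i E) (column j E) = (if i = j then 1 else 0)"
begin

abbreviation "gram \<equiv> (\<chi> i j. G (axis i 1) (axis j 1)) :: real^4^4"
abbreviation "coframe \<equiv> (\<chi> i j. G (column i E) (axis j 1)) :: real^4^4"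

text \<open>Row i of \<open>coframe\<close> is the covector G(e_i, .), so its product with the frame
  matrix is the table of inner products of the frame.\<close>

lemma coframe_mult_frame: "coframe ** E = mat 1"
proof -
  have "(\<Sum>k\<in>UNIV. G (column i E) (axis k 1) * E$k$j) = G (column i E) (column j E)" for i j
  proof -
    have lin: "linear (G (column i E))" using G by (simp add: bilinear_def)
    have "column j E = (\<Sum>k\<in>UNIV. E$k$j *\<^sub>R axis k 1)"
      using basis_expansion[of "column j E"] by (simp add: scalar_mult_eq_scaleR column_def)
    then have "G (column i E) (column j E) = (\<Sum>k\<in>UNIV. G (column i E) (E$k$j *\<^sub>R axis k 1))"
      using linear_sum[OF lin] by metis
    then show ?thesis by (simp add: bilinear_rmul[OF G] mult.commute)
  qed
  then show ?thesis by (simp add: matrix_matrix_mult_def mat_def ortho)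
qed

lemma det_coframe_frame: "det coframe * det E = 1"
  using arg_cong[OF coframe_mult_frame, of det] by (simp add: det_mul)

lemma transpose_coframe: "coframe = transpose E ** gram"
proof -
  have "G (column i E) (axis j 1) = (\<Sum>k\<in>UNIV. E$k$i * G (axis k 1) (axis j 1))" for i j
    by (subst bilinear_matrix_form[OF G]) (simp add: column_def axis_def if_distrib[of "\<lambda>x. _ * x * _"] cong: if_cong)
  then show ?thesis by (simp add: vec_eq_iff matrix_matrix_mult_def transpose_def)
qed

lemma det_gram: "det gram * det E * det E = 1"
proof -
  have "det coframe = det E * det gram" unfolding transpose_coframe by (simp add: det_mul)
  then show ?thesis using det_coframe_frame by (simp add: mult.commute mult.left_commute)
qed

text \<open>Rearranged from E^T G E = 1. A metric determines its frames only up to an orthogonal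
  change, whereas E E^T is the inverse Gram matrix and so the same for all of them.\<close>

lemma gram_inverse: "gram ** (E ** transpose E) = mat 1"
proof -
  have "transpose E ** gram ** E = mat 1" using coframe_mult_frame transpose_coframe by metis
  then have "E ** (transpose E ** gram) = mat 1"
    using matrix_left_right_inverse by blast
  then have "(E ** transpose E) ** gram = mat 1" by (simp only: matrix_mul_assoc)
  then show ?thesis using matrix_left_right_inverse by blast
qed

text \<open>The classical coefficient sqrt(det g) of the volume form. The two determinants are the
  powers -1 and -2 of det E, and positivity of the frame selects the root.\<close>

lemma det_coframe_eq_sqrt:
  assumes "det E > 0" shows "det coframe = sqrt (det gram)"
proof -
  have "det coframe = inverse (det E)"
    using det_coframe_frame assms by (simp add: field_simps)
  moreover have "det gram = (inverse (det E))\<^sup>2"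
    using det_gram assms by (simp add: field_simps power2_eq_square)
  ultimately show ?thesis using assms by simp
qed

text \<open>Cramer's rule for the columns of the inverse. As a quotient of determinants of metric
  coefficients the inverse metric is visibly continuous.\<close>

lemma inverse_gram_entry:
  "(E ** transpose E) $ k $ m =
     det (\<chi> i j. if j = k then (if i = m then 1 else 0) else gram $ i $ j) / det gram"
proof -
  have nz: "det gram \<noteq> 0" using det_gram by auto
  have "gram *v column m (E ** transpose E) = axis m 1"
    using gram_inverse matrix_vector_mult_basis[of "E ** transpose E" m]
      matrix_vector_mul_assoc[of gram "E ** transpose E" "axis m 1"]
    by (simp add: matrix_vector_mul_lid)
  then have "column m (E ** transpose E) =
      (\<chi> k. det (\<chi> i j. if j = k then axis m 1 $ i else gram $ i $ j) / det gram)"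
    using cramer[OF nz] by blast
  then have "column m (E ** transpose E) $ k =
      det (\<chi> i j. if j = k then axis m 1 $ i else gram $ i $ j) / det gram"
    by simp
  then show ?thesis
    by (simp add: column_def) (simp add: axis_def eq_commute[of m] cong: if_cong)
qed

text \<open>The right-hand side involves the frame only through the inverse Gram matrix, so it is continuous
  even though orthonormal frames are chosen pointwise.\<close>

lemma frame_norm_eq:
  assumes "bilinear b"
  shows "(\<Sum>i\<in>UNIV. \<Sum>j\<in>UNIV. b (column i E) (column j E) * b (column i E) (column j E)) =
    trace ((\<chi> i j. b (axis i 1) (axis j 1)) ** (E ** transpose E)
      ** transpose (\<chi> i j. b (axis i 1) (axis j 1)) ** (E ** transpose E))"
proof -
  define B where "B = ((\<chi> i j. b (axis i 1) (axis j 1)) :: real^4^4)"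
  \<comment> \<open>The components of \<open>b\<close> in the frame form M = E^T B E, and the sum is
    the trace of M M^T. Cyclicity moves the outer E^T to the end, so that E occurs only through E
    E^T.\<close>
  define M where "M = transpose E ** B ** E"
  have M: "b (column i E) (column j E) = M $ i $ j" for i j
  proof -
    have "b (column i E) (column j E) = (\<Sum>k\<in>UNIV. \<Sum>l\<in>UNIV. E$k$i * E$l$j * B$k$l)"
      by (subst bilinear_matrix_form[OF assms]) (simp add: B_def column_def)
    also have "\<dots> = (\<Sum>l\<in>UNIV. \<Sum>k\<in>UNIV. E$k$i * E$l$j * B$k$l)" by (rule sum.swap)
    also have "\<dots> = M $ i $ j"
      by (simp add: M_def matrix_matrix_mult_def transpose_def sum_distrib_left sum_distrib_right
          mult.assoc mult.commute[of "E $ _ $ j"])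
    finally show ?thesis .
  qed
  have "(\<Sum>i\<in>UNIV. \<Sum>j\<in>UNIV. M $ i $ j * M $ i $ j) = trace (M ** transpose M)"
    by (simp add: trace_def matrix_matrix_mult_def transpose_def)
  also have "M ** transpose M = transpose E ** (B ** (E ** transpose E) ** transpose B ** E)"
    by (simp add: M_def matrix_transpose_mul matrix_mul_assoc)
  also have "trace \<dots> = trace (B ** (E ** transpose E) ** transpose B ** (E ** transpose E))"
    by (subst trace_mul_sym) (simp only: matrix_mul_assoc)
  finally show ?thesis by (simp add: M B_def)
qed

end

text \<open>The factor 1/2 cancels the double count of index pairs, which leaves six squares;
  \<open>wedge_sq\<close> supplies exactly the cross terms that combine them into three.\<close>

lemma form_norm_pos_eq:
  fixes p :: "4 \<Rightarrow> 4 \<Rightarrow> real"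
  assumes "\<And>i j. p j i = - p i j"
  shows "1 / 2 * (\<Sum>i\<in>UNIV. \<Sum>j\<in>UNIV. p i j * p i j) - wedge_sq p 1 2 3 4 =
      (p 1 2 - p 3 4)\<^sup>2 + (p 1 3 + p 2 4)\<^sup>2 + (p 1 4 - p 2 3)\<^sup>2"
    and "1 / 2 * (\<Sum>i\<in>UNIV. \<Sum>j\<in>UNIV. p i j * p i j) + wedge_sq p 1 2 3 4 =
      (p 1 2 + p 3 4)\<^sup>2 + (p 1 3 - p 2 4)\<^sup>2 + (p 1 4 + p 2 3)\<^sup>2"
proof -
  have d: "p i i = 0" for i using assms[of i i] by simp
  show "1 / 2 * (\<Sum>i\<in>UNIV. \<Sum>j\<in>UNIV. p i j * p i j) - wedge_sq p 1 2 3 4 =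
      (p 1 2 - p 3 4)\<^sup>2 + (p 1 3 + p 2 4)\<^sup>2 + (p 1 4 - p 2 3)\<^sup>2"
    "1 / 2 * (\<Sum>i\<in>UNIV. \<Sum>j\<in>UNIV. p i j * p i j) + wedge_sq p 1 2 3 4 =
      (p 1 2 + p 3 4)\<^sup>2 + (p 1 3 - p 2 4)\<^sup>2 + (p 1 4 + p 2 3)\<^sup>2"
    by (simp_all add: sum_4 d wedge_sq_def assms[of 2 1] assms[of 3 1] assms[of 4 1] assms[of 3 2]
        assms[of 4 2] assms[of 4 3] power2_eq_square algebra_simps)
qed

text \<open>Two columns are unit vectors, so each determinant is up to sign the 2 by 2 minor of (U,
  V) in the complementary rows; the factor 1/2 cancels the two orders of i and j.\<close>

lemma hodge_components:
  fixes p :: "4 \<Rightarrow> 4 \<Rightarrow> real" and U V :: "4 \<Rightarrow> real"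
  assumes "\<And>i j. p j i = - p i j"
  shows "1 / 2 * (\<Sum>i\<in>UNIV. \<Sum>j\<in>UNIV. p i j *
      det ((\<chi> m. vector [if m = i then 1 else 0, if m = j then 1 else 0, U m, V m]) :: real^4^4)) =
    p 3 4 * (U 1 * V 2 - U 2 * V 1) - p 2 4 * (U 1 * V 3 - U 3 * V 1) + p 2 3 * (U 1 * V 4 - U 4 * V 1)
    + p 1 4 * (U 2 * V 3 - U 3 * V 2) - p 1 3 * (U 2 * V 4 - U 4 * V 2) + p 1 2 * (U 3 * V 4 - U 4 * V 3)"
proof -
  have d: "p i i = 0" for i using assms[of i i] by simp
  show ?thesis
    by (simp add: sum_4 d det_4 assms[of 2 1] assms[of 3 1] assms[of 4 1] assms[of 3 2]
        assms[of 4 2] assms[of 4 3] algebra_simps)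
qed

section \<open>Compactly supported integrands\<close>

text \<open>\<open>U\<close> and the complement of \<open>K\<close> are open and cover the space; on
  the first the extended function is \<open>h\<close>, on the second it is 0.\<close>

lemma continuous_on_extend_zero:
  fixes h :: "'a::t2_space \<Rightarrow> 'b::{topological_space, zero}"
  assumes "open U" "compact K" "K \<subseteq> U" "continuous_on U h" "\<And>x. x \<in> U - K \<Longrightarrow> h x = 0"
  shows "continuous_on UNIV (\<lambda>x. if x \<in> U then h x else 0)"
proof -
  have "continuous_on (U \<union> - K) (\<lambda>x. if x \<in> U then h x else 0)"
  proof (rule continuous_on_open_Un)
    show "continuous_on U (\<lambda>x. if x \<in> U then h x else 0)"
      using assms(4) by (simp cong: continuous_on_cong)
    have "continuous_on (- K) (\<lambda>x. 0 :: 'b)" by simp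
    then show "continuous_on (- K) (\<lambda>x. if x \<in> U then h x else 0)"
      by (rule continuous_on_eq) (use assms(5) in auto)
  qed (use assms compact_imp_closed in auto)
  moreover have "U \<union> - K = UNIV" using assms(3) by blast
  ultimately show ?thesis by simp
qed

lemma ck_on_extend_zero:
  fixes h :: "'a::real_normed_vector \<Rightarrow> 'b::real_normed_vector"
  assumes "open U" "compact K" "K \<subseteq> U" "ck_on k U h" "\<And>x. x \<in> U - K \<Longrightarrow> h x = 0"
  shows "ck_on k UNIV (\<lambda>x. if x \<in> U then h x else 0)"
proof (rule ck_on_local)
  fix x :: 'a
  consider "x \<in> U" | "x \<in> - K" using assms(3) by blast
  then show "\<exists>T. open T \<and> x \<in> T \<and> ck_on k T (\<lambda>x. if x \<in> U then h x else 0)"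
  proof cases
    case 1
    have "ck_on k U (\<lambda>x. if x \<in> U then h x else 0)"
      by (rule ck_on_cong[OF assms(1) _ assms(4)]) simp
    then show ?thesis using 1 assms(1) by blast
  next
    case 2
    have "open (- K)" using assms(2) by (simp add: compact_imp_closed open_Compl)
    moreover have "ck_on k (- K) (\<lambda>x. if x \<in> U then h x else 0)"
      by (rule ck_on_cong[OF \<open>open (- K)\<close> _ ck_on_const[of k _ 0]]) (use assms(5) in auto)
    ultimately show ?thesis using 2 by blast
  qed
qed

lemma absolutely_integrable_compact_support:
  fixes h :: "'a::euclidean_space \<Rightarrow> 'b::euclidean_space"
  assumes "open U" "compact K" "K \<subseteq> U" "continuous_on U h" "\<And>x. x \<in> U - K \<Longrightarrow> h x = 0"
  shows "h absolutely_integrable_on U"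
proof -
  let ?f = "\<lambda>x. if x \<in> U then h x else 0"
  obtain a b where ab: "K \<subseteq> cbox a b" using compact_imp_bounded[OF assms(2)] bounded_subset_cbox_symmetric by metis
  have c: "continuous_on UNIV ?f" by (rule continuous_on_extend_zero[OF assms])
  have "?f absolutely_integrable_on cbox a b"
    by (rule absolutely_integrable_continuous) (rule continuous_on_subset[OF c], simp)
  then have "(\<lambda>x. if x \<in> cbox a b then ?f x else 0) absolutely_integrable_on UNIV"
    by (simp only: absolutely_integrable_restrict_UNIV)
  moreover have "(\<lambda>x. if x \<in> cbox a b then ?f x else 0) = ?f" using ab assms(5) by fastforce
  ultimately show ?thesis by (simp only: absolutely_integrable_restrict_UNIV)
qed

lemma integrable_compact_support:
  fixes h :: "'a::euclidean_space \<Rightarrow> 'b::euclidean_space"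
  assumes "open U" "compact K" "K \<subseteq> U" "continuous_on U h" "\<And>x. x \<in> U - K \<Longrightarrow> h x = 0"
  shows "h integrable_on U"
  using absolutely_integrable_compact_support[OF assms] absolutely_integrable_on_def by blast

lemma integral_eq_0_compact_support:
  fixes h :: "'a::euclidean_space \<Rightarrow> real"
  assumes "open U" "compact K" "K \<subseteq> U" "continuous_on U h" "\<And>x. x \<in> U - K \<Longrightarrow> h x = 0"
    and "\<And>x. x \<in> U \<Longrightarrow> h x \<ge> 0" "integral U h = 0" "x \<in> U"
  shows "h x = 0"
proof -
  let ?f = "\<lambda>x. if x \<in> U then h x else 0"
  \<comment> \<open>\<open>x\<close> is added so that the open box contains it; this also makes the
    box nondegenerate, as the criterion for a vanishing integral requires.\<close>
  have "bounded (insert x K)" using assms(2) compact_imp_bounded by auto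
  then obtain a where a: "insert x K \<subseteq> box (- a) a"
    using bounded_subset_box_symmetric by metis
  have c: "continuous_on UNIV ?f" by (rule continuous_on_extend_zero[OF assms(1-5)])
  have "integral (cbox (- a) a) ?f = integral UNIV (\<lambda>x. if x \<in> cbox (- a) a then ?f x else 0)"
    by (simp only: Henstock_Kurzweil_Integration.integral_restrict_UNIV)
  also have "(\<lambda>x. if x \<in> cbox (- a) a then ?f x else 0) = ?f"
    using a assms(5) box_subset_cbox[of "- a" a] by fastforce
  also have "integral UNIV ?f = 0"
    using assms(7) by (simp only: Henstock_Kurzweil_Integration.integral_restrict_UNIV)
  finally have "\<forall>x\<in>cbox (- a) a. ?f x = 0"
    using a assms(6) continuous_on_subset[OF c]
    by (subst (asm) integral_cbox_eq_0_iff) auto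
  then show ?thesis using a assms(8) box_subset_cbox[of "- a" a] by fastforce
qed

text \<open>The integral of the translate \<open>f (x + s v)\<close> does not depend on \<open>s\<close>; differentiate it at \<open>s = 0\<close>.\<close>

lemma integral_directional_derivative_UNIV:
  fixes f :: "'a::euclidean_space \<Rightarrow> real"
  assumes f: "ck_on 1 UNIV f" and K: "compact K" "\<And>x. x \<notin> K \<Longrightarrow> f x = 0"
  shows "integral UNIV (\<lambda>x. frechet_derivative f (at x) v) = 0"
proof -
  have dif: "f differentiable (at x)" for x using f by simp
  have cD: "continuous_on UNIV (\<lambda>x. frechet_derivative f (at x) v)" using f by simp
  have cf: "continuous_on UNIV f" using f by (rule ck_on_continuous)
  obtain R where R: "K \<subseteq> ball 0 R" using K(1) compact_imp_bounded bounded_subset_ballD[of K 0] by metis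
  \<comment> \<open>Every \<open>x\<close> with x + s v in \<open>K\<close> and |s| <= 1 lies in
    \<open>L\<close>, so a single box serves for all translates.\<close>
  define L where "L = K \<union> ball 0 (R + norm v)"
  have "bounded L" using K(1) by (simp add: L_def compact_imp_bounded)
  then obtain a where a: "L \<subseteq> cbox (- a) a"
    using bounded_subset_cbox_symmetric by metis
  have bound: "x + s *\<^sub>R v \<in> K \<Longrightarrow> \<bar>s\<bar> \<le> 1 \<Longrightarrow> x \<in> cbox (- a) a" for x s
  proof -
    assume 1: "x + s *\<^sub>R v \<in> K" "\<bar>s\<bar> \<le> 1"
    have "norm x \<le> norm (x + s *\<^sub>R v) + norm (s *\<^sub>R v)"
      by (metis norm_triangle_ineq4 add_diff_cancel)
    moreover have "norm (x + s *\<^sub>R v) < R" using 1 R by auto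
    moreover have "norm (s *\<^sub>R v) \<le> norm v" using 1 by (simp add: mult_left_le_one_le)
    ultimately have "x \<in> L" by (simp add: L_def)
    then show ?thesis using a by blast
  qed
  have restrict: "integral (cbox c d) (\<lambda>x. f (x + s *\<^sub>R v)) = integral UNIV (\<lambda>x. f (x + s *\<^sub>R v))"
    if "\<And>x. x + s *\<^sub>R v \<in> K \<Longrightarrow> x \<in> cbox c d" for s c d
  proof -
    have "(\<lambda>x. if x \<in> cbox c d then f (x + s *\<^sub>R v) else 0) = (\<lambda>x. f (x + s *\<^sub>R v))"
      using that K(2) by fastforce
    then show ?thesis
      using Henstock_Kurzweil_Integration.integral_restrict_UNIV[of "cbox c d" "\<lambda>x. f (x + s *\<^sub>R v)"] by metis
  qed
  have const: "integral (cbox (- a) a) (\<lambda>x. f (x + s *\<^sub>R v)) = integral (cbox (- a) a) f" if "\<bar>s\<bar> \<le> 1" for s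
  proof -
    have "integral (cbox (- a) a) (\<lambda>x. f (x + s *\<^sub>R v)) = integral UNIV (\<lambda>x. f (x + s *\<^sub>R v))"
      by (rule restrict) (use bound that in blast)
    also have "\<dots> = integral (cbox (- a - s *\<^sub>R v) (a - s *\<^sub>R v)) (\<lambda>x. f (x + s *\<^sub>R v))"
    proof (rule restrict[symmetric])
      fix x assume "x + s *\<^sub>R v \<in> K"
      then have "x + s *\<^sub>R v \<in> cbox (- a) a" using a by (auto simp: L_def)
      then show "x \<in> cbox (- a - s *\<^sub>R v) (a - s *\<^sub>R v)" by (auto simp: mem_box algebra_simps inner_simps)
    qed
    also have "\<dots> = integral (cbox (- a) a) f" by (rule integral_shift_cbox)
    finally show ?thesis .
  qed
  have "((\<lambda>s. integral (cbox (- a) a) (\<lambda>x. f (x + s *\<^sub>R v))) has_vector_derivative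
      integral (cbox (- a) a) (\<lambda>x. frechet_derivative f (at (x + 0 *\<^sub>R v)) v)) (at 0 within {-1..1})"
  proof (rule leibniz_rule_vector_derivative)
    show "((\<lambda>s. f (x + s *\<^sub>R v)) has_vector_derivative frechet_derivative f (at (x + s *\<^sub>R v)) v)
       (at s within {-1..1})" for s x
      by (rule has_vector_derivative_along_line[OF dif])
    show "(\<lambda>x. f (x + s *\<^sub>R v)) integrable_on cbox (- a) a" for s
      by (intro integrable_continuous continuous_on_compose2[OF cf] continuous_intros) auto
    show "continuous_on ({-1..1} \<times> cbox (- a) a) (\<lambda>(s, x). frechet_derivative f (at (x + s *\<^sub>R v)) v)"
      unfolding case_prod_unfold by (rule continuous_on_compose2[OF cD]) (auto intro!: continuous_intros)
  qed auto
  then have 1: "((\<lambda>s. integral (cbox (- a) a) (\<lambda>x. f (x + s *\<^sub>R v))) has_vector_derivative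
      integral (cbox (- a) a) (\<lambda>x. frechet_derivative f (at x) v)) (at 0 within {-1..1})"
    by simp
  have "((\<lambda>s. integral (cbox (- a) a) f) has_vector_derivative
      integral (cbox (- a) a) (\<lambda>x. frechet_derivative f (at x) v)) (at 0 within {-1..1})"
    by (rule has_vector_derivative_transform[OF _ _ 1]) (use const in auto)
  then have z: "integral (cbox (- a) a) (\<lambda>x. frechet_derivative f (at x) v) = 0"
    using vector_derivative_unique_within_closed_interval[of "-1" 1 0 "\<lambda>s. integral (cbox (- a) a) f"
        "integral (cbox (- a) a) (\<lambda>x. frechet_derivative f (at x) v)" 0]
    by simp
  have "frechet_derivative f (at x) v = 0" if "x \<notin> K" for x
  proof -
    have "frechet_derivative f (at x) = frechet_derivative (\<lambda>x. 0) (at x)"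
      by (rule frechet_derivative_cong_open[of "- K"])
         (use that K in \<open>auto simp: compact_imp_closed open_Compl\<close>)
    then show ?thesis by simp
  qed
  then have "(\<lambda>x. if x \<in> cbox (- a) a then frechet_derivative f (at x) v else 0) =
      (\<lambda>x. frechet_derivative f (at x) v)"
    using a by (fastforce simp: L_def)
  then show ?thesis
    using z Henstock_Kurzweil_Integration.integral_restrict_UNIV[of "cbox (- a) a" "\<lambda>x. frechet_derivative f (at x) v"]
    by metis
qed

lemma integral_directional_derivative:
  fixes h :: "'a::euclidean_space \<Rightarrow> real"
  assumes "open U" "compact K" "K \<subseteq> U" "ck_on 1 U h" "\<And>x. x \<in> U - K \<Longrightarrow> h x = 0"
  shows "integral U (\<lambda>x. frechet_derivative h (at x) v) = 0"
    and "(\<lambda>x. frechet_derivative h (at x) v) integrable_on U"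
proof -
  let ?f = "\<lambda>x. if x \<in> U then h x else 0"
  have eq: "frechet_derivative ?f (at x) v = (if x \<in> U then frechet_derivative h (at x) v else 0)" for x
  proof (cases "x \<in> U")
    case True
    have "frechet_derivative ?f (at x) = frechet_derivative h (at x)"
      by (rule frechet_derivative_cong_open[OF assms(1) True]) simp
    then show ?thesis using True by simp
  next
    case False
    have "frechet_derivative ?f (at x) = frechet_derivative (\<lambda>x. 0) (at x)"
      by (rule frechet_derivative_cong_open[of "- K"])
         (use False assms in \<open>auto simp: compact_imp_closed open_Compl\<close>)
    then show ?thesis using False by simp
  qed
  have "integral UNIV (\<lambda>x. frechet_derivative ?f (at x) v) = 0"
    by (rule integral_directional_derivative_UNIV[OF ck_on_extend_zero[OF assms] assms(2)])
       (use assms(3,5) in auto)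
  then show "integral U (\<lambda>x. frechet_derivative h (at x) v) = 0"
    by (simp only: eq Henstock_Kurzweil_Integration.integral_restrict_UNIV)
  show "(\<lambda>x. frechet_derivative h (at x) v) integrable_on U"
  proof (rule integrable_compact_support[OF assms(1-3)])
    show "continuous_on U (\<lambda>x. frechet_derivative h (at x) v)" using assms(4) by simp
    fix x assume x: "x \<in> U - K"
    have "frechet_derivative h (at x) = frechet_derivative (\<lambda>x. 0) (at x)"
      by (rule frechet_derivative_cong_open[of "U - K"])
         (use x assms in \<open>auto simp: compact_imp_closed open_Diff\<close>)
    then show "frechet_derivative h (at x) v = 0" by simp
  qed
qed

section \<open>The exterior derivative of a 1-form\<close>

definition extd :: "('e::real_normed_vector \<Rightarrow> 'e \<Rightarrow> real) \<Rightarrow> 'e \<Rightarrow> 'e \<Rightarrow> 'e \<Rightarrow> real" where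
  "extd \<theta> y u v = frechet_derivative (\<lambda>z. \<theta> z v) (at y) u - frechet_derivative (\<lambda>z. \<theta> z u) (at y) v"

lemma frechet_derivative_add:
  "f differentiable (at x) \<Longrightarrow> g differentiable (at x) \<Longrightarrow>
   frechet_derivative (\<lambda>x. f x + g x) (at x) v = frechet_derivative f (at x) v + frechet_derivative g (at x) v"
  by (rule frechet_derivative_eqI) (auto intro!: has_derivative_add differentiable_has_frechet)

lemma frechet_derivative_diff:
  "f differentiable (at x) \<Longrightarrow> g differentiable (at x) \<Longrightarrow>
   frechet_derivative (\<lambda>x. f x - g x) (at x) v = frechet_derivative f (at x) v - frechet_derivative g (at x) v"
  by (rule frechet_derivative_eqI) (auto intro!: has_derivative_diff differentiable_has_frechet)

lemma frechet_derivative_mult: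
  fixes f g :: "'a::real_normed_vector \<Rightarrow> real"
  shows "f differentiable (at x) \<Longrightarrow> g differentiable (at x) \<Longrightarrow>
   frechet_derivative (\<lambda>x. f x * g x) (at x) v =
   f x * frechet_derivative g (at x) v + frechet_derivative f (at x) v * g x"
  by (rule frechet_derivative_eqI) (auto intro!: has_derivative_mult differentiable_has_frechet)

lemma frechet_derivative_sum:
  "(\<And>i. i \<in> I \<Longrightarrow> f i differentiable (at x)) \<Longrightarrow>
   frechet_derivative (\<lambda>x. \<Sum>i\<in>I. f i x) (at x) v = (\<Sum>i\<in>I. frechet_derivative (f i) (at x) v)"
  by (rule frechet_derivative_eqI) (auto intro!: has_derivative_sum differentiable_has_frechet)

lemma ck_on_SucD: "ck_on (Suc k) S f \<Longrightarrow> x \<in> S \<Longrightarrow> f differentiable (at x)"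
  "ck_on (Suc k) S f \<Longrightarrow> ck_on k S (\<lambda>x. frechet_derivative f (at x) v)"
  by auto

text \<open>The integrand is the coefficient of db wedge ds = d(b wedge ds), hence a divergence.
  Each component of b wedge ds contains a factor from \<open>b\<close> and so inherits its compact
  support, while \<open>s\<close> may be arbitrary.\<close>

lemma integral_wedge_exact:
  fixes b s :: "4 \<Rightarrow> real^4 \<Rightarrow> real" and D :: "(real^4 \<Rightarrow> real) \<Rightarrow> 4 \<Rightarrow> real^4 \<Rightarrow> real"
  assumes U: "open U" "compact K" "K \<subseteq> U"
    and b: "\<And>j. ck_on 2 U (b j)" and s: "\<And>j. ck_on 2 U (s j)"
    and zero: "\<And>j x. x \<in> U - K \<Longrightarrow> b j x = 0"
  defines "D \<equiv> \<lambda>f i x. frechet_derivative f (at x) (axis i 1)"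
  defines "\<beta> \<equiv> \<lambda>i j x. D (b j) i x - D (b i) j x" and "\<sigma> \<equiv> \<lambda>i j x. D (s j) i x - D (s i) j x"
  shows "integral U (\<lambda>x. \<beta> 1 2 x * \<sigma> 3 4 x - \<beta> 1 3 x * \<sigma> 2 4 x + \<beta> 1 4 x * \<sigma> 2 3 x
    + \<beta> 2 3 x * \<sigma> 1 4 x - \<beta> 2 4 x * \<sigma> 1 3 x + \<beta> 3 4 x * \<sigma> 1 2 x) = 0"
proof -
  have Dapp: "D f i x = frechet_derivative f (at x) (axis i 1)" for f i x by (simp add: D_def)
  have b1: "ck_on 1 U (b j)" for j by (rule ck_on_le[OF b]) simp
  have Ds: "ck_on 1 U (D (s j) i)" for i j
    using s[of j] unfolding D_def numeral_2_eq_2 by (metis One_nat_def ck_on_SucD(2))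
  have \<sigma>: "ck_on 1 U (\<sigma> i j)" for i j
    unfolding \<sigma>_def by (intro ck_on_diff U(1) Ds)
  \<comment> \<open>The components of b wedge ds, with the sign belonging to the omitted index, so
    that the sum of the i-th derivatives of \<open>H i\<close> is the exterior derivative.\<close>
  define H :: "4 \<Rightarrow> real^4 \<Rightarrow> real" where "H i = (\<lambda>x.
      if i = 1 then b 2 x * \<sigma> 3 4 x - b 3 x * \<sigma> 2 4 x + b 4 x * \<sigma> 2 3 x
      else if i = 2 then b 3 x * \<sigma> 1 4 x - b 1 x * \<sigma> 3 4 x - b 4 x * \<sigma> 1 3 x
      else if i = 3 then b 1 x * \<sigma> 2 4 x - b 2 x * \<sigma> 1 4 x + b 4 x * \<sigma> 1 2 x
      else b 2 x * \<sigma> 1 3 x - b 1 x * \<sigma> 2 3 x - b 3 x * \<sigma> 1 2 x)" for i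
  have H: "ck_on 1 U (H i)" for i
  proof -
    have If: "ck_on 1 U (\<lambda>x. if P then f x else g x)" if "ck_on 1 U f" "ck_on 1 U g"
      for P and f g :: "real^4 \<Rightarrow> real"
      using that by (cases P) simp_all
    show ?thesis unfolding H_def by (intro If ck_on_add ck_on_diff ck_on_mult U(1) b1 \<sigma>)
  qed
  have Hz: "H i x = 0" if "x \<in> U - K" for i x using zero[OF that] by (simp add: H_def)
  have int: "integral U (D (H i) i) = 0" "D (H i) i integrable_on U" for i
    unfolding D_def using integral_directional_derivative[OF U H Hz] by auto
  have eq: "(\<Sum>i\<in>UNIV. D (H i) i x) =
     \<beta> 1 2 x * \<sigma> 3 4 x - \<beta> 1 3 x * \<sigma> 2 4 x + \<beta> 1 4 x * \<sigma> 2 3 x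
    + \<beta> 2 3 x * \<sigma> 1 4 x - \<beta> 2 4 x * \<sigma> 1 3 x + \<beta> 3 4 x * \<sigma> 1 2 x" if x: "x \<in> U" for x
  proof -
    have bd: "b j differentiable (at x)" for j using b1 x by simp
    have sd: "\<sigma> i j differentiable (at x)" for i j using \<sigma> x by simp
    have Dsd: "D (s j) i differentiable (at x)" for i j using Ds x by simp
    note md = differentiable_mult[OF bd sd]
    have D\<sigma>: "D (\<sigma> i j) k x = D (D (s j) i) k x - D (D (s i) j) k x" for i j k
    proof -
      have "\<sigma> i j = (\<lambda>x. D (s j) i x - D (s i) j x)" by (simp add: \<sigma>_def)
      then show ?thesis
        unfolding Dapp[of "\<sigma> i j"] Dapp[of "D (s j) i"] Dapp[of "D (s i) j"]
        by (simp only: frechet_derivative_diff[OF Dsd Dsd])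
    qed
    \<comment> \<open>Mixed second derivatives commute, which is d(ds) = 0: all terms in which the
      derivative falls on \<open>\<sigma>\<close> cancel.\<close>
    have sym: "D (D (s j) i) k x = D (D (s j) k) i x" for i j k
      unfolding Dapp[of "D _ _"] unfolding D_def by (rule symmetric_second_derivative[OF U(1) s x])
    have DH: "D (H 1) 1 x = b 2 x * D (\<sigma> 3 4) 1 x + D (b 2) 1 x * \<sigma> 3 4 x
        - (b 3 x * D (\<sigma> 2 4) 1 x + D (b 3) 1 x * \<sigma> 2 4 x) + (b 4 x * D (\<sigma> 2 3) 1 x + D (b 4) 1 x * \<sigma> 2 3 x)"
      "D (H 2) 2 x = b 3 x * D (\<sigma> 1 4) 2 x + D (b 3) 2 x * \<sigma> 1 4 x
        - (b 1 x * D (\<sigma> 3 4) 2 x + D (b 1) 2 x * \<sigma> 3 4 x) - (b 4 x * D (\<sigma> 1 3) 2 x + D (b 4) 2 x * \<sigma> 1 3 x)"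
      "D (H 3) 3 x = b 1 x * D (\<sigma> 2 4) 3 x + D (b 1) 3 x * \<sigma> 2 4 x
        - (b 2 x * D (\<sigma> 1 4) 3 x + D (b 2) 3 x * \<sigma> 1 4 x) + (b 4 x * D (\<sigma> 1 2) 3 x + D (b 4) 3 x * \<sigma> 1 2 x)"
      "D (H 4) 4 x = b 2 x * D (\<sigma> 1 3) 4 x + D (b 2) 4 x * \<sigma> 1 3 x
        - (b 1 x * D (\<sigma> 2 3) 4 x + D (b 1) 4 x * \<sigma> 2 3 x) - (b 3 x * D (\<sigma> 1 2) 4 x + D (b 3) 4 x * \<sigma> 1 2 x)"
      unfolding Dapp[of "H _"] Dapp[of "\<sigma> _ _"] Dapp[of "b _"]
      unfolding H_def
      by (simp_all add: frechet_derivative_add frechet_derivative_diff frechet_derivative_mult md bd sd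
          differentiable_diff differentiable_add)
    show ?thesis
      unfolding sum_4 DH D\<sigma> \<beta>_def
      unfolding sym[of _ 2 1] sym[of _ 3 1] sym[of _ 4 1] sym[of _ 3 2] sym[of _ 4 2] sym[of _ 4 3]
      by (simp add: algebra_simps)
  qed
  have "integral U (\<lambda>x. \<Sum>i\<in>UNIV. D (H i) i x) = 0"
    using int by (subst integral_sum) auto
  then show ?thesis using eq by (metis (mono_tags, lifting) integral_cong)
qed

section \<open>The Poincare lemma for 2-forms on convex sets\<close>

definition smooth_form2 :: "'e::euclidean_space set \<Rightarrow> ('e \<Rightarrow> 'e \<Rightarrow> 'e \<Rightarrow> real) \<Rightarrow> bool" where
  "smooth_form2 W \<Omega> \<longleftrightarrow> (\<forall>y\<in>W. bilinear (\<Omega> y) \<and> (\<forall>u. \<Omega> y u u = 0)) \<and>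
     (\<forall>u v. smooth_on W (\<lambda>y. \<Omega> y u v))"

definition closed_on :: "'e::euclidean_space set \<Rightarrow> ('e \<Rightarrow> 'e \<Rightarrow> 'e \<Rightarrow> real) \<Rightarrow> bool" where
  "closed_on W \<Omega> \<longleftrightarrow> (\<forall>y\<in>W. \<forall>u v w.
     frechet_derivative (\<lambda>z. \<Omega> z v w) (at y) u - frechet_derivative (\<lambda>z. \<Omega> z u w) (at y) v
     + frechet_derivative (\<lambda>z. \<Omega> z u v) (at y) w = 0)"

lemma linear_expand:
  fixes L :: "'e::euclidean_space \<Rightarrow> real"
  assumes "linear L" shows "L z = (\<Sum>b\<in>Basis. (z \<bullet> b) * L b)"
proof -
  have "L z = L (\<Sum>b\<in>Basis. (z \<bullet> b) *\<^sub>R b)" by (simp add: euclidean_representation)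
  also have "\<dots> = (\<Sum>b\<in>Basis. (z \<bullet> b) * L b)"
    by (subst linear_sum[OF assms]) (simp add: linear_cmul[OF assms])
  finally show ?thesis .
qed

lemma frechet_derivative_linear_family:
  fixes F :: "'a::real_normed_vector \<Rightarrow> 'e::euclidean_space \<Rightarrow> real"
  assumes "open W" "x \<in> W" "\<And>y. y \<in> W \<Longrightarrow> linear (F y)" "\<And>w. (\<lambda>y. F y w) differentiable (at x)"
  shows "frechet_derivative (\<lambda>y. F y z) (at x) v =
    (\<Sum>b\<in>Basis. (z \<bullet> b) * frechet_derivative (\<lambda>y. F y b) (at x) v)"
proof -
  have "frechet_derivative (\<lambda>y. F y z) (at x) = frechet_derivative (\<lambda>y. \<Sum>b\<in>Basis. (z \<bullet> b) * F y b) (at x)"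
    by (rule frechet_derivative_cong_open[OF assms(1,2)]) (rule linear_expand[OF assms(3)])
  then show ?thesis
    by (simp add: frechet_derivative_sum frechet_derivative_mult assms(4) differentiable_mult)
qed

text \<open>The homotopy operator of the contraction to x0: \<theta>(y)(v) is the integral over t in
  [0, 1] of t times \<Omega> at x0 + t (y - x0), evaluated on y - x0 and v. Convexity keeps the rays
  inside \<open>W\<close>.\<close>

lemma poincare_2form:
  fixes \<Omega> :: "'e::euclidean_space \<Rightarrow> 'e \<Rightarrow> 'e \<Rightarrow> real"
  assumes W: "open W" "convex W" and \<Omega>: "smooth_form2 W \<Omega>" "closed_on W \<Omega>"
  obtains \<theta> where "\<And>v. smooth_on W (\<lambda>y. \<theta> y v)" "\<And>y. y \<in> W \<Longrightarrow> linear (\<theta> y)"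
    "\<And>y u v. y \<in> W \<Longrightarrow> extd \<theta> y u v = \<Omega> y u v"
proof (cases "W = {}")
  case True
  then show ?thesis using that[of "\<lambda>_ _. 0"] by (auto simp: smooth_on_def)
next
  case False
  then obtain x0 where x0: "x0 \<in> W" by blast
  have bil: "bilinear (\<Omega> y)" and alt: "\<Omega> y u u = 0" if "y \<in> W" for y u
    using \<Omega>(1) that by (auto simp: smooth_form2_def)
  have sm: "ck_on k W (\<lambda>y. \<Omega> y u v)" for k u v
    using \<Omega>(1) by (auto simp: smooth_form2_def smooth_on_def)
  have lin1: "linear (\<lambda>u. \<Omega> y u v)" and lin2: "linear (\<Omega> y v)" if "y \<in> W" for y v
    using bil[OF that] by (auto simp: bilinear_def)
  have \<Omega>dif: "(\<lambda>y. \<Omega> y u v) differentiable (at y)" if "y \<in> W" for u v y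
    using sm[of 1] that by simp
  define p where "p ty = x0 + fst ty *\<^sub>R (snd ty - x0)" for ty :: "real \<times> 'e"
  define T where "T = p -` W"
  have p_cont: "continuous_on UNIV p" unfolding p_def by (intro continuous_intros)
  have T: "open T" unfolding T_def by (rule open_vimage[OF W(1) p_cont])
  have sub: "{0..1} \<times> W \<subseteq> T"
  proof clarsimp
    fix t y assume "0 \<le> t" "t \<le> (1::real)" "y \<in> W"
    then have "(1 - t) *\<^sub>R x0 + t *\<^sub>R y \<in> W" using convexD_alt[OF W(2) x0] by simp
    then show "(t, y) \<in> T" by (simp add: T_def p_def algebra_simps)
  qed
  have pT: "p ` T \<subseteq> W" by (auto simp: T_def)
  have ckp: "ck_on k T p" for k
    unfolding p_def
    by (intro ck_on_add ck_on_scaleR ck_on_diff T ck_on_const ck_on_bounded_linear bounded_linear_fst bounded_linear_snd)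
  define G where "G v ty = fst ty * \<Omega> (p ty) (snd ty - x0) v" for v and ty :: "real \<times> 'e"
  \<comment> \<open>\<open>G\<close> with its moving first argument expanded in a basis; in this
    form the smoothness of \<Omega> on fixed arguments and the product rule apply.\<close>
  define G' where "G' v ty = (\<Sum>b\<in>Basis. (fst ty * ((snd ty - x0) \<bullet> b)) * \<Omega> (p ty) b v)" for v and ty :: "real \<times> 'e"
  have GG': "G' v ty = G v ty" if "ty \<in> T" for v ty
    using linear_expand[OF lin1[of "p ty" v], of "snd ty - x0"] that
    by (simp add: G_def G'_def T_def sum_distrib_left mult.assoc)
  have ckG': "ck_on k T (G' v)" for k v
    unfolding G'_def
    by (intro ck_on_sum ck_on_mult ck_on_inner ck_on_diff T ck_on_const ck_on_bounded_linear
        bounded_linear_fst bounded_linear_snd ck_on_compose[OF T ckp sm pT])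
  have ckG: "ck_on k T (G v)" for k v
    by (rule ck_on_cong[OF T GG' ckG'])
  define \<theta> where "\<theta> y v = integral {0..1} (\<lambda>t. G v (t, y))" for y v
  have \<theta>ck: "ck_on k W (\<lambda>y. \<theta> y v)" for k v
    unfolding \<theta>_def by (rule ck_on_integral_param[OF T sub W ckG])
  have Gint: "(\<lambda>t. G v (t, y)) integrable_on {0..1}" if "y \<in> W" for v y
    by (rule integrable_continuous_real, rule continuous_on_compose2[OF ck_on_continuous[OF ckG]])
       (use sub that in \<open>auto intro!: continuous_intros\<close>)
  have \<theta>lin: "linear (\<theta> y)" if y: "y \<in> W" for y
  proof (rule linearI)
    have pW: "p (t, y) \<in> W" if "t \<in> {0..1}" for t
    proof -
      have "(t, y) \<in> T" using sub y that by blast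
      then show ?thesis by (simp add: T_def)
    qed
    fix u v :: 'e and c :: real
    have "\<theta> y (u + v) = integral {0..1} (\<lambda>t. G u (t, y) + G v (t, y))"
      unfolding \<theta>_def
      by (rule integral_cong) (simp add: G_def linear_add[OF lin2[OF pW]] distrib_left)
    then show "\<theta> y (u + v) = \<theta> y u + \<theta> y v"
      using y by (simp add: \<theta>_def Henstock_Kurzweil_Integration.integral_add Gint)
    have "\<theta> y (c *\<^sub>R u) = integral {0..1} (\<lambda>t. c * G u (t, y))"
      unfolding \<theta>_def
      by (rule integral_cong) (simp add: G_def linear_cmul[OF lin2[OF pW]])
    then show "\<theta> y (c *\<^sub>R u) = c *\<^sub>R \<theta> y u" by (simp add: \<theta>_def)
  qed
  have ext: "extd \<theta> y u v = \<Omega> y u v" if y: "y \<in> W" for y u v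
  proof -
    define z where "z = y - x0"
    define q where "q t = x0 + t *\<^sub>R z" for t
    have q: "q t \<in> W" "p (t, y) = q t" "(t, y) \<in> T" if "t \<in> {0..1}" for t
    proof -
      show "(t, y) \<in> T" using sub y that by blast
      then show "q t \<in> W" "p (t, y) = q t" by (simp_all add: T_def p_def q_def z_def)
    qed
    \<comment> \<open>The first term comes from differentiating the argument y - x0, the second from
      the base point x0 + t (y - x0), whose inner derivative contributes another factor t.\<close>
    have dG: "frechet_derivative (G w) (at (t, y)) (0, u) =
        t * \<Omega> (q t) u w + t\<^sup>2 * frechet_derivative (\<lambda>y. \<Omega> y z w) (at (q t)) u"
      if t: "t \<in> {0..1}" for t u w
    proof -
      have dp: "(p has_derivative (\<lambda>(s, h). s *\<^sub>R z + t *\<^sub>R h)) (at (t, y))"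
        unfolding p_def z_def by (auto intro!: derivative_eq_intros)
      have d\<Omega>: "((\<lambda>ty. \<Omega> (p ty) b w) has_derivative
          (\<lambda>sh. frechet_derivative (\<lambda>y. \<Omega> y b w) (at (q t)) (case sh of (s, h) \<Rightarrow> s *\<^sub>R z + t *\<^sub>R h))) (at (t, y))" for b
        using has_derivative_compose[OF dp, of "\<lambda>y. \<Omega> y b w"] differentiable_has_frechet[OF \<Omega>dif[OF q(1)[OF t]]] q(2)[OF t]
        by simp
      have c: "((\<lambda>ty. fst ty * ((snd ty - x0) \<bullet> b)) has_derivative
          (\<lambda>sh. t * (snd sh \<bullet> b) + fst sh * (z \<bullet> b))) (at (t, y))" for b
        unfolding z_def by (auto intro!: derivative_eq_intros)
      have "frechet_derivative (G w) (at (t, y)) (0, u) = frechet_derivative (G' w) (at (t, y)) (0, u)"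
        using frechet_derivative_cong_open[OF T q(3)[OF t] GG'] by simp
      also have "\<dots> = (\<Sum>b\<in>Basis. t * (z \<bullet> b) * frechet_derivative (\<lambda>y. \<Omega> y b w) (at (q t)) (t *\<^sub>R u)
          + t * (u \<bullet> b) * \<Omega> (q t) b w)"
      proof (subst frechet_derivative_eqI)
        show "(G' w has_derivative (\<lambda>sh. \<Sum>b\<in>Basis.
            (fst (t, y) * ((snd (t, y) - x0) \<bullet> b)) * frechet_derivative (\<lambda>y. \<Omega> y b w) (at (q t)) (case sh of (s, h) \<Rightarrow> s *\<^sub>R z + t *\<^sub>R h)
            + (t * (snd sh \<bullet> b) + fst sh * (z \<bullet> b)) * \<Omega> (p (t, y)) b w)) (at (t, y))"
          unfolding G'_def by (intro has_derivative_sum has_derivative_mult c d\<Omega>)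
      qed (simp_all add: z_def q(2)[OF t])
      also have "\<dots> = t * t * (\<Sum>b\<in>Basis. (z \<bullet> b) * frechet_derivative (\<lambda>y. \<Omega> y b w) (at (q t)) u)
          + t * (\<Sum>b\<in>Basis. (u \<bullet> b) * \<Omega> (q t) b w)"
        by (simp add: sum.distrib sum_distrib_left linear_cmul[OF linear_frechet_derivative[OF \<Omega>dif[OF q(1)[OF t]]]] algebra_simps)
      also have "\<dots> = t * t * frechet_derivative (\<lambda>y. \<Omega> y z w) (at (q t)) u + t * \<Omega> (q t) u w"
        using frechet_derivative_linear_family[OF W(1) q(1)[OF t] lin1 \<Omega>dif[OF q(1)[OF t]], where z = z and v = u]
          linear_expand[OF lin1[OF q(1)[OF t], of w], of u]
        by simp
      finally show ?thesis by (simp add: power2_eq_square)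
    qed
    have d\<theta>: "frechet_derivative (\<lambda>y. \<theta> y w) (at y) u =
        integral {0..1} (\<lambda>t. frechet_derivative (G w) (at (t, y)) (0, u))" for u w
      unfolding \<theta>_def by (rule integral_param_derivative(2)[OF T sub W ckG y])
    have dGint: "(\<lambda>t. frechet_derivative (G w) (at (t, y)) (0, u)) integrable_on {0..1}" for u w
      by (rule integrable_continuous_real,
          rule continuous_on_compose2[of T "\<lambda>ty. frechet_derivative (G w) (at ty) (0, u)"])
         (use sub y ckG[of 1 w] in \<open>auto intro!: continuous_intros\<close>)
    \<comment> \<open>The integrand is the derivative in t of t^2 \<open>\<Omega> (q t) u v\<close>,
      which is 0 at t = 0 and \<open>\<Omega> y u v\<close> at t = 1.\<close>
    have FTC: "((\<lambda>t. 2 * t * \<Omega> (q t) u v + t\<^sup>2 * frechet_derivative (\<lambda>y. \<Omega> y u v) (at (q t)) z)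
        has_integral 1\<^sup>2 * \<Omega> (q 1) u v - 0\<^sup>2 * \<Omega> (q 0) u v) {0..1}"
    proof (rule fundamental_theorem_of_calculus)
      fix t :: real assume t: "t \<in> {0..1}"
      have 1: "((\<lambda>t. \<Omega> (q t) u v) has_vector_derivative frechet_derivative (\<lambda>y. \<Omega> y u v) (at (q t)) z) (at t within {0..1})"
        unfolding q_def by (rule has_vector_derivative_along_line[where f = "\<lambda>y. \<Omega> y u v"]) (use q(1)[OF t] \<Omega>dif in \<open>simp add: q_def\<close>)
      have 2: "((\<lambda>t. t\<^sup>2) has_vector_derivative 2 * t) (at t within {0..1})"
        by (auto intro!: derivative_eq_intros simp flip: has_real_derivative_iff_has_vector_derivative)
      show "((\<lambda>t. t\<^sup>2 * \<Omega> (q t) u v) has_vector_derivative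
          2 * t * \<Omega> (q t) u v + t\<^sup>2 * frechet_derivative (\<lambda>y. \<Omega> y u v) (at (q t)) z) (at t within {0..1})"
        using has_vector_derivative_mult[OF 2 1] by (simp add: add.commute)
    qed simp
    have "extd \<theta> y u v = integral {0..1} (\<lambda>t. frechet_derivative (G v) (at (t, y)) (0, u)
        - frechet_derivative (G u) (at (t, y)) (0, v))"
      unfolding extd_def d\<theta> by (rule Henstock_Kurzweil_Integration.integral_diff[symmetric]) (rule dGint)+
    also have "\<dots> = integral {0..1} (\<lambda>t. 2 * t * \<Omega> (q t) u v + t\<^sup>2 * frechet_derivative (\<lambda>y. \<Omega> y u v) (at (q t)) z)"
    proof (rule integral_cong)
      fix t :: real assume t: "t \<in> {0..1}"
      \<comment> \<open>Closedness on z, u, v trades the derivatives along u and v for the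
        derivative along the ray direction z; skewness then supplies the term with 2 t.\<close>
      have "frechet_derivative (\<lambda>y. \<Omega> y u v) (at (q t)) z - frechet_derivative (\<lambda>y. \<Omega> y z v) (at (q t)) u
          + frechet_derivative (\<lambda>y. \<Omega> y z u) (at (q t)) v = 0"
        using \<Omega>(2) q(1)[OF t] unfolding closed_on_def by blast
      then have e: "frechet_derivative (\<lambda>y. \<Omega> y u v) (at (q t)) z =
          frechet_derivative (\<lambda>y. \<Omega> y z v) (at (q t)) u - frechet_derivative (\<lambda>y. \<Omega> y z u) (at (q t)) v"
        by simp
      have "0 = \<Omega> (q t) (u + v) (u + v)" using alt[OF q(1)[OF t]] by simp
      also have "\<dots> = \<Omega> (q t) u v + \<Omega> (q t) v u"
        unfolding bilinear_ladd[OF bil[OF q(1)[OF t]]] bilinear_radd[OF bil[OF q(1)[OF t]]]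
        using alt[OF q(1)[OF t]] by simp
      finally have "\<Omega> (q t) v u = - \<Omega> (q t) u v" by simp
      then show "frechet_derivative (G v) (at (t, y)) (0, u) - frechet_derivative (G u) (at (t, y)) (0, v) =
          2 * t * \<Omega> (q t) u v + t\<^sup>2 * frechet_derivative (\<lambda>y. \<Omega> y u v) (at (q t)) z"
        unfolding dG[OF t] e by (simp add: algebra_simps)
    qed
    also have "\<dots> = \<Omega> y u v" using integral_unique[OF FTC] by (simp add: q_def z_def)
    finally show ?thesis .
  qed
  show ?thesis using that[of \<theta>] \<theta>ck \<theta>lin ext by (auto simp: smooth_on_def)
qed

section \<open>Pull-back of 1-forms and 2-forms between vector spaces\<close>

definition pull1 :: "('a::real_normed_vector \<Rightarrow> 'e::real_normed_vector) \<Rightarrow> ('e \<Rightarrow> 'e \<Rightarrow> real) \<Rightarrow> 'a \<Rightarrow> 'a \<Rightarrow> real" where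
  "pull1 f \<theta> x u = \<theta> (f x) (frechet_derivative f (at x) u)"

definition pull2 :: "('a::real_normed_vector \<Rightarrow> 'e::real_normed_vector) \<Rightarrow> ('e \<Rightarrow> 'e \<Rightarrow> 'e \<Rightarrow> real) \<Rightarrow> 'a \<Rightarrow> 'a \<Rightarrow> 'a \<Rightarrow> real" where
  "pull2 f \<Omega> x u v = \<Omega> (f x) (frechet_derivative f (at x) u) (frechet_derivative f (at x) v)"

lemma smooth_on_frechet_derivative: "smooth_on S f \<Longrightarrow> smooth_on S (\<lambda>x. frechet_derivative f (at x) u)"
  unfolding smooth_on_def by (metis ck_on_SucD(2))

lemma smooth_on_pull1:
  fixes f :: "'a::euclidean_space \<Rightarrow> 'e::euclidean_space"
  assumes U: "open U" "smooth_on U f" "f ` U \<subseteq> W"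
    and \<theta>: "\<And>v. smooth_on W (\<lambda>y. \<theta> y v)" "\<And>y. y \<in> W \<Longrightarrow> linear (\<theta> y)"
  shows "smooth_on U (\<lambda>x. pull1 f \<theta> x u)"
proof (rule smooth_on_cong[OF U(1)])
  show "smooth_on U (\<lambda>x. \<Sum>b\<in>Basis. (frechet_derivative f (at x) u \<bullet> b) * \<theta> (f x) b)"
  proof (rule smooth_onI)
    fix k
    have "ck_on k U (\<lambda>x. frechet_derivative f (at x) u)"
      using smooth_on_frechet_derivative[OF U(2)] by (rule smooth_onD)
    then show "ck_on k U (\<lambda>x. \<Sum>b\<in>Basis. (frechet_derivative f (at x) u \<bullet> b) * \<theta> (f x) b)"
      by (intro ck_on_sum ck_on_mult ck_on_inner U(1)
          ck_on_compose[OF U(1) smooth_onD[OF U(2)] smooth_onD[OF \<theta>(1)] U(3)])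
  qed
  fix x assume "x \<in> U"
  then have "f x \<in> W" using U(3) by blast
  then show "(\<Sum>b\<in>Basis. (frechet_derivative f (at x) u \<bullet> b) * \<theta> (f x) b) = pull1 f \<theta> x u"
    unfolding pull1_def by (rule linear_expand[OF \<theta>(2), symmetric])
qed

text \<open>Differentiating the pulled-back 1-form also produces second derivatives of
  \<open>f\<close>; they are symmetric in u and v and drop out of the antisymmetrised
  expression.\<close>

lemma extd_pull1:
  fixes f :: "'a::euclidean_space \<Rightarrow> 'e::euclidean_space"
  assumes U: "open U" "smooth_on U f" "f ` U \<subseteq> W" and W: "open W"
    and \<theta>: "\<And>v. smooth_on W (\<lambda>y. \<theta> y v)" "\<And>y. y \<in> W \<Longrightarrow> linear (\<theta> y)"
    and x: "x \<in> U"
  shows "extd (pull1 f \<theta>) x u v = pull2 f (extd \<theta>) x u v"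
proof -
  let ?F = "\<lambda>u. frechet_derivative f (at x) u"
  have fx: "f x \<in> W" using U(3) x by blast
  have \<theta>dif: "(\<lambda>y. \<theta> y b) differentiable (at (f x))" for b
    by (rule smooth_on_differentiable[OF \<theta>(1) fx])
  have fdif: "f differentiable (at x)" by (rule smooth_on_differentiable[OF U(2) x])
  have Fdif: "(\<lambda>x. frechet_derivative f (at x) u) differentiable (at x)" for u
    by (rule smooth_on_differentiable[OF smooth_on_frechet_derivative[OF U(2)] x])
  have d: "frechet_derivative (\<lambda>x. pull1 f \<theta> x u) (at x) v =
      (\<Sum>b\<in>Basis. (?F u \<bullet> b) * frechet_derivative (\<lambda>y. \<theta> y b) (at (f x)) (?F v)
        + (frechet_derivative (\<lambda>x. frechet_derivative f (at x) u) (at x) v \<bullet> b) * \<theta> (f x) b)" for u v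
  proof -
    have e: "frechet_derivative (\<lambda>x. pull1 f \<theta> x u) (at x) =
        frechet_derivative (\<lambda>x. \<Sum>b\<in>Basis. (frechet_derivative f (at x) u \<bullet> b) * \<theta> (f x) b) (at x)"
    proof (rule frechet_derivative_cong_open[OF U(1) x])
      fix y assume "y \<in> U"
      then have "f y \<in> W" using U(3) by blast
      then show "pull1 f \<theta> y u = (\<Sum>b\<in>Basis. (frechet_derivative f (at y) u \<bullet> b) * \<theta> (f y) b)"
        unfolding pull1_def by (rule linear_expand[OF \<theta>(2)])
    qed
    show ?thesis
      unfolding e
    proof (rule frechet_derivative_eqI, rule has_derivative_sum, rule has_derivative_mult)
      fix b :: 'e
      show "((\<lambda>x. frechet_derivative f (at x) u \<bullet> b) has_derivative
          (\<lambda>v. frechet_derivative (\<lambda>x. frechet_derivative f (at x) u) (at x) v \<bullet> b)) (at x)"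
        by (rule has_derivative_inner_left[OF differentiable_has_frechet[OF Fdif]])
      show "((\<lambda>x. \<theta> (f x) b) has_derivative
          (\<lambda>v. frechet_derivative (\<lambda>y. \<theta> y b) (at (f x)) (?F v))) (at x)"
        by (rule has_derivative_compose[OF differentiable_has_frechet[OF fdif] differentiable_has_frechet[OF \<theta>dif]])
    qed
  qed
  have sym: "frechet_derivative (\<lambda>x. frechet_derivative f (at x) u) (at x) v =
      frechet_derivative (\<lambda>x. frechet_derivative f (at x) v) (at x) u"
    by (rule symmetric_second_derivative[OF U(1) smooth_onD[OF U(2)] x])
  have ex: "frechet_derivative (\<lambda>y. \<theta> y z) (at (f x)) w =
      (\<Sum>b\<in>Basis. (z \<bullet> b) * frechet_derivative (\<lambda>y. \<theta> y b) (at (f x)) w)" for z w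
    by (rule frechet_derivative_linear_family[OF W fx \<theta>(2) \<theta>dif])
  show ?thesis
    unfolding extd_def[of "pull1 f \<theta>"] d pull2_def extd_def[of \<theta>]
    unfolding ex[of "?F u"] ex[of "?F v"] sym
    by (simp add: sum.distrib)
qed

lemma integral_wedge_pull2_eq:
  fixes f f' :: "real^4 \<Rightarrow> 'e::euclidean_space"
  assumes U: "open U" "compact K" "K \<subseteq> U" and W: "open W" "convex W"
    and \<Omega>: "smooth_form2 W \<Omega>" "closed_on W \<Omega>"
    and f: "smooth_on U f" "f ` U \<subseteq> W" and f': "smooth_on U f'" "f' ` U \<subseteq> W"
    and eq: "\<And>x. x \<in> U - K \<Longrightarrow> f x = f' x"
  shows "integral U (\<lambda>x.
      wedge_sq (pull2 f \<Omega> x) (axis 1 1) (axis 2 1) (axis 3 1) (axis 4 1)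
      - wedge_sq (pull2 f' \<Omega> x) (axis 1 1) (axis 2 1) (axis 3 1) (axis 4 1)) = 0"
proof -
  obtain \<theta> where \<theta>: "\<And>v. smooth_on W (\<lambda>y. \<theta> y v)" "\<And>y. y \<in> W \<Longrightarrow> linear (\<theta> y)"
    "\<And>y u v. y \<in> W \<Longrightarrow> extd \<theta> y u v = \<Omega> y u v"
    using poincare_2form[OF W \<Omega>] by blast
  define a where "a j x = pull1 f \<theta> x (axis j 1)" for j :: 4 and x
  define a' where "a' j x = pull1 f' \<theta> x (axis j 1)" for j :: 4 and x
  have ck: "ck_on 2 U (a j)" "ck_on 2 U (a' j)" for j
    using smooth_onD[OF smooth_on_pull1[OF U(1) f \<theta>(1,2)]] smooth_onD[OF smooth_on_pull1[OF U(1) f' \<theta>(1,2)]]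
    unfolding a_def[abs_def] a'_def[abs_def] by blast+
  have dif: "a j differentiable (at x)" "a' j differentiable (at x)" if "x \<in> U" for j x
    using ck_on_SucD(1)[of 1 U] ck that by (auto simp: numeral_2_eq_2)
  define D :: "(real^4 \<Rightarrow> real) \<Rightarrow> 4 \<Rightarrow> real^4 \<Rightarrow> real" where "D f i x = frechet_derivative f (at x) (axis i 1)" for f i x
  have p2: "pull2 f \<Omega> x (axis i 1) (axis j 1) = D (a j) i x - D (a i) j x" if "x \<in> U" for x i j
    using extd_pull1[OF U(1) f W(1) \<theta>(1,2) that, of "axis i 1" "axis j 1"] \<theta>(3)[of "f x"] f(2) that
    by (simp add: extd_def[of "pull1 f \<theta>"] D_def a_def[abs_def] pull2_def image_subset_iff)
  have p2': "pull2 f' \<Omega> x (axis i 1) (axis j 1) = D (a' j) i x - D (a' i) j x" if "x \<in> U" for x i j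
    using extd_pull1[OF U(1) f' W(1) \<theta>(1,2) that, of "axis i 1" "axis j 1"] \<theta>(3)[of "f' x"] f'(2) that
    by (simp add: extd_def[of "pull1 f' \<theta>"] D_def a'_def[abs_def] pull2_def image_subset_iff)
  \<comment> \<open>2-forms commute under the wedge product, so the difference of squares factors as
    x^2 - y^2 = (x - y)(x + y).\<close>
  define b where "b j x = a j x - a' j x" for j x
  define s where "s j x = a j x + a' j x" for j x
  have Db: "D (b j) i x = D (a j) i x - D (a' j) i x" and Ds: "D (s j) i x = D (a j) i x + D (a' j) i x"
    if "x \<in> U" for i j x
    unfolding D_def b_def[abs_def] s_def[abs_def]
    by (simp_all add: frechet_derivative_add frechet_derivative_diff dif[OF that])
  have ckb: "ck_on 2 U (b j)" and cks: "ck_on 2 U (s j)" for j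
    unfolding b_def[abs_def] s_def[abs_def] by (intro ck_on_add ck_on_diff U(1) ck)+
  have bz: "b j x = 0" if x: "x \<in> U - K" for j x
  proof -
    \<comment> \<open>Equality on the open set U - K carries over to the derivatives, which enter
      the pulled-back 1-forms.\<close>
    have "frechet_derivative f (at x) = frechet_derivative f' (at x)"
      by (rule frechet_derivative_cong_open[OF _ x eq])
         (use U in \<open>auto simp: compact_imp_closed open_Diff\<close>)
    then show ?thesis using eq[OF x] by (simp add: b_def a_def a'_def pull1_def)
  qed
  note I = integral_wedge_exact[where b = b and s = s, OF U ckb cks bz, folded D_def]
  show ?thesis
    by (rule trans[OF integral_cong I]) (simp add: wedge_sq_def p2 p2' Db Ds, simp add: algebra_simps)
qed

section \<open>Charts and coordinate representations\<close>

definition rep :: "('a, 'e) chart \<Rightarrow> ('b, 'f) chart \<Rightarrow> ('a \<Rightarrow> 'b) \<Rightarrow> 'e \<Rightarrow> 'f" where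
  "rep c c' f = cmap c' \<circ> f \<circ> cinv c"

text \<open>Meant for open \<open>Q\<close>: it describes maps that are continuous everywhere but
  smooth only on part of the manifold, as they occur while a continuous map is being
  smoothed.\<close>

definition smooth_map_on ::
  "('a::topological_space, 'e::euclidean_space) chart set \<Rightarrow>
   ('b::topological_space, 'f::euclidean_space) chart set \<Rightarrow> ('a \<Rightarrow> 'b) \<Rightarrow> 'a set \<Rightarrow> bool" where
  "smooth_map_on A B f Q \<longleftrightarrow>
     (\<forall>c\<in>A. \<forall>c'\<in>B. smooth_on (cmap c ` (cdom c \<inter> Q \<inter> f -` cdom c')) (rep c c' f))"

lemma smooth_map_iff: "smooth_map A B f \<longleftrightarrow> continuous_on UNIV f \<and> smooth_map_on A B f UNIV"
  by (simp add: smooth_map_def smooth_map_on_def rep_def)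

lemma smooth_map_on_subset: "smooth_map_on A B f Q \<Longrightarrow> Q' \<subseteq> Q \<Longrightarrow> smooth_map_on A B f Q'"
  unfolding smooth_map_on_def by (blast intro: smooth_on_subset)

lemma smooth_atlas_chart: "smooth_atlas A \<Longrightarrow> c \<in> A \<Longrightarrow> is_chart c"
  by (simp add: smooth_atlas_def)

lemma smooth_atlas_cover: "smooth_atlas A \<Longrightarrow> \<exists>c\<in>A. p \<in> cdom c"
  unfolding smooth_atlas_def by blast

lemma chart_at: "smooth_atlas A \<Longrightarrow> chart_at A p \<in> A \<and> p \<in> cdom (chart_at A p)"
  unfolding chart_at_def by (rule someI_ex) (use smooth_atlas_cover in blast)

text \<open>Transition maps are representations of the identity, so the chain rules for changing
  charts at the source or the target become instances of the one for compositions.\<close>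

lemma rep_id: "rep c c' (\<lambda>x. x) = transition c c'"
  by (simp add: rep_def transition_def fun_eq_iff)

lemma smooth_map_on_id: "smooth_atlas A \<Longrightarrow> smooth_map_on A A (\<lambda>x. x) UNIV"
  by (simp add: smooth_map_on_def smooth_atlas_def rep_id)

lemma chart_simps:
  assumes "is_chart c"
  shows "open (cdom c)" "open (cimg c)" "p \<in> cdom c \<Longrightarrow> cinv c (cmap c p) = p"
    "y \<in> cimg c \<Longrightarrow> cmap c (cinv c y) = y" "y \<in> cimg c \<Longrightarrow> cinv c y \<in> cdom c"
    "continuous_on (cdom c) (cmap c)" "continuous_on (cimg c) (cinv c)" "inj_on (cmap c) (cdom c)"
  using assms homeomorphism_apply1[of "cdom c" "cimg c" "cmap c" "cinv c"]
  unfolding is_chart_def homeomorphism_def by (auto simp: f_inv_into_f inv_into_into inj_on_def) metis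

lemma chart_vimage: "cmap c ` (cdom c \<inter> Q) = cimg c \<inter> cinv c -` Q" if "is_chart c"
  using chart_simps[OF that] by (auto simp: image_iff)

lemma chart_open_image: "is_chart c \<Longrightarrow> open Q \<Longrightarrow> open (cmap c ` (cdom c \<inter> Q))"
  by (simp add: chart_vimage chart_simps continuous_open_preimage)

lemma chart_open_preimage: "is_chart c \<Longrightarrow> open W \<Longrightarrow> open (cdom c \<inter> cmap c -` W)"
  by (simp add: chart_simps continuous_open_preimage)

lemma chart_compact_inv_image: "is_chart c \<Longrightarrow> compact L \<Longrightarrow> L \<subseteq> cimg c \<Longrightarrow> compact (cinv c ` L)"
  by (meson chart_simps(7) compact_continuous_image continuous_on_subset)

lemma chart_compact_image: "is_chart c \<Longrightarrow> compact K \<Longrightarrow> K \<subseteq> cdom c \<Longrightarrow> compact (cmap c ` K)"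
  by (meson chart_simps(6) compact_continuous_image continuous_on_subset)

lemma open_rep_domain:
  assumes "is_chart c" "open (cdom c')" "open Q" "continuous_on Q f"
  shows "open (cmap c ` (cdom c \<inter> Q \<inter> f -` cdom c'))"
proof -
  have "open (Q \<inter> f -` cdom c')" using assms by (simp add: continuous_open_preimage)
  then show ?thesis using chart_open_image[OF assms(1)] by (simp add: Int_assoc)
qed

lemma rep_apply: "is_chart c \<Longrightarrow> p \<in> cdom c \<Longrightarrow> rep c c' f (cmap c p) = cmap c' (f p)"
  by (simp add: rep_def chart_simps)

lemma rep_differentiable:
  assumes "smooth_map_on A B f Q" "c \<in> A" "c' \<in> B" "p \<in> cdom c" "f p \<in> cdom c'" "p \<in> Q"
  shows "rep c c' f differentiable (at (cmap c p))"
  using assms by (auto intro!: smooth_on_differentiable[of "cmap c ` (cdom c \<inter> Q \<inter> f -` cdom c')"]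
      simp: smooth_map_on_def)

text \<open>The representation of the composition is the composition of representations only near
  the point, where \<open>f\<close> stays in the middle chart; continuity on \<open>Q\<close> makes
  that set open.\<close>

lemma rep_compose_derivative:
  assumes ch: "is_chart c" "is_chart c'" and Q: "open Q" "p \<in> Q" "continuous_on Q f"
    and p: "p \<in> cdom c" "f p \<in> cdom c'"
    and d: "rep c c' f differentiable (at (cmap c p))" "rep c' c'' f' differentiable (at (cmap c' (f p)))"
  shows "frechet_derivative (rep c c'' (f' \<circ> f)) (at (cmap c p)) u =
    frechet_derivative (rep c' c'' f') (at (cmap c' (f p))) (frechet_derivative (rep c c' f) (at (cmap c p)) u)"
proof -
  let ?S = "cmap c ` (cdom c \<inter> Q \<inter> f -` cdom c')"
  have S: "open ?S" "cmap c p \<in> ?S"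
    using open_rep_domain[OF ch(1) chart_simps(1)[OF ch(2)] Q(1,3)] p Q(2) by auto
  have "frechet_derivative (rep c c'' (f' \<circ> f)) (at (cmap c p)) =
      frechet_derivative (\<lambda>y. rep c' c'' f' (rep c c' f y)) (at (cmap c p))"
  proof (rule frechet_derivative_cong_open[OF S])
    fix y assume "y \<in> ?S"
    then obtain q where "q \<in> cdom c" "f q \<in> cdom c'" "y = cmap c q" by auto
    then show "rep c c'' (f' \<circ> f) y = rep c' c'' f' (rep c c' f y)"
      by (simp add: rep_def chart_simps ch)
  qed
  also have "\<dots> = (\<lambda>u. frechet_derivative (rep c' c'' f') (at (cmap c' (f p)))
      (frechet_derivative (rep c c' f) (at (cmap c p)) u))"
    using has_derivative_compose[OF differentiable_has_frechet[OF d(1)], of "rep c' c'' f'"]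
      differentiable_has_frechet[OF d(2)]
    by (intro frechet_derivative_at[symmetric]) (simp add: rep_apply[OF ch(1) p(1)])
  finally show ?thesis by simp
qed

lemma transition_differentiable:
  assumes "smooth_atlas A" "c \<in> A" "c' \<in> A" "p \<in> cdom c" "p \<in> cdom c'"
  shows "transition c c' differentiable (at (cmap c p))"
  using rep_differentiable[OF smooth_map_on_id[OF assms(1)] assms(2-5)] by (simp add: rep_id)

lemma rep_chain_left:
  assumes A: "smooth_atlas A" "c \<in> A" "c1 \<in> A" "p \<in> cdom c" "p \<in> cdom c1"
    and d: "rep c1 c' f differentiable (at (cmap c1 p))"
  shows "frechet_derivative (rep c1 c' f) (at (cmap c1 p)) (frechet_derivative (transition c c1) (at (cmap c p)) u)
    = frechet_derivative (rep c c' f) (at (cmap c p)) u"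
  using rep_compose_derivative[of c c1 UNIV p "\<lambda>x. x" c' f u] transition_differentiable[OF A] d
    smooth_atlas_chart[OF A(1)] A
  by (simp add: rep_id o_def)

lemma rep_chain_right:
  assumes B: "smooth_atlas B" "c' \<in> B" "c1 \<in> B" "f p \<in> cdom c'" "f p \<in> cdom c1"
    and c: "is_chart c" "p \<in> cdom c" and Q: "open Q" "p \<in> Q" "continuous_on Q f"
    and d: "rep c c' f differentiable (at (cmap c p))"
  shows "frechet_derivative (transition c' c1) (at (cmap c' (f p))) (frechet_derivative (rep c c' f) (at (cmap c p)) u)
    = frechet_derivative (rep c c1 f) (at (cmap c p)) u"
  using rep_compose_derivative[of c c' Q p f c1 "\<lambda>x. x" u] transition_differentiable[OF B] d Q c B
    smooth_atlas_chart[OF B(1)]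
  by (simp add: rep_id o_def)

lemma transition_self:
  assumes "is_chart c" "p \<in> cdom c"
  shows "frechet_derivative (transition c c) (at (cmap c p)) u = u"
proof -
  have "frechet_derivative (transition c c) (at (cmap c p)) = frechet_derivative (\<lambda>y. y) (at (cmap c p))"
    by (rule frechet_derivative_cong_open[of "cimg c"])
       (use assms in \<open>auto simp: chart_simps transition_def\<close>)
  then show ?thesis by simp
qed

lemma transition_chain:
  assumes "smooth_atlas A" "c \<in> A" "c' \<in> A" "c'' \<in> A" "p \<in> cdom c" "p \<in> cdom c'" "p \<in> cdom c''"
  shows "frechet_derivative (transition c' c'') (at (cmap c' p)) (frechet_derivative (transition c c') (at (cmap c p)) u)
    = frechet_derivative (transition c c'') (at (cmap c p)) u"
  using rep_chain_left[of A c c' p c'' "\<lambda>x. x" u] assms transition_differentiable[of A c' c'' p]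
  by (simp add: rep_id)

section \<open>Tangent vectors in coordinates\<close>

lemma coord_vec_self: "c \<in> A \<Longrightarrow> is_chart c \<Longrightarrow> p \<in> cdom c \<Longrightarrow> coord_vec A c p u c = u"
  by (simp add: coord_vec_def transition_self)

lemma coord_vec_in_tangent_space:
  assumes "smooth_atlas A" "c \<in> A" "p \<in> cdom c"
  shows "coord_vec A c p u \<in> tangent_space A p"
  using assms transition_chain[of A c _ _ p u] by (auto simp: tangent_space_def coord_vec_def)

lemma tangent_vec_eq_coord_vec:
  assumes "c \<in> A" "p \<in> cdom c" "v \<in> tangent_space A p"
  shows "coord_vec A c p (v c) = v"
proof
  fix c'
  show "coord_vec A c p (v c) c' = v c'"
  proof (cases "c' \<in> A \<and> p \<in> cdom c'")
    case True
    then have "v c' = frechet_derivative (transition c c') (at (cmap c p)) (v c)"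
      using assms unfolding tangent_space_def by blast
    then show ?thesis unfolding coord_vec_def using True by simp
  next
    case False
    then have "v c' = 0" using assms(3) unfolding tangent_space_def by blast
    then show ?thesis by (simp only: coord_vec_def False if_False)
  qed
qed

lemma coord_vec_change:
  assumes "smooth_atlas A" "c \<in> A" "c' \<in> A" "p \<in> cdom c" "p \<in> cdom c'"
  shows "coord_vec A c' p (frechet_derivative (transition c c') (at (cmap c p)) u) = coord_vec A c p u"
  using assms transition_chain[of A c c' _ p u] by (auto simp: coord_vec_def)

lemma coord_vec_linear_combination:
  assumes "smooth_atlas A" "c \<in> A" "p \<in> cdom c"
  shows "coord_vec A c p (a *\<^sub>R u + b *\<^sub>R v) = (\<lambda>c'. a *\<^sub>R coord_vec A c p u c' + b *\<^sub>R coord_vec A c p v c')"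
  using linear_frechet_derivative[OF transition_differentiable[OF assms(1,2) _ assms(3)]]
  by (auto simp: coord_vec_def linear_add linear_cmul)

text \<open>\<open>tangent_map\<close> computes in an arbitrarily chosen chart at \<open>p\<close>.
  The chain rule at the source removes that choice, the chain rule at the target brings in
  \<open>c'\<close>.\<close>

lemma tangent_map_coord_vec:
  assumes A: "smooth_atlas A" "c \<in> A" "p \<in> cdom c" and B: "smooth_atlas B" "c' \<in> B" "f p \<in> cdom c'"
    and f: "smooth_map A B f"
  shows "tangent_map A B f p (coord_vec A c p u) =
    coord_vec B c' (f p) (frechet_derivative (rep c c' f) (at (cmap c p)) u)"
proof
  fix c1
  define c0 where "c0 = chart_at A p"
  have c0: "c0 \<in> A" "p \<in> cdom c0" using chart_at[OF A(1)] by (auto simp: c0_def)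
  have f': "continuous_on UNIV f" "smooth_map_on A B f UNIV" using f by (auto simp: smooth_map_iff)
  show "tangent_map A B f p (coord_vec A c p u) c1 =
    coord_vec B c' (f p) (frechet_derivative (rep c c' f) (at (cmap c p)) u) c1"
  proof (cases "c1 \<in> B \<and> f p \<in> cdom c1")
    case True
    have "tangent_map A B f p (coord_vec A c p u) c1 =
        frechet_derivative (rep c0 c1 f) (at (cmap c0 p)) (frechet_derivative (transition c c0) (at (cmap c p)) u)"
      using True c0 by (simp add: tangent_map_def coord_vec_def rep_def flip: c0_def)
    also have "\<dots> = frechet_derivative (rep c c1 f) (at (cmap c p)) u"
      by (rule rep_chain_left[OF A(1,2) c0(1) A(3) c0(2)])
         (use rep_differentiable[OF f'(2)] c0 True in blast)
    also have "\<dots> = frechet_derivative (transition c' c1) (at (cmap c' (f p)))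
        (frechet_derivative (rep c c' f) (at (cmap c p)) u)"
      by (rule rep_chain_right[symmetric, OF B(1,2) _ B(3) _ smooth_atlas_chart[OF A(1,2)] A(3) open_UNIV UNIV_I f'(1)])
         (use True rep_differentiable[OF f'(2)] A B in blast)+
    finally show ?thesis using True by (simp add: coord_vec_def)
  next
    case False
    then show ?thesis by (auto simp: tangent_map_def coord_vec_def Let_def)
  qed
qed

section \<open>Tensor fields in coordinates\<close>

lemma local2_bilinear_metric:
  assumes A: "smooth_atlas A" "c \<in> A" "p \<in> cdom c" and g: "riemannian_metric A g"
  defines "G \<equiv> \<lambda>u v. g p (coord_vec A c p u) (coord_vec A c p v)"
  shows "bilinear G" "G u v = G v u" "u \<noteq> 0 \<Longrightarrow> G u u > 0"
proof -
  note T = coord_vec_in_tangent_space[OF A]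
  show sym: "G u v = G v u" for u v
    using g T unfolding riemannian_metric_def G_def by blast
  have lin: "G (a *\<^sub>R u + b *\<^sub>R v) w = a * G u w + b * G v w" for a b u v w
    using g T unfolding riemannian_metric_def G_def coord_vec_linear_combination[OF A] by blast
  have "linear (\<lambda>u. G u w)" for w
    by (rule linearI) (use lin[of 1 _ 1] lin[of _ _ 0 0] in auto)
  then show "bilinear G" unfolding bilinear_def using sym by (metis (no_types, lifting) ext)
  have "u \<noteq> 0 \<Longrightarrow> coord_vec A c p u \<noteq> (\<lambda>_. 0)"
    using coord_vec_self[OF A(2) smooth_atlas_chart[OF A(1,2)] A(3), of u] by auto
  then show "u \<noteq> 0 \<Longrightarrow> G u u > 0"
    using g T unfolding riemannian_metric_def G_def by blast
qed

definition continuous_form2 :: "('a::{t2_space, second_countable_topology}, 'e::euclidean_space) chart set \<Rightarrow> ('a, 'e) field2 \<Rightarrow> bool" where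
  "continuous_form2 A \<alpha> \<longleftrightarrow> (\<forall>c\<in>A. \<forall>y\<in>cimg c. bilinear (local2 A c \<alpha> y) \<and> (\<forall>u. local2 A c \<alpha> y u u = 0)) \<and>
     (\<forall>c\<in>A. \<forall>u v. continuous_on (cimg c) (\<lambda>y. local2 A c \<alpha> y u v))"

lemma local2_pullback2:
  assumes A: "smooth_atlas A" "c \<in> A" "y \<in> cimg c" and B: "smooth_atlas B" "c' \<in> B" "f (cinv c y) \<in> cdom c'"
    and f: "smooth_map A B f"
  shows "local2 A c (pullback2 A B f \<omega>) y u v = pull2 (rep c c' f) (local2 B c' \<omega>) y u v"
proof -
  note ch = smooth_atlas_chart[OF A(1,2)] smooth_atlas_chart[OF B(1,2)]
  have p: "cinv c y \<in> cdom c" "cmap c (cinv c y) = y" using chart_simps[OF ch(1)] A(3) by auto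
  have "rep c c' f y = cmap c' (f (cinv c y))" by (simp add: rep_def)
  then have "cinv c' (rep c c' f y) = f (cinv c y)" using chart_simps(3)[OF ch(2) B(3)] by simp
  then show ?thesis
    by (simp add: local2_def pullback2_def pull2_def Let_def tangent_map_coord_vec[OF A(1,2) p(1) B f] p(2))
qed

lemma pull2_bilinear:
  assumes "f differentiable (at x)" "bilinear (\<Omega> (f x))" "\<And>u. \<Omega> (f x) u u = 0"
  shows "bilinear (pull2 f \<Omega> x)" "pull2 f \<Omega> x u u = 0"
proof -
  note l = linear_frechet_derivative[OF assms(1)]
  show "bilinear (pull2 f \<Omega> x)"
    unfolding bilinear_def pull2_def
    using linear_compose[OF l, unfolded o_def] assms(2) unfolding bilinear_def by blast
qed (simp add: pull2_def assms(3))

lemma smooth_on_pull2: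
  fixes f :: "'a::euclidean_space \<Rightarrow> 'e::euclidean_space"
  assumes U: "open U" "smooth_on U f" "f ` U \<subseteq> W" and \<Omega>: "smooth_form2 W \<Omega>"
  shows "smooth_on U (\<lambda>x. pull2 f \<Omega> x u v)"
proof (rule smooth_on_cong[OF U(1)])
  show "smooth_on U (\<lambda>x. \<Sum>a\<in>Basis. \<Sum>b\<in>Basis. (frechet_derivative f (at x) u \<bullet> a) *
     ((frechet_derivative f (at x) v \<bullet> b) * \<Omega> (f x) a b))"
  proof (rule smooth_onI)
    fix k
    have d: "ck_on k U (\<lambda>x. frechet_derivative f (at x) u)" for u
      using smooth_on_frechet_derivative[OF U(2)] by (rule smooth_onD)
    have w: "ck_on k W (\<lambda>y. \<Omega> y a b)" for a b using \<Omega> by (simp add: smooth_form2_def smooth_on_def)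
    show "ck_on k U (\<lambda>x. \<Sum>a\<in>Basis. \<Sum>b\<in>Basis. (frechet_derivative f (at x) u \<bullet> a) *
     ((frechet_derivative f (at x) v \<bullet> b) * \<Omega> (f x) a b))"
      by (intro ck_on_sum ck_on_mult ck_on_inner U(1) d ck_on_compose[OF U(1) smooth_onD[OF U(2)] w U(3)])
  qed
  fix x assume "x \<in> U"
  then have "bilinear (\<Omega> (f x))" using U(3) \<Omega> by (auto simp: smooth_form2_def)
  then have l: "linear (\<lambda>a. \<Omega> (f x) a b)" "linear (\<Omega> (f x) a)" for a b by (auto simp: bilinear_def)
  show "(\<Sum>a\<in>Basis. \<Sum>b\<in>Basis. (frechet_derivative f (at x) u \<bullet> a) *
     ((frechet_derivative f (at x) v \<bullet> b) * \<Omega> (f x) a b)) = pull2 f \<Omega> x u v"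
    unfolding pull2_def
    unfolding linear_expand[OF l(1)[of "frechet_derivative f (at x) v"], of "frechet_derivative f (at x) u"]
    by (simp add: linear_expand[OF l(2), where z = "frechet_derivative f (at x) v"] sum_distrib_left)
qed

text \<open>The interface through which the Kaehler structure enters the pull-back and homotopy
  arguments, phrased chart by chart so that the Poincare lemma can be applied.\<close>

definition closed_smooth_form2 :: "('b::{t2_space, second_countable_topology}, 'e::euclidean_space) chart set \<Rightarrow> ('b, 'e) field2 \<Rightarrow> bool" where
  "closed_smooth_form2 B \<omega> \<longleftrightarrow> (\<forall>c\<in>B. smooth_form2 (cimg c) (local2 B c \<omega>) \<and> closed_on (cimg c) (local2 B c \<omega>))"

lemma continuous_form2_pullback:
  assumes A: "smooth_atlas A" and B: "smooth_atlas B" and \<omega>: "closed_smooth_form2 B \<omega>" and f: "smooth_map A B f"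
  shows "continuous_form2 A (pullback2 A B f \<omega>)"
  unfolding continuous_form2_def
proof (intro conjI ballI allI)
  have f': "continuous_on UNIV f" "smooth_map_on A B f UNIV" using f by (auto simp: smooth_map_iff)
  fix c assume c: "c \<in> A"
  note ch = smooth_atlas_chart[OF A c]
  {
    fix y assume y: "y \<in> cimg c"
    obtain c' where c': "c' \<in> B" "f (cinv c y) \<in> cdom c'" using smooth_atlas_cover[OF B] by blast
    note eq = local2_pullback2[OF A c y B c' f, of \<omega>]
    have p: "cinv c y \<in> cdom c" "cmap c (cinv c y) = y" using chart_simps[OF ch] y by auto
    have d: "rep c c' f differentiable (at y)"
      using rep_differentiable[OF f'(2) c c'(1) p(1) c'(2)] p(2) by simp
    have "rep c c' f y \<in> cimg c'" using c'(2) by (simp add: rep_def)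
    then have "bilinear (local2 B c' \<omega> (rep c c' f y))" "\<And>u. local2 B c' \<omega> (rep c c' f y) u u = 0"
      using \<omega> c'(1) by (auto simp: closed_smooth_form2_def smooth_form2_def)
    note pb = pull2_bilinear[where f = "rep c c' f" and \<Omega> = "local2 B c' \<omega>", OF d this]
    have "local2 A c (pullback2 A B f \<omega>) y = pull2 (rep c c' f) (local2 B c' \<omega>) y"
      by (intro ext eq)
    with pb show "bilinear (local2 A c (pullback2 A B f \<omega>) y)"
      "local2 A c (pullback2 A B f \<omega>) y u u = 0" for u
      by simp_all
  }
  fix u v
  show "continuous_on (cimg c) (\<lambda>y. local2 A c (pullback2 A B f \<omega>) y u v)"
  proof (rule ck_on_continuous[of 0], rule ck_on_local)
    fix y assume y: "y \<in> cimg c"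
    obtain c' where c': "c' \<in> B" "f (cinv c y) \<in> cdom c'" using smooth_atlas_cover[OF B] by blast
    note ch' = smooth_atlas_chart[OF B c'(1)]
    let ?S = "cmap c ` (cdom c \<inter> UNIV \<inter> f -` cdom c')"
    have S: "open ?S" by (rule open_rep_domain[OF ch chart_simps(1)[OF ch'] open_UNIV f'(1)])
    have yS: "y \<in> ?S" using y c' chart_simps(3)[OF ch] by auto
    have sm: "smooth_on ?S (rep c c' f)" using f'(2) c c'(1) by (simp add: smooth_map_on_def)
    have im: "rep c c' f ` ?S \<subseteq> cimg c'" by (auto simp: rep_def chart_simps(3)[OF ch])
    have "smooth_on ?S (\<lambda>x. pull2 (rep c c' f) (local2 B c' \<omega>) x u v)"
      by (rule smooth_on_pull2[OF S sm im]) (use \<omega> c'(1) in \<open>simp add: closed_smooth_form2_def\<close>)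
    then have "ck_on 0 ?S (\<lambda>x. pull2 (rep c c' f) (local2 B c' \<omega>) x u v)" by (rule smooth_onD)
    moreover have "pull2 (rep c c' f) (local2 B c' \<omega>) x u v = local2 A c (pullback2 A B f \<omega>) x u v"
      if x: "x \<in> ?S" for x
      by (rule local2_pullback2[symmetric, OF A c _ B c'(1) _ f]) (use x chart_simps(3)[OF ch] in auto)
    ultimately have "ck_on 0 ?S (\<lambda>y. local2 A c (pullback2 A B f \<omega>) y u v)"
      by (rule ck_on_cong[OF S, rotated])
    then show "\<exists>T. open T \<and> y \<in> T \<and> ck_on 0 T (\<lambda>y. local2 A c (pullback2 A B f \<omega>) y u v)"
      using S yS by blast
  qed
qed

lemma wedge2_wedge_sq: "wedge2 \<alpha> \<alpha> p = wedge_sq (\<alpha> p)"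
  by (simp add: wedge2_def wedge_sq_def fun_eq_iff)

lemma pullback4_wedge2: "pullback4 A B f (wedge2 \<omega> \<omega>) = wedge2 (pullback2 A B f \<omega>) (pullback2 A B f \<omega>)"
  by (simp add: pullback4_def wedge2_def pullback2_def fun_eq_iff)

lemma local4_wedge2: "local4 A c (wedge2 \<alpha> \<alpha>) y =
    wedge_sq (local2 A c \<alpha> y) (axis 1 1) (axis 2 1) (axis 3 1) (axis 4 1)"
  by (simp add: local4_def wedge2_wedge_sq local2_def wedge_sq_def Let_def)

text \<open>Alternation comes from the Hermitian condition: h(Ju, u) = h(JJu, Ju) = -h(u, Ju) =
  -h(Ju, u). Bilinearity and smoothness are those of \<open>h\<close>, once \<open>J\<close> is
  multiplication by i in coordinates.\<close>

lemma closed_smooth_form2_kaehler: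
  assumes "kaehler_manifold B h J"
  shows "closed_smooth_form2 B (kaehler_form h J)"
  unfolding closed_smooth_form2_def
proof (intro ballI conjI)
  have hol: "holomorphic_atlas B" and met: "riemannian_metric B h"
    and J: "\<And>p v. v \<in> tangent_space B p \<Longrightarrow> J p v = (\<lambda>c. \<i> *s v c)"
    and herm: "\<And>p u v. u \<in> tangent_space B p \<Longrightarrow> v \<in> tangent_space B p \<Longrightarrow> h p (J p u) (J p v) = h p u v"
    and closed: "closed_form2 B (kaehler_form h J)"
    using assms by (auto simp: kaehler_manifold_def)
  have B: "smooth_atlas B" using hol by (simp add: holomorphic_atlas_def)
  fix c assume c: "c \<in> B"
  note ch = smooth_atlas_chart[OF B c]
  \<comment> \<open>Derivatives of holomorphic transitions are complex linear, so multiplying the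
    components by i in one chart is the same operation on tangent vectors as in every other
    chart.\<close>
  have Jc: "J p (coord_vec B c p u) = coord_vec B c p (\<i> *s u)" if p: "p \<in> cdom c" for p u
  proof
    have "J p (coord_vec B c p u) = (\<lambda>c'. \<i> *s coord_vec B c p u c')"
      by (rule J[OF coord_vec_in_tangent_space[OF B c p]])
    moreover have "frechet_derivative (transition c c') (at (cmap c p)) (\<i> *s u) =
        \<i> *s frechet_derivative (transition c c') (at (cmap c p)) u" if "c' \<in> B" "p \<in> cdom c'" for c'
      using hol c p that unfolding holomorphic_atlas_def by blast
    ultimately show "J p (coord_vec B c p u) c' = coord_vec B c p (\<i> *s u) c'" for c'
      by (simp add: coord_vec_def)
  qed
  have loc: "local2 B c (kaehler_form h J) y u v = local2 B c h y (\<i> *s u) v" if "y \<in> cimg c" for y u v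
    using Jc[OF chart_simps(5)[OF ch that]] by (simp add: local2_def kaehler_form_def Let_def)
  show "smooth_form2 (cimg c) (local2 B c (kaehler_form h J))"
    unfolding smooth_form2_def
  proof (intro conjI ballI allI)
    fix y assume y: "y \<in> cimg c"
    note p = chart_simps(5)[OF ch y]
    have bil: "bilinear (local2 B c h y)" and sym: "local2 B c h y u v = local2 B c h y v u" for u v
      using local2_bilinear_metric[OF B c p met] by (auto simp: local2_def[abs_def] Let_def)
    have lin: "linear (\<lambda>u :: complex^'b. \<i> *s u)"
      by (rule linearI) (simp_all add: vec_eq_iff algebra_simps)
    have "linear (\<lambda>u. local2 B c h y (\<i> *s u) v)" "linear (\<lambda>v. local2 B c h y (\<i> *s u) v)" for u v
      using bil linear_compose[OF lin, of "\<lambda>w. local2 B c h y w v"] by (auto simp: bilinear_def o_def)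
    then show "bilinear (local2 B c (kaehler_form h J) y)"
      by (simp add: bilinear_def loc[OF y])
    fix u
    have "local2 B c h y (\<i> *s u) u = local2 B c h y (\<i> *s (\<i> *s u)) (\<i> *s u)"
      using herm[OF coord_vec_in_tangent_space[OF B c p] coord_vec_in_tangent_space[OF B c p], of "\<i> *s u" u]
      by (simp add: local2_def Let_def Jc[OF p])
    also have "\<i> *s (\<i> *s u) = - u" by (simp add: vec_eq_iff)
    also have "local2 B c h y (- u) (\<i> *s u) = - local2 B c h y (\<i> *s u) u"
      using bilinear_lneg[OF bil] sym by metis
    finally show "local2 B c (kaehler_form h J) y u u = 0" by (simp add: loc[OF y])
  next
    fix u v
    have "smooth_on (cimg c) (\<lambda>y. local2 B c h y (\<i> *s u) v)"
      using met c by (simp add: riemannian_metric_def smooth_field2_def)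
    then show "smooth_on (cimg c) (\<lambda>y. local2 B c (kaehler_form h J) y u v)"
      by (rule smooth_on_cong[OF chart_simps(2)[OF ch], rotated]) (rule loc[symmetric])
  qed
  show "closed_on (cimg c) (local2 B c (kaehler_form h J))"
    using closed c unfolding closed_form2_def local_ext_deriv2_def closed_on_def by blast
qed

section \<open>Partitions of unity\<close>

lemma smooth_function_continuous:
  assumes A: "smooth_atlas A" and \<mu>: "smooth_function A \<mu>"
  shows "continuous_on UNIV \<mu>"
proof (rule continuous_at_imp_continuous_on, rule ballI)
  fix p
  obtain c where c: "c \<in> A" "p \<in> cdom c" using smooth_atlas_cover[OF A] by blast
  note ch = smooth_atlas_chart[OF A c(1)]
  have "continuous_on (cimg c) (\<mu> \<circ> cinv c)"
    using \<mu> c(1) smooth_onD[THEN ck_on_continuous] unfolding smooth_function_def by blast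
  then have "continuous_on (cdom c) (\<lambda>x. (\<mu> \<circ> cinv c) (cmap c x))"
    by (rule continuous_on_compose2[OF _ chart_simps(6)[OF ch]]) auto
  then have "continuous_on (cdom c) \<mu>"
    by (rule continuous_on_eq) (simp add: chart_simps[OF ch])
  then show "isCont \<mu> p" using c(2) chart_simps(1)[OF ch] continuous_on_eq_continuous_at by blast
qed

lemma smooth_functionI:
  "(\<And>c k. c \<in> A \<Longrightarrow> ck_on k (cimg c) (\<lambda>y. f (cinv c y))) \<Longrightarrow> smooth_function A f"
  by (simp add: smooth_function_def smooth_on_def o_def)

lemma smooth_functionD: "smooth_function A f \<Longrightarrow> c \<in> A \<Longrightarrow> ck_on k (cimg c) (\<lambda>y. f (cinv c y))"
  by (simp add: smooth_function_def smooth_on_def o_def)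

text \<open>Near a point outside the chart domain the function vanishes identically, because the
  preimage of \<open>L\<close> in the manifold is compact, hence closed.\<close>

lemma smooth_function_chart_extension:
  fixes \<beta> :: "'e::euclidean_space \<Rightarrow> real"
  assumes A: "smooth_atlas A" "c \<in> A" and \<beta>: "smooth_on UNIV \<beta>"
    and L: "compact L" "L \<subseteq> cimg c" "\<And>y. y \<notin> L \<Longrightarrow> \<beta> y = 0"
  shows "smooth_function A (\<lambda>p. if p \<in> cdom c then \<beta> (cmap c p) else 0)"
proof (rule smooth_functionI)
  fix c' k assume c': "c' \<in> A"
  note ch = smooth_atlas_chart[OF A] and ch' = smooth_atlas_chart[OF A(1) c']
  let ?b = "\<lambda>p. if p \<in> cdom c then \<beta> (cmap c p) else 0"
  have K: "compact (cinv c ` L)" by (rule chart_compact_inv_image[OF ch L(1,2)])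
  show "ck_on k (cimg c') (\<lambda>y. ?b (cinv c' y))"
  proof (rule ck_on_local)
    fix y assume y: "y \<in> cimg c'"
    show "\<exists>T. open T \<and> y \<in> T \<and> ck_on k T (\<lambda>y. ?b (cinv c' y))"
    proof (cases "cinv c' y \<in> cdom c")
      case True
      let ?T = "cmap c' ` (cdom c' \<inter> cdom c)"
      have T: "open ?T" by (rule chart_open_image[OF ch' chart_simps(1)[OF ch]])
      have "smooth_on ?T (transition c' c)" using A c' by (simp add: smooth_atlas_def)
      then have "ck_on k ?T (\<lambda>y. \<beta> (transition c' c y))"
        using smooth_onD[OF \<beta>] by (intro ck_on_compose[OF T smooth_onD]) auto
      then have "ck_on k ?T (\<lambda>y. ?b (cinv c' y))"
        by (rule ck_on_cong[OF T, rotated]) (auto simp: transition_def chart_simps[OF ch'])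
      moreover have "y \<in> ?T" using True y chart_simps[OF ch'] by (metis IntI image_eqI)
      ultimately show ?thesis using T by blast
    next
      case False
      let ?T = "cmap c' ` (cdom c' \<inter> - cinv c ` L)"
      have T: "open ?T" using K by (intro chart_open_image[OF ch']) (simp add: compact_imp_closed open_Compl)
      have "ck_on k ?T (\<lambda>y. ?b (cinv c' y))"
      proof (rule ck_on_cong[OF T _ ck_on_const[of k _ 0]])
        fix z assume "z \<in> ?T"
        then obtain q where q: "q \<in> cdom c'" "q \<notin> cinv c ` L" "z = cmap c' q" by blast
        have "q \<in> cdom c \<Longrightarrow> cmap c q \<notin> L"
          using q(2) chart_simps(3)[OF ch] by (metis image_eqI)
        then show "0 = ?b (cinv c' z)" using q L(3) by (simp add: chart_simps(3)[OF ch'])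
      qed
      moreover have "cinv c' y \<notin> cinv c ` L" using False L(2) chart_simps(5)[OF ch] by auto
      then have "y \<in> ?T" using y chart_simps(4,5)[OF ch'] by (metis ComplI IntI image_eqI)
      ultimately show ?thesis using T by blast
    qed
  qed
qed

lemma exists_manifold_bump:
  fixes A :: "('a::{t2_space, second_countable_topology}, 'e::euclidean_space) chart set"
  assumes A: "smooth_atlas A" "c \<in> A" "p \<in> cdom c" and N: "open N" "p \<in> N"
  obtains \<mu> K Q where "smooth_function A \<mu>" "\<And>x. 0 \<le> \<mu> x" "\<And>x. \<mu> x \<le> 1"
    "compact K" "K \<subseteq> cdom c" "K \<subseteq> N" "\<And>x. x \<notin> K \<Longrightarrow> \<mu> x = 0"
    "open Q" "p \<in> Q" "Q \<subseteq> K" "\<And>x. x \<in> Q \<Longrightarrow> \<mu> x = 1"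
proof -
  note ch = smooth_atlas_chart[OF A(1,2)]
  have "open (cmap c ` (cdom c \<inter> N))" by (rule chart_open_image[OF ch N(1)])
  then obtain r where r: "r > 0" "cball (cmap c p) r \<subseteq> cmap c ` (cdom c \<inter> N)"
    using A(3) N(2) open_contains_cball by (metis IntI image_eqI)
  obtain \<beta> :: "'e \<Rightarrow> real" where \<beta>: "smooth_on UNIV \<beta>" "\<And>x. 0 \<le> \<beta> x" "\<And>x. \<beta> x \<le> 1"
    "\<And>x. x \<in> cball (cmap c p) (r/2) \<Longrightarrow> \<beta> x = 1" "\<And>x. x \<notin> ball (cmap c p) r \<Longrightarrow> \<beta> x = 0"
    using exists_smooth_bump[of "r/2" r "cmap c p"] r(1) by auto
  \<comment> \<open>\<open>K\<close> corresponds to the closed ball that carries the bump,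
    \<open>Q\<close> to the open ball of half the radius, where the bump is 1.\<close>
  define K where "K = cinv c ` cball (cmap c p) r"
  define Q where "Q = cdom c \<inter> cmap c -` ball (cmap c p) (r/2)"
  have sub: "cball (cmap c p) r \<subseteq> cimg c" using r(2) by blast
  show ?thesis
  proof
    show "smooth_function A (\<lambda>p. if p \<in> cdom c then \<beta> (cmap c p) else 0)"
      by (rule smooth_function_chart_extension[OF A(1,2) \<beta>(1) compact_cball sub])
         (use \<beta>(5) ball_subset_cball in blast)
    show "compact K" unfolding K_def by (rule chart_compact_inv_image[OF ch compact_cball sub])
    show "K \<subseteq> cdom c" unfolding K_def using sub chart_simps(5)[OF ch] by blast
    show "K \<subseteq> N"
      unfolding K_def using r(2) chart_simps(3)[OF ch] by fastforce
    show "(if x \<in> cdom c then \<beta> (cmap c x) else 0) = 0" if "x \<notin> K" for x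
    proof (cases "x \<in> cdom c")
      case True
      then have "cmap c x \<notin> cball (cmap c p) r"
        using that chart_simps(3)[OF ch True] unfolding K_def by (metis image_eqI)
      then show ?thesis using \<beta>(5) by auto
    qed simp
    show "open Q" unfolding Q_def by (rule chart_open_preimage[OF ch open_ball])
    show "p \<in> Q" using A(3) r(1) by (simp add: Q_def)
    show "Q \<subseteq> K"
    proof
      fix x assume "x \<in> Q"
      then have "cmap c x \<in> cball (cmap c p) r" "x = cinv c (cmap c x)"
        using r(1) chart_simps(3)[OF ch] by (auto simp: Q_def)
      then show "x \<in> K" unfolding K_def by blast
    qed
    show "(if x \<in> cdom c then \<beta> (cmap c x) else 0) = 1" if "x \<in> Q" for x
      using that \<beta>(4) by (auto simp: Q_def)
  qed (use \<beta>(2,3) in auto)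
qed

lemma exists_partition_of_unity:
  fixes A :: "('a::{t2_space, second_countable_topology}, 'e::euclidean_space) chart set"
  assumes A: "smooth_atlas A" and M: "compact (UNIV :: 'a set)"
  obtains C \<rho> where "partition_of_unity A C \<rho>"
proof -
  have "\<exists>c \<mu> K Q. c \<in> A \<and> smooth_function A \<mu> \<and> (\<forall>x. 0 \<le> \<mu> x) \<and> compact K \<and> K \<subseteq> cdom c \<and>
     (\<forall>x. x \<notin> K \<longrightarrow> \<mu> x = 0) \<and> open Q \<and> p \<in> Q \<and> (\<forall>x\<in>Q. \<mu> x = 1)" for p
  proof -
    obtain c where c: "c \<in> A" "p \<in> cdom c" using smooth_atlas_cover[OF A] by blast
    obtain \<mu> K Q where "smooth_function A \<mu>" "\<forall>x. 0 \<le> \<mu> x" "compact K" "K \<subseteq> cdom c"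
      "\<forall>x. x \<notin> K \<longrightarrow> \<mu> x = 0" "open Q" "p \<in> Q" "\<forall>x\<in>Q. \<mu> x = 1"
      using exists_manifold_bump[OF A c open_UNIV UNIV_I] by metis
    with c(1) show ?thesis by (intro exI[of _ c] exI[of _ \<mu>] exI[of _ K] exI[of _ Q] conjI)
  qed
  then obtain c \<mu> K Q where c: "\<And>p. c p \<in> A" and \<mu>: "\<And>p. smooth_function A (\<mu> p)" "\<And>p x. 0 \<le> \<mu> p x"
    and K: "\<And>p. compact (K p)" "\<And>p. K p \<subseteq> cdom (c p)" "\<And>p x. x \<notin> K p \<Longrightarrow> \<mu> p x = 0"
    and Q: "\<And>p. open (Q p)" "\<And>p. p \<in> Q p" "\<And>p x. x \<in> Q p \<Longrightarrow> \<mu> p x = 1"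
    by metis
  obtain P where P: "finite P" "UNIV \<subseteq> (\<Union>p\<in>P. Q p)"
  proof (rule compactE_image[OF M, of UNIV Q])
    show "UNIV \<subseteq> (\<Union>p\<in>UNIV. Q p)" using Q(2) by auto
  qed (use Q(1) in auto)
  define S where "S x = (\<Sum>p\<in>P. \<mu> p x)" for x
  have S: "S x > 0" for x
  proof -
    obtain p where p: "p \<in> P" "x \<in> Q p" using P(2) by blast
    have "\<mu> p x \<le> S x" unfolding S_def by (rule member_le_sum[OF p(1)]) (use \<mu> P in auto)
    then show ?thesis using Q(3)[OF p(2)] by simp
  qed
  \<comment> \<open>Partitions of unity are indexed by charts, while the bumps are indexed by
    points: bumps with the same chart are summed before normalising.\<close>
  define \<rho> where "\<rho> d x = (\<Sum>p\<in>{p\<in>P. c p = d}. \<mu> p x) * inverse (S x)" for d x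
  have "partition_of_unity A (c ` P) \<rho>"
    unfolding partition_of_unity_def
  proof (intro conjI ballI allI)
    fix d assume "d \<in> c ` P"
    show "smooth_function A (\<rho> d)"
    proof (rule smooth_functionI)
      fix e k assume e: "e \<in> A"
      note o = chart_simps(2)[OF smooth_atlas_chart[OF A e]]
      show "ck_on k (cimg e) (\<lambda>y. \<rho> d (cinv e y))"
        unfolding \<rho>_def
        by (intro ck_on_mult ck_on_sum ck_on_inverse o smooth_functionD[OF \<mu>(1) e])
           (use S in \<open>simp_all add: S_def ck_on_sum[OF o smooth_functionD[OF \<mu>(1) e]] less_imp_neq[THEN not_sym]\<close>)
    qed
    show "0 \<le> \<rho> d x" for x
      unfolding \<rho>_def using S[of x] by (auto intro!: mult_nonneg_nonneg sum_nonneg \<mu>)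
    have cl: "closed (\<Union>p\<in>{p\<in>P. c p = d}. K p)"
      using P(1) K(1) by (intro closed_UN) (auto intro: compact_imp_closed)
    have "{x. \<rho> d x \<noteq> 0} \<subseteq> (\<Union>p\<in>{p\<in>P. c p = d}. K p)"
    proof
      fix x assume "x \<in> {x. \<rho> d x \<noteq> 0}"
      then have "(\<Sum>p\<in>{p\<in>P. c p = d}. \<mu> p x) \<noteq> 0" by (auto simp: \<rho>_def)
      then obtain p where "p \<in> {p\<in>P. c p = d}" "\<mu> p x \<noteq> 0" by (meson sum.neutral)
      then show "x \<in> (\<Union>p\<in>{p\<in>P. c p = d}. K p)" using K(3) by blast
    qed
    then have "closure {x. \<rho> d x \<noteq> 0} \<subseteq> (\<Union>p\<in>{p\<in>P. c p = d}. K p)"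
      using cl by (rule closure_minimal)
    then show "closure {x. \<rho> d x \<noteq> 0} \<subseteq> cdom d" using K(2) by fastforce
  next
    fix x
    have "(\<Sum>d\<in>c ` P. \<Sum>p\<in>{p\<in>P. c p = d}. \<mu> p x) = S x"
      unfolding S_def by (rule sum.image_gen[OF P(1), symmetric])
    then show "(\<Sum>d\<in>c ` P. \<rho> d x) = 1"
      unfolding \<rho>_def using S[of x] by (simp flip: sum_distrib_right)
  qed (use P c in auto)
  then show ?thesis by (rule that)
qed

section \<open>Integrals of continuous 4-forms\<close>

text \<open>Only the values on coordinate frames enter the integral, so a continuous 4-form is
  described by its coordinate densities and their transformation rule.\<close>

definition continuous_form4 ::
  "('a::{t2_space, second_countable_topology}, real^4) chart set \<Rightarrow> ('a, real^4) field4 \<Rightarrow> bool" where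
  "continuous_form4 A \<eta> \<longleftrightarrow> (\<forall>c\<in>A. continuous_on (cimg c) (local4 A c \<eta>)) \<and>
     (\<forall>c\<in>A. \<forall>c'\<in>A. \<forall>p\<in>cdom c \<inter> cdom c'. local4 A c \<eta> (cmap c p) =
        det (matrix (frechet_derivative (transition c c') (at (cmap c p)))) * local4 A c' \<eta> (cmap c' p))"

lemma continuous_form4D:
  assumes "continuous_form4 A \<eta>"
  shows "c \<in> A \<Longrightarrow> continuous_on (cimg c) (local4 A c \<eta>)"
    "c \<in> A \<Longrightarrow> c' \<in> A \<Longrightarrow> p \<in> cdom c \<Longrightarrow> p \<in> cdom c' \<Longrightarrow> local4 A c \<eta> (cmap c p) =
        det (matrix (frechet_derivative (transition c c') (at (cmap c p)))) * local4 A c' \<eta> (cmap c' p)"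
  using assms unfolding continuous_form4_def by blast+

definition supported_in ::
  "('a, real^4) chart set \<Rightarrow> ('a, real^4) field4 \<Rightarrow> 'a set \<Rightarrow> bool" where
  "supported_in A \<eta> K \<longleftrightarrow> (\<forall>c\<in>A. \<forall>p\<in>cdom c - K. local4 A c \<eta> (cmap c p) = 0)"

definition scale4 :: "('a \<Rightarrow> real) \<Rightarrow> ('a, 'e) field4 \<Rightarrow> ('a, 'e) field4" where
  "scale4 \<kappa> \<eta> = (\<lambda>p a b c d. \<kappa> p * \<eta> p a b c d)"

lemma local4_scale4: "local4 A c (scale4 \<kappa> \<eta>) y = \<kappa> (cinv c y) * local4 A c \<eta> y"
  by (simp add: local4_def scale4_def Let_def)

context
  fixes A :: "('a::{t2_space, second_countable_topology}, real^4) chart set"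
  assumes orient: "oriented_atlas A" and M: "compact (UNIV :: 'a set)"
begin

lemma oriented_atlas_smooth: "smooth_atlas A"
  using orient by (simp add: oriented_atlas_def)

lemmas oriented_atlas_chart = smooth_atlas_chart[OF oriented_atlas_smooth]

lemma continuous_form4_scale4:
  assumes "continuous_on UNIV \<kappa>" "continuous_form4 A \<eta>"
  shows "continuous_form4 A (scale4 \<kappa> \<eta>)"
  unfolding continuous_form4_def
proof (intro conjI ballI)
  fix c assume c: "c \<in> A"
  have "continuous_on (cimg c) (\<lambda>y. \<kappa> (cinv c y))"
    by (rule continuous_on_compose2[OF assms(1) chart_simps(7)[OF oriented_atlas_chart[OF c]]]) simp
  then have "continuous_on (cimg c) (\<lambda>y. \<kappa> (cinv c y) * local4 A c \<eta> y)"
    using assms(2) c by (intro continuous_on_mult) (simp_all add: continuous_form4_def)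
  then show "continuous_on (cimg c) (local4 A c (scale4 \<kappa> \<eta>))"
    by (simp add: local4_scale4[abs_def])
next
  fix c c' p assume c: "c \<in> A" "c' \<in> A" "p \<in> cdom c \<inter> cdom c'"
  then have "local4 A c \<eta> (cmap c p) =
      det (matrix (frechet_derivative (transition c c') (at (cmap c p)))) * local4 A c' \<eta> (cmap c' p)"
    using continuous_form4D(2)[OF assms(2)] by blast
  moreover have "cinv c (cmap c p) = p" "cinv c' (cmap c' p) = p"
    using c chart_simps(3)[OF oriented_atlas_chart] by auto
  ultimately show "local4 A c (scale4 \<kappa> \<eta>) (cmap c p) =
      det (matrix (frechet_derivative (transition c c') (at (cmap c p)))) *
      local4 A c' (scale4 \<kappa> \<eta>) (cmap c' p)"
    unfolding local4_scale4 by (simp only: mult.left_commute)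
qed

lemma supported_in_local4:
  assumes "supported_in A \<eta> K" "c \<in> A" "y \<in> cimg c - cmap c ` (K \<inter> cdom c)"
  shows "local4 A c \<eta> y = 0"
proof -
  have "y = cmap c (cinv c y)" "cinv c y \<in> cdom c" using chart_simps[OF oriented_atlas_chart[OF assms(2)]] assms(3) by auto
  moreover from this have "cinv c y \<in> cdom c - K" using assms(3) by (metis Diff_iff IntI image_eqI)
  ultimately show ?thesis using assms(1,2) unfolding supported_in_def by (metis (no_types))
qed

lemma local4_integrand:
  assumes "continuous_form4 A \<eta>" "supported_in A \<eta> K" "compact K" "c \<in> A" "K \<subseteq> cdom c"
  shows "open (cimg c)" "compact (cmap c ` K)" "cmap c ` K \<subseteq> cimg c" "continuous_on (cimg c) (local4 A c \<eta>)"
    "\<And>y. y \<in> cimg c - cmap c ` K \<Longrightarrow> local4 A c \<eta> y = 0"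
  using assms supported_in_local4[OF assms(2,4)] chart_simps(2)[OF oriented_atlas_chart[OF assms(4)]]
    chart_compact_image[OF oriented_atlas_chart[OF assms(4)] assms(3,5)]
  by (auto simp: continuous_form4_def Int_absorb2)

text \<open>Change of variables along the transition map. The oriented atlas makes the Jacobian
  positive, so its absolute value matches the signed determinant in the transformation rule.\<close>

lemma integral_local4_change_chart:
  assumes \<eta>: "continuous_form4 A \<eta>" "supported_in A \<eta> K" and K: "compact K" "K \<subseteq> cdom c" "K \<subseteq> cdom c'"
    and c: "c \<in> A" "c' \<in> A"
  shows "integral (cimg c) (local4 A c \<eta>) = integral (cimg c') (local4 A c' \<eta>)"
proof -
  let ?D = "cdom c \<inter> cdom c'"
  let ?S = "cmap c ` ?D" and ?S' = "cmap c' ` ?D" and ?\<tau> = "transition c c'"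
  let ?d = "\<lambda>y. frechet_derivative ?\<tau> (at y)"
  let ?h = "local4 A c \<eta>" and ?h' = "local4 A c' \<eta>"
  have opn: "open ?S" "open ?S'"
    using chart_open_image[OF oriented_atlas_chart[OF c(1)] chart_simps(1)[OF oriented_atlas_chart[OF c(2)]]]
      chart_open_image[OF oriented_atlas_chart[OF c(2)] chart_simps(1)[OF oriented_atlas_chart[OF c(1)]]] by (auto simp: Int_commute)
  have im: "?\<tau> ` ?S = ?S'"
    unfolding transition_def image_comp[symmetric]
    using chart_simps(3)[OF oriented_atlas_chart[OF c(1)]] by force
  have inj: "inj_on ?\<tau> ?S"
    using chart_simps(3)[OF oriented_atlas_chart[OF c(1)]] chart_simps(8)[OF oriented_atlas_chart[OF c(2)]]
    by (auto simp: inj_on_def transition_def)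
  have der: "(?\<tau> has_derivative ?d y) (at y within ?S)" if y: "y \<in> ?S" for y
    using y transition_differentiable[OF oriented_atlas_smooth c]
    by (auto intro!: has_derivative_at_withinI differentiable_has_frechet)
  have zero: "?h y = 0" if "y \<in> cimg c - ?S" for y
    by (rule local4_integrand(5)[OF \<eta> K(1) c(1) K(2)]) (use that K in blast)
  have zero': "?h' y = 0" if "y \<in> cimg c' - ?S'" for y
    by (rule local4_integrand(5)[OF \<eta> K(1) c(2) K(3)]) (use that K in blast)
  have e1: "integral (cimg c) ?h = integral ?S ?h"
    by (rule integral_spike_set) (use zero in \<open>auto intro!: negligible_subset[OF negligible_empty]\<close>)
  have e2: "integral (cimg c') ?h' = integral ?S' ?h'"
    by (rule integral_spike_set) (use zero' in \<open>auto intro!: negligible_subset[OF negligible_empty]\<close>)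
  have "?h' absolutely_integrable_on ?S'"
  proof (rule absolutely_integrable_compact_support[OF opn(2)])
    show "compact (cmap c' ` K)" by (rule local4_integrand(2)[OF \<eta> K(1) c(2) K(3)])
    show "cmap c' ` K \<subseteq> ?S'" using K by blast
    show "continuous_on ?S' ?h'"
      by (rule continuous_on_subset[OF local4_integrand(4)[OF \<eta> K(1) c(2) K(3)]]) blast
    show "?h' y = 0" if "y \<in> ?S' - cmap c' ` K" for y
      by (rule local4_integrand(5)[OF \<eta> K(1) c(2) K(3)]) (use that in blast)
  qed
  \<comment> \<open>The change-of-variables rule is for integrands with values in
    \<open>real^'n\<close>, hence the passage through \<open>real^1\<close>.\<close>
  then have "(\<lambda>y. vec (?h' y) :: real^1) absolutely_integrable_on ?\<tau> ` ?S"
    by (simp add: im absolutely_integrable_on_1_iff)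
  then have "integral (?\<tau> ` ?S) (\<lambda>y. vec (?h' y) :: real^1) =
      integral ?S (\<lambda>y. \<bar>det (matrix (?d y))\<bar> *\<^sub>R (vec (?h' (?\<tau> y)) :: real^1))"
    using opn(1) der inj by (intro integral_change_of_variables) auto
  also have "\<dots> = integral ?S (\<lambda>y. vec (?h y) :: real^1)"
  proof (rule integral_cong)
    fix y assume "y \<in> ?S"
    then obtain p where p: "p \<in> ?D" "y = cmap c p" by blast
    have "det (matrix (?d y)) > 0" using orient c p unfolding oriented_atlas_def by blast
    moreover have "?h y = det (matrix (?d y)) * ?h' (cmap c' p)"
      using \<eta>(1) c p unfolding continuous_form4_def by blast
    moreover have "?\<tau> y = cmap c' p" using p chart_simps(3)[OF oriented_atlas_chart[OF c(1)]] by (simp add: transition_def)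
    ultimately show "\<bar>det (matrix (?d y))\<bar> *\<^sub>R (vec (?h' (?\<tau> y)) :: real^1) = vec (?h y)"
      by (simp only: abs_of_pos vec_cmul[symmetric] scalar_mult_eq_scaleR[symmetric])
  qed
  finally show ?thesis unfolding e1 e2 im by (simp add: integral_on_1_eq vec_eq_iff)
qed

lemma partition_of_unity_support:
  assumes "partition_of_unity A C \<rho>" "c \<in> C"
  shows "compact (closure {p. \<rho> c p \<noteq> 0})" "closure {p. \<rho> c p \<noteq> 0} \<subseteq> cdom c"
    "continuous_on UNIV (\<rho> c)" "supported_in A (scale4 (\<rho> c) \<eta>) (closure {p. \<rho> c p \<noteq> 0})" "c \<in> A"
proof -
  show "compact (closure {p. \<rho> c p \<noteq> 0})" using M compact_Int_closed[OF M closed_closure] by simp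
  show "closure {p. \<rho> c p \<noteq> 0} \<subseteq> cdom c" "c \<in> A" using assms by (auto simp: partition_of_unity_def)
  show "continuous_on UNIV (\<rho> c)"
    using assms smooth_function_continuous[OF oriented_atlas_smooth] by (auto simp: partition_of_unity_def)
  show "supported_in A (scale4 (\<rho> c) \<eta>) (closure {p. \<rho> c p \<noteq> 0})"
    unfolding supported_in_def local4_scale4
  proof (intro ballI)
    fix d p assume "d \<in> A" "p \<in> cdom d - closure {p. \<rho> c p \<noteq> 0}"
    then have "\<rho> c p = 0" "p \<in> cdom d" using closure_subset[of "{p. \<rho> c p \<noteq> 0}"] by auto
    then show "\<rho> c (cinv d (cmap d p)) * local4 A d \<eta> (cmap d p) = 0"
      using \<open>d \<in> A\<close> by (simp add: chart_simps(3)[OF oriented_atlas_chart])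
  qed
qed

lemma supported_in_scale4: "supported_in A \<eta> K \<Longrightarrow> supported_in A (scale4 \<kappa> \<eta>) K"
  by (simp add: supported_in_def local4_scale4)

lemma supported_in_Int: "supported_in A \<eta> K \<Longrightarrow> supported_in A \<eta> K' \<Longrightarrow> supported_in A \<eta> (K \<inter> K')"
  unfolding supported_in_def by blast

text \<open>Each summand is supported in both charts, so it may be integrated in the chart of its
  partition function instead of \<open>c\<close>.\<close>

lemma integral_local4_partition:
  assumes \<rho>: "partition_of_unity A C \<rho>" and \<eta>: "continuous_form4 A \<eta>" "supported_in A \<eta> K"
    and K: "compact K" "K \<subseteq> cdom c" and c: "c \<in> A"
  shows "integral (cimg c) (local4 A c \<eta>) = (\<Sum>d\<in>C. integral (cimg d) (local4 A d (scale4 (\<rho> d) \<eta>)))"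
proof -
  let ?L = "\<lambda>d. K \<inter> closure {p. \<rho> d p \<noteq> 0}"
  have form: "continuous_form4 A (scale4 (\<rho> d) \<eta>)" "supported_in A (scale4 (\<rho> d) \<eta>) (?L d)"
    "compact (?L d)" "?L d \<subseteq> cdom c" "?L d \<subseteq> cdom d" "d \<in> A" if "d \<in> C" for d
    using partition_of_unity_support[OF \<rho> that] K \<eta>
    by (auto intro: continuous_form4_scale4 supported_in_Int supported_in_scale4 compact_Int_closed)
  have "local4 A c \<eta> y = (\<Sum>d\<in>C. local4 A c (scale4 (\<rho> d) \<eta>) y)" for y
    using \<rho> by (simp add: local4_scale4 partition_of_unity_def flip: sum_distrib_right)
  then have "integral (cimg c) (local4 A c \<eta>) = integral (cimg c) (\<lambda>y. \<Sum>d\<in>C. local4 A c (scale4 (\<rho> d) \<eta>) y)"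
    by presburger
  also have "\<dots> = (\<Sum>d\<in>C. integral (cimg c) (local4 A c (scale4 (\<rho> d) \<eta>)))"
  proof (rule integral_sum)
    show "finite C" using \<rho> by (simp add: partition_of_unity_def)
    fix d assume d: "d \<in> C"
    note f = form[OF d]
    show "local4 A c (scale4 (\<rho> d) \<eta>) integrable_on cimg c"
      by (rule integrable_compact_support[OF local4_integrand[OF f(1,2,3) c f(4)]])
  qed
  also have "\<dots> = (\<Sum>d\<in>C. integral (cimg d) (local4 A d (scale4 (\<rho> d) \<eta>)))"
    by (rule sum.cong[OF refl], rule integral_local4_change_chart) (use form c in blast)+
  finally show ?thesis .
qed

text \<open>Inserting one partition into the sum for another leads to the same double sum, because
  every product form is supported in both charts and can be integrated in either. Thus the definite
  description denotes.\<close>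

lemma form_integral_eq:
  assumes \<rho>: "partition_of_unity A C \<rho>" and \<eta>: "continuous_form4 A \<eta>"
  shows "form_integral A \<eta> = (\<Sum>c\<in>C. integral (cimg c) (local4 A c (scale4 (\<rho> c) \<eta>)))"
proof -
  let ?I = "\<lambda>C \<rho>. \<Sum>c\<in>C. integral (cimg c) (local4 A c (scale4 (\<rho> c) \<eta>))"
  have swap: "scale4 (\<rho> d) (scale4 (\<rho>' c) \<eta>) = scale4 (\<rho>' c) (scale4 (\<rho> d) \<eta>)" for d c and \<rho> \<rho>' :: "('a, real^4) chart \<Rightarrow> 'a \<Rightarrow> real"
    by (simp add: scale4_def fun_eq_iff)
  have expand: "?I C' \<rho>' = (\<Sum>c\<in>C'. \<Sum>d\<in>C. integral (cimg d) (local4 A d (scale4 (\<rho> d) (scale4 (\<rho>' c) \<eta>))))"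
    if r: "partition_of_unity A C' \<rho>'" "partition_of_unity A C \<rho>" for C' \<rho>' C \<rho>
  proof (rule sum.cong[OF refl])
    fix c assume c: "c \<in> C'"
    note s = partition_of_unity_support[OF r(1) c]
    show "integral (cimg c) (local4 A c (scale4 (\<rho>' c) \<eta>)) =
        (\<Sum>d\<in>C. integral (cimg d) (local4 A d (scale4 (\<rho> d) (scale4 (\<rho>' c) \<eta>))))"
      by (rule integral_local4_partition[OF r(2) continuous_form4_scale4[OF s(3) \<eta>] s(4,1,2,5)])
  qed
  have indep: "?I C' \<rho>' = ?I C \<rho>" if r: "partition_of_unity A C' \<rho>'" for C' \<rho>'
  proof -
    have "?I C' \<rho>' = (\<Sum>c\<in>C'. \<Sum>d\<in>C. integral (cimg d) (local4 A d (scale4 (\<rho> d) (scale4 (\<rho>' c) \<eta>))))"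
      by (rule expand[OF r \<rho>])
    also have "\<dots> = (\<Sum>d\<in>C. \<Sum>c\<in>C'. integral (cimg d) (local4 A d (scale4 (\<rho> d) (scale4 (\<rho>' c) \<eta>))))"
      by (rule sum.swap)
    also have "\<dots> = (\<Sum>d\<in>C. integral (cimg d) (local4 A d (scale4 (\<rho> d) \<eta>)))"
    proof (rule sum.cong[OF refl])
      fix d assume d: "d \<in> C"
      note s = partition_of_unity_support[OF \<rho> d]
      have "(\<Sum>c\<in>C'. integral (cimg d) (local4 A d (scale4 (\<rho> d) (scale4 (\<rho>' c) \<eta>)))) =
          (\<Sum>c\<in>C'. integral (cimg c) (local4 A c (scale4 (\<rho>' c) (scale4 (\<rho> d) \<eta>))))"
      proof (rule sum.cong[OF refl])
        fix c assume c: "c \<in> C'"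
        note s' = partition_of_unity_support[OF r c]
        have f: "continuous_form4 A (scale4 (\<rho>' c) (scale4 (\<rho> d) \<eta>))"
          by (intro continuous_form4_scale4 s s' \<eta>)
        have g: "supported_in A (scale4 (\<rho>' c) (scale4 (\<rho> d) \<eta>))
            (closure {p. \<rho>' c p \<noteq> 0} \<inter> closure {p. \<rho> d p \<noteq> 0})"
          by (intro supported_in_Int s' supported_in_scale4 s)
        show "integral (cimg d) (local4 A d (scale4 (\<rho> d) (scale4 (\<rho>' c) \<eta>))) =
            integral (cimg c) (local4 A c (scale4 (\<rho>' c) (scale4 (\<rho> d) \<eta>)))"
          unfolding swap[of \<rho> d \<rho>' c]
          by (rule integral_local4_change_chart[OF f g _ _ _ s(5) s'(5)])
             (use s(2) s'(2) in \<open>auto intro: compact_Int_closed[OF s'(1)]\<close>)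
      qed
      also have "\<dots> = integral (cimg d) (local4 A d (scale4 (\<rho> d) \<eta>))"
        by (rule integral_local4_partition[symmetric, OF r continuous_form4_scale4[OF s(3) \<eta>] s(4,1,2,5)])
      finally show "(\<Sum>c\<in>C'. integral (cimg d) (local4 A d (scale4 (\<rho> d) (scale4 (\<rho>' c) \<eta>)))) =
          integral (cimg d) (local4 A d (scale4 (\<rho> d) \<eta>))" .
    qed
    finally show ?thesis .
  qed
  have integrand: "(\<lambda>y. \<rho> c (cinv c y) * local4 A c \<eta> y) = local4 A c (scale4 (\<rho> c) \<eta>)"
    for \<rho> :: "('a, real^4) chart \<Rightarrow> 'a \<Rightarrow> real" and c
    by (simp add: local4_scale4 fun_eq_iff)
  show ?thesis
    unfolding form_integral_def integrand
  proof (rule the_equality)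
    show "\<exists>C' \<rho>'. partition_of_unity A C' \<rho>' \<and> ?I C \<rho> = ?I C' \<rho>'" using \<rho> by blast
    fix I assume "\<exists>C' \<rho>'. partition_of_unity A C' \<rho>' \<and> I = ?I C' \<rho>'"
    then obtain C' \<rho>' where "partition_of_unity A C' \<rho>'" "I = ?I C' \<rho>'" by blast
    then show "I = ?I C \<rho>" using indep by simp
  qed
qed

lemma form_integral_supported:
  assumes \<eta>: "continuous_form4 A \<eta>" "supported_in A \<eta> K" and K: "compact K" "K \<subseteq> cdom c" "c \<in> A"
  shows "form_integral A \<eta> = integral (cimg c) (local4 A c \<eta>)"
proof -
  obtain C \<rho> where \<rho>: "partition_of_unity A C \<rho>" using exists_partition_of_unity[OF oriented_atlas_smooth M] .
  show ?thesis
    using form_integral_eq[OF \<rho> \<eta>(1)] integral_local4_partition[OF \<rho> \<eta> K] by simp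
qed

lemma integrable_local4_partition:
  assumes "partition_of_unity A C \<rho>" "c \<in> C" "continuous_form4 A \<eta>"
  shows "local4 A c (scale4 (\<rho> c) \<eta>) integrable_on cimg c"
proof -
  note s = partition_of_unity_support[OF assms(1,2)]
  show ?thesis
    by (rule integrable_compact_support[OF
        local4_integrand[OF continuous_form4_scale4[OF s(3) assms(3)] s(4) s(1) s(5) s(2)]])
qed

lemma continuous_form4_lincomb:
  assumes "continuous_form4 A \<eta>" "continuous_form4 A \<zeta>"
  shows "continuous_form4 A (\<lambda>p w x y z. a * \<eta> p w x y z + b * \<zeta> p w x y z)"
proof -
  have l: "local4 A c (\<lambda>p w x y z. a * \<eta> p w x y z + b * \<zeta> p w x y z) =
      (\<lambda>y. a * local4 A c \<eta> y + b * local4 A c \<zeta> y)" for c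
    by (simp add: local4_def Let_def fun_eq_iff)
  show ?thesis
    unfolding continuous_form4_def l
  proof (intro conjI ballI)
    fix c assume "c \<in> A"
    then show "continuous_on (cimg c) (\<lambda>y. a * local4 A c \<eta> y + b * local4 A c \<zeta> y)"
      by (intro continuous_intros continuous_form4D assms)
  next
    fix c c' p assume c: "c \<in> A" "c' \<in> A" "p \<in> cdom c \<inter> cdom c'"
    show "a * local4 A c \<eta> (cmap c p) + b * local4 A c \<zeta> (cmap c p) =
        det (matrix (frechet_derivative (transition c c') (at (cmap c p)))) *
        (a * local4 A c' \<eta> (cmap c' p) + b * local4 A c' \<zeta> (cmap c' p))"
      using continuous_form4D(2)[OF assms(1) c(1,2)] continuous_form4D(2)[OF assms(2) c(1,2)] c(3)
      by (simp only: Int_iff distrib_left mult.left_commute)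
  qed
qed

lemma form_integral_lincomb:
  assumes "continuous_form4 A \<eta>" "continuous_form4 A \<zeta>"
  shows "form_integral A (\<lambda>p w x y z. a * \<eta> p w x y z + b * \<zeta> p w x y z) =
    a * form_integral A \<eta> + b * form_integral A \<zeta>"
proof -
  obtain C \<rho> where \<rho>: "partition_of_unity A C \<rho>" using exists_partition_of_unity[OF oriented_atlas_smooth M] .
  have l: "local4 A c (scale4 \<kappa> (\<lambda>p w x y z. a * \<eta> p w x y z + b * \<zeta> p w x y z)) =
      (\<lambda>y. a * local4 A c (scale4 \<kappa> \<eta>) y + b * local4 A c (scale4 \<kappa> \<zeta>) y)" for c \<kappa>
    by (simp add: local4_def Let_def scale4_def fun_eq_iff algebra_simps)
  have "form_integral A (\<lambda>p w x y z. a * \<eta> p w x y z + b * \<zeta> p w x y z) =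
      (\<Sum>c\<in>C. a * integral (cimg c) (local4 A c (scale4 (\<rho> c) \<eta>)) + b * integral (cimg c) (local4 A c (scale4 (\<rho> c) \<zeta>)))"
    unfolding form_integral_eq[OF \<rho> continuous_form4_lincomb[OF assms]] l
  proof (rule sum.cong[OF refl])
    fix c assume c: "c \<in> C"
    note int = integrable_local4_partition[OF \<rho> c]
    show "integral (cimg c) (\<lambda>y. a * local4 A c (scale4 (\<rho> c) \<eta>) y + b * local4 A c (scale4 (\<rho> c) \<zeta>) y) =
        a * integral (cimg c) (local4 A c (scale4 (\<rho> c) \<eta>)) + b * integral (cimg c) (local4 A c (scale4 (\<rho> c) \<zeta>))"
      using integrable_cmul[OF int[OF assms(1)], of a] integrable_cmul[OF int[OF assms(2)], of b]
      by (simp add: Henstock_Kurzweil_Integration.integral_add)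
  qed
  then show ?thesis
    by (simp add: form_integral_eq[OF \<rho>] assms sum.distrib sum_distrib_left)
qed

text \<open>For the second claim, some partition function is nonzero at \<open>p\<close>. Its
  integral is one of finitely many nonnegative summands of 0, so its continuous integrand vanishes
  at \<open>p\<close>, and the transformation rule passes to any other chart.\<close>

lemma form_integral_nonneg:
  assumes \<eta>: "continuous_form4 A \<eta>" and nn: "\<And>c p. c \<in> A \<Longrightarrow> p \<in> cdom c \<Longrightarrow> local4 A c \<eta> (cmap c p) \<ge> 0"
  shows "form_integral A \<eta> \<ge> 0"
    and "form_integral A \<eta> = 0 \<Longrightarrow> c \<in> A \<Longrightarrow> p \<in> cdom c \<Longrightarrow> local4 A c \<eta> (cmap c p) = 0"
proof -
  obtain C \<rho> where \<rho>: "partition_of_unity A C \<rho>" using exists_partition_of_unity[OF oriented_atlas_smooth M] .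
  have \<rho>nn: "\<rho> d q \<ge> 0" if "d \<in> C" for d q using \<rho> that by (simp add: partition_of_unity_def)
  have CA: "d \<in> A" if "d \<in> C" for d using \<rho> that by (auto simp: partition_of_unity_def)
  have finC: "finite C" using \<rho> by (simp add: partition_of_unity_def)
  have nn': "local4 A d (scale4 (\<rho> d) \<eta>) y \<ge> 0" if d: "d \<in> C" "y \<in> cimg d" for d y
  proof -
    have "y = cmap d (cinv d y)" "cinv d y \<in> cdom d" using d CA chart_simps[OF oriented_atlas_chart] by auto
    then have "local4 A d \<eta> y \<ge> 0" using nn[OF CA[OF d(1)]] by metis
    then show ?thesis using \<rho>nn[OF d(1)] by (simp add: local4_scale4)
  qed
  have inn: "integral (cimg d) (local4 A d (scale4 (\<rho> d) \<eta>)) \<ge> 0" if d: "d \<in> C" for d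
    by (rule Henstock_Kurzweil_Integration.integral_nonneg[OF integrable_local4_partition[OF \<rho> d \<eta>]]) (rule nn'[OF d])
  show "form_integral A \<eta> \<ge> 0"
    unfolding form_integral_eq[OF \<rho> \<eta>] by (rule sum_nonneg) (rule inn)
  assume z: "form_integral A \<eta> = 0" and c: "c \<in> A" "p \<in> cdom c"
  have "(\<Sum>d\<in>C. \<rho> d p) \<noteq> 0" using \<rho> by (simp add: partition_of_unity_def)
  then obtain d where d: "d \<in> C" "\<rho> d p \<noteq> 0" by (meson sum.neutral)
  note s = partition_of_unity_support[OF \<rho> d(1)]
  have "p \<in> closure {p. \<rho> d p \<noteq> 0}" using d(2) closure_subset[of "{p. \<rho> d p \<noteq> 0}"] by auto
  then have pd: "p \<in> cdom d" using s(2) by blast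
  have "integral (cimg d) (local4 A d (scale4 (\<rho> d) \<eta>)) = 0"
    using z d(1) inn finC unfolding form_integral_eq[OF \<rho> \<eta>] by (simp add: sum_nonneg_eq_0_iff)
  note zero = this
  have "local4 A d (scale4 (\<rho> d) \<eta>) (cmap d p) = 0"
    by (rule integral_eq_0_compact_support[OF
        local4_integrand[OF continuous_form4_scale4[OF s(3) \<eta>] s(4) s(1) s(5) s(2)] nn'[OF d(1)] zero])
       (use pd in auto)
  then have "local4 A d \<eta> (cmap d p) = 0"
    using d(2) pd by (simp add: local4_scale4 chart_simps(3)[OF oriented_atlas_chart[OF s(5)]])
  then show "local4 A c \<eta> (cmap c p) = 0"
    using continuous_form4D(2)[OF \<eta> c(1) s(5) c(2) pd] by simp
qed

end

section \<open>Orthonormal frames and the volume form\<close>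

lemma continuous_on_det:
  fixes M :: "'a::topological_space \<Rightarrow> real^'n^'n"
  assumes "\<And>i j. continuous_on S (\<lambda>x. M x $ i $ j)"
  shows "continuous_on S (\<lambda>x. det (M x))"
  unfolding det_def by (intro continuous_intros assms)

lemma vector_4_eta: "vector [f 1, f 2, f 3, f 4] = ((\<chi> j. f j) :: 'a::zero^4)"
  by (simp add: vec_eq_iff forall_4)

lemma column_of_columns: "column j (\<chi> i j. e j $ i) = e j"
  by (simp add: column_def vec_eq_iff)

lemma linear_columns:
  fixes T :: "real^'n \<Rightarrow> real^'n"
  assumes "linear T"
  shows "(\<chi> i j. T (e j) $ i) = matrix T ** (\<chi> i j. e j $ i)"
proof -
  have "T x = matrix T *v x" for x using fun_cong[OF matrix_vector_mul(2)[OF assms], of x] by simp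
  then show ?thesis by (simp add: matrix_matrix_mult_def matrix_vector_mult_def vec_eq_iff)
qed

text \<open>Gram-Schmidt in one chart, with the first vector reversed if the determinant is
  negative. Positive Jacobians carry the orientation to all other charts.\<close>

lemma exists_oriented_orthonormal_frame:
  assumes orient: "oriented_atlas A" and g: "riemannian_metric A g"
  shows "\<exists>e. oriented_orthonormal_frame A g p e"
proof -
  have A: "smooth_atlas A" using orient by (simp add: oriented_atlas_def)
  obtain c where c: "c \<in> A" "p \<in> cdom c" using smooth_atlas_cover[OF A] by blast
  define G where "G u v = g p (coord_vec A c p u) (coord_vec A c p v)" for u v
  have G: "bilinear G" "\<And>u v. G u v = G v u" "\<And>u. u \<noteq> 0 \<Longrightarrow> G u u > 0"
    using local2_bilinear_metric[OF A c g] by (auto simp: G_def[abs_def])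
  have "\<exists>e0 :: 4 \<Rightarrow> real^4. \<forall>i j. G (e0 i) (e0 j) = (if i = j then 1 else 0 :: real)"
  proof (rule gram_schmidt[of G])
    show "bilinear G" by (rule G(1))
    show "G u v = G v u" for u v by (rule G(2))
    show "u \<noteq> 0 \<Longrightarrow> G u u > 0" for u by (rule G(3))
  qed blast
  then obtain e0 :: "4 \<Rightarrow> real^4" where e0: "\<And>i j. G (e0 i) (e0 j) = (if i = j then 1 else 0 :: real)" by blast
  define E0 where "E0 = ((\<chi> i j. e0 j $ i) :: real^4^4)"
  have "det E0 \<noteq> 0"
    using det_coframe_frame[OF G(1), of E0] e0 by (auto simp: E0_def column_of_columns)
  have "\<exists>e1. (\<forall>i j. G (e1 i) (e1 j) = (if i = j then 1 else 0)) \<and> det ((\<chi> i j. e1 j $ i) :: real^4^4) > 0"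
  proof (cases "det E0 > 0")
    case True
    then show ?thesis using e0 unfolding E0_def by blast
  next
    case False
    define e1 where "e1 = e0(1 := - e0 1)"
    have "G (e1 i) (e1 j) = (if i = j then 1 else 0)" for i j
      using e0 by (simp add: e1_def bilinear_lneg[OF G(1)] bilinear_rneg[OF G(1)])
    moreover have "det ((\<chi> i j. e1 j $ i) :: real^4^4) = - det E0"
      by (simp add: det_4 e1_def E0_def)
    ultimately show ?thesis using False \<open>det E0 \<noteq> 0\<close> by (intro exI[of _ e1]) auto
  qed
  then obtain e1 where e1: "\<And>i j. G (e1 i) (e1 j) = (if i = j then 1 else 0)"
    "det ((\<chi> i j. e1 j $ i) :: real^4^4) > 0" by blast
  have "oriented_orthonormal_frame A g p (\<lambda>i. coord_vec A c p (e1 i))"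
    unfolding oriented_orthonormal_frame_def
  proof (intro conjI allI ballI impI)
    show "coord_vec A c p (e1 i) \<in> tangent_space A p" for i by (rule coord_vec_in_tangent_space[OF A c])
    show "g p (coord_vec A c p (e1 i)) (coord_vec A c p (e1 j)) = (if i = j then 1 else 0)" for i j
      using e1(1) by (simp add: G_def)
    fix c' assume c': "c' \<in> A" "p \<in> cdom c'"
    let ?T = "frechet_derivative (transition c c') (at (cmap c p))"
    have "linear ?T" by (rule linear_frechet_derivative[OF transition_differentiable[OF A c(1) c'(1) c(2) c'(2)]])
    moreover have "det (matrix ?T) > 0" using orient c c' unfolding oriented_atlas_def by blast
    ultimately show "det ((\<chi> i j. coord_vec A c p (e1 j) c' $ i) :: real^4^4) > 0"
      using c' e1(2) by (simp add: coord_vec_def linear_columns det_mul)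
  qed
  then show ?thesis by blast
qed

lemma local2_cmap:
  assumes "smooth_atlas A" "c \<in> A" "p \<in> cdom c"
  shows "local2 A c \<alpha> (cmap c p) u v = \<alpha> p (coord_vec A c p u) (coord_vec A c p v)"
  using chart_simps(3)[OF smooth_atlas_chart[OF assms(1,2)] assms(3)] by (simp add: local2_def Let_def)

lemma continuous_form2_local:
  assumes "continuous_form2 A \<alpha>" "c \<in> A" "p \<in> cdom c"
  shows "bilinear (local2 A c \<alpha> (cmap c p))" "local2 A c \<alpha> (cmap c p) u u = 0"
  using assms unfolding continuous_form2_def by blast+

lemma continuous_form4_wedge2:
  assumes at: "smooth_atlas A" and \<alpha>: "continuous_form2 A \<alpha>"
  shows "continuous_form4 A (wedge2 \<alpha> \<alpha>)"
  unfolding continuous_form4_def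
proof (intro conjI ballI)
  fix c assume c: "c \<in> A"
  have "continuous_on (cimg c) (\<lambda>y. local2 A c \<alpha> y u v)" for u v
    using \<alpha> c unfolding continuous_form2_def by blast
  then show "continuous_on (cimg c) (local4 A c (wedge2 \<alpha> \<alpha>))"
    unfolding local4_wedge2[abs_def] wedge_sq_def by (intro continuous_intros)
next
  fix c c' p assume c: "c \<in> A" "c' \<in> A" "p \<in> cdom c \<inter> cdom c'"
  then have p: "p \<in> cdom c" "p \<in> cdom c'" by auto
  let ?T = "frechet_derivative (transition c c') (at (cmap c p))"
  have col: "column j (matrix ?T) = ?T (axis j 1)" for j
    by (simp add: column_def matrix_def vec_eq_iff)
  have "local2 A c \<alpha> (cmap c p) u v = local2 A c' \<alpha> (cmap c' p) (?T u) (?T v)" for u v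
    using coord_vec_change[OF at c(1,2) p] by (simp add: local2_cmap[OF at] c p)
  then have "local4 A c (wedge2 \<alpha> \<alpha>) (cmap c p) =
      wedge_sq (local2 A c' \<alpha> (cmap c' p)) (column 1 (matrix ?T)) (column 2 (matrix ?T)) (column 3 (matrix ?T)) (column 4 (matrix ?T))"
    unfolding local4_wedge2 wedge_sq_def col by simp
  also have "\<dots> = det (matrix ?T) * local4 A c' (wedge2 \<alpha> \<alpha>) (cmap c' p)"
    unfolding local4_wedge2 by (rule wedge_sq_det) (use continuous_form2_local[OF \<alpha>] c p in auto)
  finally show "local4 A c (wedge2 \<alpha> \<alpha>) (cmap c p) = det (matrix ?T) * local4 A c' (wedge2 \<alpha> \<alpha>) (cmap c' p)" .
qed

section \<open>Frames, Gram matrix and volume form in charts\<close>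

context
  fixes A :: "('a::{t2_space, second_countable_topology}, real^4) chart set" and g :: "('a, real^4) field2"
  assumes orient: "oriented_atlas A" and M: "compact (UNIV :: 'a set)" and g: "riemannian_metric A g"
begin

lemmas metric_atlas_smooth = oriented_atlas_smooth[OF orient M]
lemmas chart_of_atlas = smooth_atlas_chart[OF metric_atlas_smooth]

lemma frame_at_orthonormal: "oriented_orthonormal_frame A g p (frame_at A g p)"
  unfolding frame_at_def by (rule someI_ex[OF exists_oriented_orthonormal_frame[OF orient g]])

definition frame_matrix :: "('a, real^4) chart \<Rightarrow> 'a \<Rightarrow> real^4^4" where
  "frame_matrix c p = (\<chi> i j. frame_at A g p j c $ i)"

lemma column_frame_matrix: "column j (frame_matrix c p) = frame_at A g p j c"
  by (simp add: frame_matrix_def column_of_columns)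

lemmas local2_at = local2_cmap[OF metric_atlas_smooth]

lemma coord_vec_column: "c \<in> A \<Longrightarrow> p \<in> cdom c \<Longrightarrow> coord_vec A c p (column j (frame_matrix c p)) = frame_at A g p j"
  using frame_at_orthonormal[of p] by (simp add: column_frame_matrix tangent_vec_eq_coord_vec oriented_orthonormal_frame_def)

lemma local2_frame:
  "c \<in> A \<Longrightarrow> p \<in> cdom c \<Longrightarrow>
   local2 A c \<alpha> (cmap c p) (column i (frame_matrix c p)) (column j (frame_matrix c p)) =
   \<alpha> p (frame_at A g p i) (frame_at A g p j)"
  by (simp add: local2_at coord_vec_column)

lemma metric_local:
  assumes "c \<in> A" "y \<in> cimg c"
  shows "bilinear (local2 A c g y)" "local2 A c g y u v = local2 A c g y v u"
  using local2_bilinear_metric[OF metric_atlas_smooth assms(1) chart_simps(5)[OF chart_of_atlas[OF assms(1)] assms(2)] g]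
  by (auto simp: local2_def[abs_def] Let_def)

lemma metric_local_frame:
  assumes "c \<in> A" "p \<in> cdom c"
  shows "bilinear (local2 A c g (cmap c p))"
    "local2 A c g (cmap c p) (column i (frame_matrix c p)) (column j (frame_matrix c p)) = (if i = j then 1 else 0)"
    "det (frame_matrix c p) > 0"
  using metric_local(1)[OF assms(1)] local2_frame[OF assms] frame_at_orthonormal[of p] assms
  by (auto simp: oriented_orthonormal_frame_def frame_matrix_def)

lemma local4_volume_form:
  assumes c: "c \<in> A" "p \<in> cdom c"
  shows "local4 A c (volume_form A g) (cmap c p) =
      det ((\<chi> i j. local2 A c g (cmap c p) (column i (frame_matrix c p)) (axis j 1)) :: real^4^4)"
proof -
  have "(\<chi> i. vector [g p (frame_at A g p i) (coord_vec A c p (axis 1 1)), g p (frame_at A g p i) (coord_vec A c p (axis 2 1)),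
      g p (frame_at A g p i) (coord_vec A c p (axis 3 1)), g p (frame_at A g p i) (coord_vec A c p (axis 4 1))]) =
      ((\<chi> i j. local2 A c g (cmap c p) (column i (frame_matrix c p)) (axis j 1)) :: real^4^4)"
    unfolding vector_4_eta[of "\<lambda>j. g p (frame_at A g p i) (coord_vec A c p (axis j 1))" for i]
    by (simp add: local2_at[OF c] coord_vec_column[OF c])
  then show ?thesis
    by (simp add: local4_def volume_form_def Let_def chart_simps(3)[OF chart_of_atlas[OF c(1)] c(2)])
qed

text \<open>The volume form is 1 on its own frame. This normalisation fixes the density in every
  chart and converts between coordinates and frame components.\<close>

lemma local4_volume_form_mult: 
  assumes c: "c \<in> A" "p \<in> cdom c"
  shows "local4 A c (volume_form A g) (cmap c p) * det (frame_matrix c p) = 1"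
  unfolding local4_volume_form[OF c]
  by (rule det_coframe_frame) (use metric_local_frame[OF c] in auto)

lemma local4_volume_form_pos:
  assumes c: "c \<in> A" "p \<in> cdom c"
  shows "local4 A c (volume_form A g) (cmap c p) > 0"
  using local4_volume_form_mult[OF c] metric_local_frame(3)[OF c] by (metis zero_less_mult_pos2 zero_less_one)

lemma frame_matrix_change:
  assumes "c \<in> A" "c' \<in> A" "p \<in> cdom c" "p \<in> cdom c'"
  shows "frame_matrix c' p = matrix (frechet_derivative (transition c c') (at (cmap c p))) ** frame_matrix c p"
proof -
  let ?T = "frechet_derivative (transition c c') (at (cmap c p))"
  have "frame_at A g p j c' = ?T (frame_at A g p j c)" for j
    using frame_at_orthonormal[of p] assms unfolding oriented_orthonormal_frame_def tangent_space_def by blast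
  then have "frame_matrix c' p = (\<chi> i j. ?T (frame_at A g p j c) $ i)" by (simp add: frame_matrix_def)
  also have "\<dots> = matrix ?T ** frame_matrix c p"
    unfolding frame_matrix_def
    by (rule linear_columns[OF linear_frechet_derivative[OF transition_differentiable[OF metric_atlas_smooth assms]]])
  finally show ?thesis .
qed

definition gram_at :: "('a, real^4) chart \<Rightarrow> real^4 \<Rightarrow> real^4^4" where
  "gram_at c y = (\<chi> i j. local2 A c g y (axis i 1) (axis j 1))"

lemma continuous_on_gram_at: "c \<in> A \<Longrightarrow> continuous_on (cimg c) (\<lambda>y. gram_at c y $ i $ j)"
  unfolding gram_at_def vec_lambda_beta
  using g smooth_onD[THEN ck_on_continuous, of "cimg c" "\<lambda>y. local2 A c g y (axis i 1) (axis j 1)"]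
  by (simp add: riemannian_metric_def smooth_field2_def)

lemma det_gram_at_nz:
  assumes "c \<in> A" "y \<in> cimg c" shows "det (gram_at c y) \<noteq> 0"
proof -
  obtain p where p: "p \<in> cdom c" "y = cmap c p" using assms(2) by blast
  show ?thesis
    using det_gram[OF metric_local_frame(1,2)[OF assms(1) p(1)]] by (auto simp: gram_at_def p(2))
qed

lemma continuous_form4_volume_form: "continuous_form4 A (volume_form A g)"
  unfolding continuous_form4_def
proof (intro conjI ballI)
  fix c assume c: "c \<in> A"
  \<comment> \<open>The chosen frame may jump from point to point, so continuity is read off from
    the metric: the density is the root of the Gram determinant.\<close>
  have "continuous_on (cimg c) (\<lambda>y. sqrt (det (gram_at c y)))"
    by (intro continuous_intros continuous_on_det continuous_on_gram_at c)
  then show "continuous_on (cimg c) (local4 A c (volume_form A g))"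
  proof (rule continuous_on_eq)
    fix y assume "y \<in> cimg c"
    then obtain p where p: "p \<in> cdom c" "y = cmap c p" by blast
    show "sqrt (det (gram_at c y)) = local4 A c (volume_form A g) y"
      unfolding p(2) local4_volume_form[OF c p(1)] gram_at_def
      using det_coframe_eq_sqrt[OF metric_local_frame[OF c p(1)]] by simp
  qed
next
  fix c c' p assume c: "c \<in> A" "c' \<in> A" "p \<in> cdom c \<inter> cdom c'"
  let ?T = "frechet_derivative (transition c c') (at (cmap c p))"
  have "det (frame_matrix c' p) = det (matrix ?T) * det (frame_matrix c p)"
    using frame_matrix_change[of c c' p] c by (simp add: det_mul)
  \<comment> \<open>The sides are compared after multiplication by the frame determinant in
    \<open>c'\<close>, where the normalisation turns each of them into the Jacobian.\<close>
  then have "(local4 A c (volume_form A g) (cmap c p)) * det (frame_matrix c' p) =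
      det (matrix ?T) * local4 A c' (volume_form A g) (cmap c' p) * det (frame_matrix c' p)"
    using local4_volume_form_mult[of c p] local4_volume_form_mult[of c' p] c
    by (simp add: mult.assoc mult.left_commute)
  then show "local4 A c (volume_form A g) (cmap c p) = det (matrix ?T) * local4 A c' (volume_form A g) (cmap c' p)"
    using metric_local_frame(3)[of c' p] c by auto
qed

section \<open>The energy density\<close>

context
  fixes \<alpha> :: "('a, real^4) field2"
  assumes \<alpha>: "continuous_form2 A \<alpha>"
begin

definition form_components :: "'a \<Rightarrow> 4 \<Rightarrow> 4 \<Rightarrow> real" where
  "form_components p i j = \<alpha> p (frame_at A g p i) (frame_at A g p j)"

lemmas form_local = continuous_form2_local[OF \<alpha>]

lemma form_components_skew: "form_components p j i = - form_components p i j"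
proof -
  obtain c where c: "c \<in> A" "p \<in> cdom c" using smooth_atlas_cover[OF metric_atlas_smooth] by blast
  let ?a = "local2 A c \<alpha> (cmap c p)"
  have "?a v u = - ?a u v" for u v
  proof -
    have "0 = ?a (u + v) (u + v)" using form_local(2)[OF c] by simp
    also have "\<dots> = ?a u v + ?a v u"
      unfolding bilinear_ladd[OF form_local(1)[OF c]] bilinear_radd[OF form_local(1)[OF c]]
      using form_local(2)[OF c] by simp
    finally show ?thesis by simp
  qed
  then show ?thesis unfolding form_components_def by (metis local2_frame[OF c])
qed

lemma form2_norm_components:
  "(form2_norm A g \<alpha> p)\<^sup>2 = 1 / 2 * (\<Sum>i\<in>UNIV. \<Sum>j\<in>UNIV. form_components p i j * form_components p i j)"
proof -
  have "0 \<le> 1 / 2 * (\<Sum>i\<in>UNIV. \<Sum>j\<in>UNIV. form_components p i j * form_components p i j)"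
    by (simp add: sum_nonneg)
  then show ?thesis
    by (simp add: form2_norm_def form2_inner_def Let_def form_components_def)
qed

lemma continuous_form2_norm: "continuous_on UNIV (\<lambda>p. (form2_norm A g \<alpha> p)\<^sup>2)"
proof (rule continuous_at_imp_continuous_on, rule ballI)
  fix p
  obtain c where c: "c \<in> A" "p \<in> cdom c" using smooth_atlas_cover[OF metric_atlas_smooth] by blast
  define B where "B y = ((\<chi> i j. local2 A c \<alpha> y (axis i 1) (axis j 1)) :: real^4^4)" for y
  \<comment> \<open>\<open>P\<close> is the inverse metric by Cramer's rule and \<open>F\<close> the
    frame-free trace formula, so both are continuous in the chart.\<close>
  define P where "P y = ((\<chi> k m. det ((\<chi> i j. if j = k then (if i = m then 1 else 0) else gram_at c y $ i $ j) :: real^4^4)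
     / det (gram_at c y)) :: real^4^4)" for y
  define F where "F y = 1 / 2 * trace (B y ** P y ** transpose (B y) ** P y)" for y
  have cB: "continuous_on (cimg c) (\<lambda>y. B y $ i $ j)" for i j
    using \<alpha> c unfolding B_def continuous_form2_def vec_lambda_beta by blast
  have cP: "continuous_on (cimg c) (\<lambda>y. P y $ k $ m)" for k m
  proof -
    have "continuous_on (cimg c) (\<lambda>y. ((\<chi> i j. if j = k then (if i = m then 1 else 0) else gram_at c y $ i $ j) :: real^4^4) $ i $ j)" for i j
      using continuous_on_gram_at[OF c(1)] by (cases "j = k") simp_all
    then show ?thesis
      unfolding P_def vec_lambda_beta
      by (intro continuous_on_divide continuous_on_det continuous_on_gram_at c(1)) (use det_gram_at_nz[OF c(1)] in auto)
  qed
  have cF: "continuous_on (cimg c) F"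
    unfolding F_def trace_def matrix_matrix_mult_def transpose_def vec_lambda_beta
    by (intro continuous_intros cB cP)
  have eq: "(form2_norm A g \<alpha> q)\<^sup>2 = F (cmap c q)" if q: "q \<in> cdom c" for q
  proof -
    note m = metric_local_frame(1,2)[OF c(1) q]
    have "P (cmap c q) = frame_matrix c q ** transpose (frame_matrix c q)"
      unfolding P_def gram_at_def using inverse_gram_entry[OF m] by (simp add: vec_eq_iff)
    then show ?thesis
      unfolding form2_norm_components form_components_def F_def B_def
      using frame_norm_eq[OF m form_local(1)[OF c(1) q]] by (simp add: local2_frame[OF c(1) q])
  qed
  have "continuous_on (cdom c) (\<lambda>q. F (cmap c q))"
    by (rule continuous_on_compose2[OF cF chart_simps(6)[OF chart_of_atlas[OF c(1)]]]) auto
  then have "continuous_on (cdom c) (\<lambda>p. (form2_norm A g \<alpha> p)\<^sup>2)"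
    by (rule continuous_on_eq) (simp add: eq)
  then show "isCont (\<lambda>p. (form2_norm A g \<alpha> p)\<^sup>2) p"
    using c(2) chart_simps(1)[OF chart_of_atlas[OF c(1)]] continuous_on_eq_continuous_at by blast
qed

lemma continuous_form4_energy:
  "continuous_form4 A (\<lambda>p a b c d. (form2_norm A g \<alpha> p)\<^sup>2 * volume_form A g p a b c d)"
  using continuous_form4_scale4[OF orient M continuous_form2_norm continuous_form4_volume_form]
  by (simp add: scale4_def)

text \<open>\<open>wedge_sq_det\<close> for the frame matrix, combined with the normalisation of the
  volume form. The expression in \<open>form_components\<close> is the factor w with \<alpha> wedge
  \<alpha> = w vol.\<close>

lemma local4_wedge2_components:
  assumes c: "c \<in> A" "p \<in> cdom c"
  shows "local4 A c (wedge2 \<alpha> \<alpha>) (cmap c p) =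
    local4 A c (volume_form A g) (cmap c p) * wedge_sq (form_components p) 1 2 3 4"
proof -
  let ?E = "frame_matrix c p"
  have "wedge_sq (form_components p) 1 2 3 4 = wedge_sq (local2 A c \<alpha> (cmap c p)) (column 1 ?E) (column 2 ?E) (column 3 ?E) (column 4 ?E)"
    by (simp add: wedge_sq_def form_components_def local2_frame[OF c])
  also have "\<dots> = det ?E * local4 A c (wedge2 \<alpha> \<alpha>) (cmap c p)"
    unfolding local4_wedge2 by (rule wedge_sq_det[OF form_local[OF c]])
  finally show ?thesis using local4_volume_form_mult[OF c] by (simp add: mult.assoc[symmetric])
qed

lemma local4_energy:
  assumes c: "c \<in> A" "p \<in> cdom c"
  shows "local4 A c (\<lambda>p a b c d. (form2_norm A g \<alpha> p)\<^sup>2 * volume_form A g p a b c d) (cmap c p) =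
    local4 A c (volume_form A g) (cmap c p) *
    (1 / 2 * (\<Sum>i\<in>UNIV. \<Sum>j\<in>UNIV. form_components p i j * form_components p i j))"
  using local4_scale4[of A c "\<lambda>p. (form2_norm A g \<alpha> p)\<^sup>2" "volume_form A g" "cmap c p"]
  by (simp add: scale4_def chart_simps(3)[OF chart_of_atlas[OF c(1)] c(2)] form2_norm_components)

text \<open>In an orthonormal frame the coordinates of a vector are its inner products with the
  frame; in these coordinates \<alpha> is an alternating form on \<open>real^4\<close>, and
  \<open>alternating_4\<close> applies.\<close>

lemma form_expand:
  assumes u: "u \<in> tangent_space A p" and v: "v \<in> tangent_space A p"
  defines "U \<equiv> \<lambda>m. g p (frame_at A g p m) u" and "V \<equiv> \<lambda>m. g p (frame_at A g p m) v"
  shows "\<alpha> p u v =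
      form_components p 1 2 * (U 1 * V 2 - U 2 * V 1) + form_components p 1 3 * (U 1 * V 3 - U 3 * V 1)
    + form_components p 1 4 * (U 1 * V 4 - U 4 * V 1) + form_components p 2 3 * (U 2 * V 3 - U 3 * V 2)
    + form_components p 2 4 * (U 2 * V 4 - U 4 * V 2) + form_components p 3 4 * (U 3 * V 4 - U 4 * V 3)"
proof -
  obtain c where c: "c \<in> A" "p \<in> cdom c" using smooth_atlas_cover[OF metric_atlas_smooth] by blast
  let ?E = "frame_matrix c p" and ?a = "local2 A c \<alpha> (cmap c p)" and ?G = "local2 A c g (cmap c p)"
  \<comment> \<open>The coframe is a left inverse of the frame matrix, hence also a right inverse,
    which reconstructs the vector from its inner products.\<close>
  have comp: "?E *v (\<chi> m. g p (frame_at A g p m) w) = w c" if w: "w \<in> tangent_space A p" for w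
  proof -
    let ?W = "(\<chi> i j. ?G (column i ?E) (axis j 1)) :: real^4^4"
    have lin: "linear (?G (column i ?E))" for i using metric_local_frame(1)[OF c] by (simp add: bilinear_def)
    have "?G (column m ?E) (w c) = (\<Sum>k\<in>UNIV. ?W $ m $ k * w c $ k)" for m
    proof -
      have "w c = (\<Sum>k\<in>UNIV. w c $ k *\<^sub>R axis k 1)"
        using basis_expansion[of "w c"] by (simp add: scalar_mult_eq_scaleR)
      then have "?G (column m ?E) (w c) = (\<Sum>k\<in>UNIV. ?G (column m ?E) (w c $ k *\<^sub>R axis k 1))"
        using linear_sum[OF lin] by metis
      then show ?thesis by (simp add: linear_cmul[OF lin] mult.commute)
    qed
    moreover have "g p (frame_at A g p m) w = ?G (column m ?E) (w c)" for m
      by (simp add: local2_at[OF c] coord_vec_column[OF c] tangent_vec_eq_coord_vec[OF c w])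
    ultimately have "(\<chi> m. g p (frame_at A g p m) w) = ?W *v (w c)"
      by (simp add: matrix_vector_mult_def vec_eq_iff)
    moreover have "?W ** ?E = mat 1"
      by (rule coframe_mult_frame) (use metric_local_frame[OF c] in auto)
    then have "?E ** ?W = mat 1" using matrix_left_right_inverse by blast
    ultimately show ?thesis by (simp add: matrix_vector_mul_assoc)
  qed
  define b where "b x y = ?a (?E *v x) (?E *v y)" for x y
  have bil: "bilinear b"
    unfolding bilinear_def b_def
    using form_local(1)[OF c] linear_compose[OF matrix_vector_mul_linear[of ?E], unfolded o_def]
    unfolding bilinear_def by blast
  have alt: "b x x = 0" for x by (simp add: b_def form_local(2)[OF c])
  have bax: "b (axis i 1) (axis j 1) = form_components p i j" for i j
    by (simp add: b_def matrix_vector_mult_basis local2_frame[OF c] form_components_def)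
  have "\<alpha> p u v = b (\<chi> m. U m) (\<chi> m. V m)"
    using comp[OF u] comp[OF v]
    by (simp add: b_def U_def V_def local2_at[OF c] tangent_vec_eq_coord_vec[OF c] u v)
  then show ?thesis using alternating_4[OF bil alt, of "\<chi> m. U m" "\<chi> m. V m"] by (simp add: bax)
qed

lemma hodge_expand:
  fixes p :: 'a
  defines "U \<equiv> \<lambda>u m. g p (frame_at A g p m) u"
  shows "hodge2 A g \<alpha> p u v =
      form_components p 3 4 * (U u 1 * U v 2 - U u 2 * U v 1) - form_components p 2 4 * (U u 1 * U v 3 - U u 3 * U v 1)
    + form_components p 2 3 * (U u 1 * U v 4 - U u 4 * U v 1) + form_components p 1 4 * (U u 2 * U v 3 - U u 3 * U v 2)
    - form_components p 1 3 * (U u 2 * U v 4 - U u 4 * U v 2) + form_components p 1 2 * (U u 3 * U v 4 - U u 4 * U v 3)"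
proof -
  have "g p (frame_at A g p m) (frame_at A g p i) = (if m = i then 1 else 0)" for m i
    using frame_at_orthonormal[of p] by (simp add: oriented_orthonormal_frame_def)
  then show ?thesis
    using hodge_components[of "form_components p" "U u" "U v", OF form_components_skew]
    by (simp add: hodge2_def volume_form_def Let_def form_components_def U_def)
qed

text \<open>The sign s treats both kinds of duality together. Testing on e1 with e2, e3, e4 gives
  the three equations; the complementary pairs follow because s is its own inverse.\<close>

lemma dual_iff_components:
  assumes s: "s * s = (1::real)"
  shows "(\<forall>u\<in>tangent_space A p. \<forall>v\<in>tangent_space A p. hodge2 A g \<alpha> p u v = s * \<alpha> p u v) \<longleftrightarrow>
    form_components p 3 4 = s * form_components p 1 2 \<and> form_components p 2 4 = - s * form_components p 1 3 \<and>
    form_components p 2 3 = s * form_components p 1 4" (is "?L \<longleftrightarrow> ?R")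
proof
  assume L: ?L
  let ?e = "frame_at A g p"
  have e: "?e i \<in> tangent_space A p" and o: "g p (?e i) (?e j) = (if i = j then 1 else 0)" for i j
    using frame_at_orthonormal[of p] by (auto simp: oriented_orthonormal_frame_def)
  have "hodge2 A g \<alpha> p (?e i) (?e j) = s * form_components p i j" for i j
    using L e by (simp add: form_components_def)
  from this[of 1 2] this[of 1 3] this[of 1 4] show ?R
    by (simp add: hodge_expand o)
next
  assume R: ?R
  have "s = 1 \<or> s = -1" using s by (simp add: square_eq_1_iff)
  then have "hodge2 A g \<alpha> p u v = s * \<alpha> p u v"
    if uv: "u \<in> tangent_space A p" "v \<in> tangent_space A p" for u v
    unfolding hodge_expand form_expand[OF uv] using R by (elim disjE) (simp_all add: algebra_simps)
  then show ?L by blast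
qed

lemma form_integral_energy_wedge:
  defines "N \<equiv> form_integral A (\<lambda>p a b c d. (form2_norm A g \<alpha> p)\<^sup>2 * volume_form A g p a b c d)"
    and "W \<equiv> form_integral A (wedge2 \<alpha> \<alpha>)"
  shows "N \<ge> W" "N = W \<longleftrightarrow> self_dual A g \<alpha>" "N \<ge> - W" "N = - W \<longleftrightarrow> anti_self_dual A g \<alpha>"
proof -
  let ?\<eta> = "\<lambda>p a b c d. (form2_norm A g \<alpha> p)\<^sup>2 * volume_form A g p a b c d"
  \<comment> \<open>One argument for both signs: s = 1 yields the self-dual half, s = -1 the
    anti-self-dual half.\<close>
  have main: "N - s * W \<ge> 0 \<and> (N - s * W = 0 \<longleftrightarrow>
      (\<forall>p. \<forall>u\<in>tangent_space A p. \<forall>v\<in>tangent_space A p. hodge2 A g \<alpha> p u v = s * \<alpha> p u v))"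
    if s: "s = 1 \<or> s = -1" for s
  proof -
    let ?\<zeta> = "\<lambda>p w x y z. 1 * ?\<eta> p w x y z + (- s) * wedge2 \<alpha> \<alpha> p w x y z"
    let ?q = "\<lambda>p. (form_components p 1 2 - s * form_components p 3 4)\<^sup>2 +
      (form_components p 1 3 + s * form_components p 2 4)\<^sup>2 + (form_components p 1 4 - s * form_components p 2 3)\<^sup>2"
    have cont: "continuous_form4 A ?\<zeta>"
      by (rule continuous_form4_lincomb[OF orient M continuous_form4_energy continuous_form4_wedge2[OF metric_atlas_smooth \<alpha>]])
    have int: "form_integral A ?\<zeta> = N - s * W"
      using form_integral_lincomb[OF orient M continuous_form4_energy continuous_form4_wedge2[OF metric_atlas_smooth \<alpha>], of 1 "- s"]
      by (simp add: N_def W_def)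
    have loc: "local4 A c ?\<zeta> (cmap c p) = local4 A c (volume_form A g) (cmap c p) * ?q p"
      if c: "c \<in> A" "p \<in> cdom c" for c p
    proof -
      have "local4 A c ?\<zeta> (cmap c p) = local4 A c ?\<eta> (cmap c p) - s * local4 A c (wedge2 \<alpha> \<alpha>) (cmap c p)"
        by (simp add: local4_def Let_def)
      also have "\<dots> = local4 A c (volume_form A g) (cmap c p) *
         (1 / 2 * (\<Sum>i\<in>UNIV. \<Sum>j\<in>UNIV. form_components p i j * form_components p i j) - s * wedge_sq (form_components p) 1 2 3 4)"
        unfolding local4_energy[OF c] local4_wedge2_components[OF c] by (simp only: right_diff_distrib mult.left_commute)
      also have "1 / 2 * (\<Sum>i\<in>UNIV. \<Sum>j\<in>UNIV. form_components p i j * form_components p i j) - s * wedge_sq (form_components p) 1 2 3 4 = ?q p"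
        using form_norm_pos_eq[of "form_components p", OF form_components_skew] s by auto
      finally show ?thesis .
    qed
    have q0: "?q p = 0 \<longleftrightarrow> (\<forall>u\<in>tangent_space A p. \<forall>v\<in>tangent_space A p. hodge2 A g \<alpha> p u v = s * \<alpha> p u v)" for p
    proof -
      have ss: "s * s = 1" using s by auto
      have sq3: "x\<^sup>2 + y\<^sup>2 + z\<^sup>2 = 0 \<longleftrightarrow> x = 0 \<and> y = 0 \<and> z = 0" for x y z :: real
        by (smt (verit) zero_le_power2 power2_eq_iff_nonneg zero_eq_power2)
      show ?thesis unfolding dual_iff_components[OF ss] sq3 using s by auto
    qed
    note nn = form_integral_nonneg[OF orient M cont, unfolded int]
    have vpos: "local4 A c (volume_form A g) (cmap c p) > 0" if "c \<in> A" "p \<in> cdom c" for c p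
      by (rule local4_volume_form_pos[OF that])
    have ge: "local4 A c ?\<zeta> (cmap c p) \<ge> 0" if "c \<in> A" "p \<in> cdom c" for c p
      unfolding loc[OF that] using vpos[OF that] by (intro mult_nonneg_nonneg add_nonneg_nonneg) auto
    have "?q p = 0" if z: "N - s * W = 0" for p
    proof -
      obtain c where c: "c \<in> A" "p \<in> cdom c" using smooth_atlas_cover[OF metric_atlas_smooth] by blast
      have "local4 A c ?\<zeta> (cmap c p) = 0" by (rule nn(2)[OF ge z c])
      then show ?thesis unfolding loc[OF c] using vpos[OF c] by simp
    qed
    \<comment> \<open>The form is known to vanish on coordinate frames only, so its integral is
      computed chart by chart from a partition of unity.\<close>
    moreover have "N - s * W = 0" if q: "\<And>p. ?q p = 0"
    proof -
      obtain C \<rho> where \<rho>: "partition_of_unity A C \<rho>" using exists_partition_of_unity[OF metric_atlas_smooth M] .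
      have "integral (cimg c) (local4 A c (scale4 (\<rho> c) ?\<zeta>)) = 0" if "c \<in> C" for c
      proof -
        have cA: "c \<in> A" using \<rho> that by (auto simp: partition_of_unity_def)
        have "integral (cimg c) (local4 A c (scale4 (\<rho> c) ?\<zeta>)) = integral (cimg c) (\<lambda>y. 0)"
        proof (rule integral_cong)
          fix y assume "y \<in> cimg c"
          then obtain p where p: "p \<in> cdom c" "y = cmap c p" by blast
          show "local4 A c (scale4 (\<rho> c) ?\<zeta>) y = 0"
            unfolding local4_scale4 p(2) loc[OF cA p(1)] q by simp
        qed
        then show ?thesis by simp
      qed
      then show ?thesis unfolding int[symmetric] form_integral_eq[OF orient M \<rho> cont] by simp
    qed
    ultimately show ?thesis using nn(1)[OF ge] q0 by blast
  qed
  show "N \<ge> W" "N = W \<longleftrightarrow> self_dual A g \<alpha>" "N \<ge> - W" "N = - W \<longleftrightarrow> anti_self_dual A g \<alpha>"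
    using main[of 1] main[of "-1"] by (auto simp: self_dual_def anti_self_dual_def)
qed

end

end

section \<open>Smoothing continuous maps between manifolds\<close>

lemma smooth_atlas_transition:
  assumes "smooth_atlas A" "c \<in> A" "c' \<in> A"
  shows "smooth_on (cmap c ` (cdom c \<inter> cdom c')) (transition c c')"
  using assms by (simp add: smooth_atlas_def)

text \<open>One pair of charts decides: the representations in all others arise by composing with
  transition maps on both sides.\<close>

lemma smooth_map_on_chart:
  assumes A: "smooth_atlas A" "c \<in> A" and B: "smooth_atlas B" "c' \<in> B"
    and Q: "open Q" "Q \<subseteq> cdom c" and f: "continuous_on Q f" "f ` Q \<subseteq> cdom c'"
    and sm: "smooth_on (cmap c ` Q) (rep c c' f)"
  shows "smooth_map_on A B f Q"
  unfolding smooth_map_on_def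
proof (intro ballI)
  fix d d' assume d: "d \<in> A" "d' \<in> B"
  note chA = smooth_atlas_chart[OF A(1)] and chB = smooth_atlas_chart[OF B(1)]
  let ?S = "cmap d ` (cdom d \<inter> Q \<inter> f -` cdom d')"
  have S: "open ?S" by (rule open_rep_domain[OF chA[OF d(1)] chart_simps(1)[OF chB[OF d(2)]] Q(1) f(1)])
  have "smooth_on ?S (transition d c)"
    by (rule smooth_on_subset[OF smooth_atlas_transition[OF A(1) d(1) A(2)]]) (use Q(2) in blast)
  moreover have "transition d c ` ?S \<subseteq> cmap c ` Q"
    by (auto simp: transition_def chart_simps(3)[OF chA[OF d(1)]])
  ultimately have 1: "smooth_on ?S (\<lambda>y. rep c c' f (transition d c y))"
    using smooth_on_compose[OF S _ sm] by blast
  have "smooth_on (cmap c' ` (cdom c' \<inter> cdom d')) (transition c' d')"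
    by (rule smooth_atlas_transition[OF B d(2)])
  moreover have "(\<lambda>y. rep c c' f (transition d c y)) ` ?S \<subseteq> cmap c' ` (cdom c' \<inter> cdom d')"
  proof clarify
    fix q assume q: "q \<in> cdom d" "q \<in> Q" "f q \<in> cdom d'"
    then have "q \<in> cdom c" "f q \<in> cdom c'" using Q(2) f(2) by auto
    with q have "rep c c' f (transition d c (cmap d q)) = cmap c' (f q)"
      by (simp add: transition_def rep_def chart_simps(3)[OF chA] d A)
    then show "rep c c' f (transition d c (cmap d q)) \<in> cmap c' ` (cdom c' \<inter> cdom d')"
      using q \<open>f q \<in> cdom c'\<close> by auto
  qed
  ultimately have "smooth_on ?S (\<lambda>y. transition c' d' (rep c c' f (transition d c y)))"
    by (rule smooth_on_compose[OF S 1])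
  then show "smooth_on ?S (rep d d' f)"
  proof (rule smooth_on_cong[OF S, rotated])
    fix y assume "y \<in> ?S"
    then obtain q where q: "q \<in> cdom d" "q \<in> Q" "f q \<in> cdom d'" "y = cmap d q" by blast
    then have "q \<in> cdom c" "f q \<in> cdom c'" using Q(2) f(2) by auto
    with q show "transition c' d' (rep c c' f (transition d c y)) = rep d d' f y"
      by (simp add: transition_def rep_def chart_simps(3)[OF chA] chart_simps(3)[OF chB] d A B)
  qed
qed

lemma smooth_map_on_local:
  assumes A: "smooth_atlas A" and B: "smooth_atlas B" and f: "continuous_on UNIV f"
    and loc: "\<And>p. p \<in> Q \<Longrightarrow> \<exists>Q'. open Q' \<and> p \<in> Q' \<and> smooth_map_on A B f Q'"
  shows "smooth_map_on A B f Q"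
  unfolding smooth_map_on_def
proof (intro ballI, rule smooth_on_local)
  fix c c' y assume c: "c \<in> A" "c' \<in> B" and "y \<in> cmap c ` (cdom c \<inter> Q \<inter> f -` cdom c')"
  then obtain p where p: "p \<in> cdom c" "p \<in> Q" "f p \<in> cdom c'" "y = cmap c p" by blast
  obtain Q' where Q': "open Q'" "p \<in> Q'" "smooth_map_on A B f Q'" using loc[OF p(2)] by blast
  have "open (cmap c ` (cdom c \<inter> Q' \<inter> f -` cdom c'))"
    by (rule open_rep_domain[OF smooth_atlas_chart[OF A c(1)] chart_simps(1)[OF smooth_atlas_chart[OF B c(2)]] Q'(1)
        continuous_on_subset[OF f]]) simp
  moreover have "smooth_on (cmap c ` (cdom c \<inter> Q' \<inter> f -` cdom c')) (rep c c' f)"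
    using Q'(3) c unfolding smooth_map_on_def by blast
  moreover have "y \<in> cmap c ` (cdom c \<inter> Q' \<inter> f -` cdom c')" using p Q'(2) by blast
  ultimately show "\<exists>T. open T \<and> y \<in> T \<and> smooth_on T (rep c c' f)" by blast
qed

lemma smooth_map_on_cong:
  assumes A: "smooth_atlas A" and B: "smooth_atlas B" and Q: "open Q" "continuous_on Q f"
    and eq: "\<And>x. x \<in> Q \<Longrightarrow> f x = f' x" and f: "smooth_map_on A B f Q"
  shows "smooth_map_on A B f' Q"
  unfolding smooth_map_on_def
proof (intro ballI)
  fix c c' assume c: "c \<in> A" "c' \<in> B"
  have S: "cmap c ` (cdom c \<inter> Q \<inter> f' -` cdom c') = cmap c ` (cdom c \<inter> Q \<inter> f -` cdom c')"
    using eq by (intro arg_cong[where f = "image (cmap c)"]) auto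
  have o: "open (cmap c ` (cdom c \<inter> Q \<inter> f -` cdom c'))"
    by (rule open_rep_domain[OF smooth_atlas_chart[OF A c(1)] chart_simps(1)[OF smooth_atlas_chart[OF B c(2)]] Q])
  show "smooth_on (cmap c ` (cdom c \<inter> Q \<inter> f' -` cdom c')) (rep c c' f')"
    unfolding S
  proof (rule smooth_on_cong[OF o])
    show "smooth_on (cmap c ` (cdom c \<inter> Q \<inter> f -` cdom c')) (rep c c' f)"
      using f c unfolding smooth_map_on_def by blast
    fix y assume "y \<in> cmap c ` (cdom c \<inter> Q \<inter> f -` cdom c')"
    then show "rep c c' f y = rep c c' f' y"
      using eq by (auto simp: rep_def chart_simps(3)[OF smooth_atlas_chart[OF A c(1)]])
  qed
qed

text \<open>The second map \<open>u\<close> takes values in target coordinates, so it can be a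
  polynomial as well as a map read in the chart. Where \<open>\<mu>\<close> vanishes the formula
  returns \<open>f\<close>, so the two cases fit together when \<open>\<mu>\<close> is supported in
  \<open>K\<close>.\<close>

definition chart_interp ::
  "('b, 'f::real_vector) chart \<Rightarrow> ('a \<Rightarrow> real) \<Rightarrow> 'a set \<Rightarrow> ('a \<Rightarrow> 'b) \<Rightarrow> ('a \<Rightarrow> 'f) \<Rightarrow> 'a \<Rightarrow> 'b" where
  "chart_interp c' \<mu> K f u x =
     (if x \<in> K then cinv c' ((1 - \<mu> x) *\<^sub>R cmap c' (f x) + \<mu> x *\<^sub>R u x) else f x)"

text \<open>The second claim keeps smoothness where \<open>f\<close> had it. The third creates
  smoothness where \<open>\<mu>\<close> is 1: there \<open>f\<close> has dropped out and the map is
  \<open>u\<close> in coordinates. Together they allow a merely continuous map to be smoothed piece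
  by piece.\<close>

lemma chart_interp_smooth:
  fixes A :: "('a::{t2_space, second_countable_topology}, 'e::euclidean_space) chart set"
    and B :: "('b::{t2_space, second_countable_topology}, 'f::euclidean_space) chart set"
  assumes A: "smooth_atlas A" "c \<in> A" and B: "smooth_atlas B" "c' \<in> B"
    and K: "compact K" "K \<subseteq> D" and D: "open D" "D \<subseteq> cdom c"
    and \<mu>: "smooth_function A \<mu>" "\<And>x. x \<notin> K \<Longrightarrow> \<mu> x = 0"
    and f: "continuous_on UNIV f" and u: "smooth_on (cmap c ` D) (u \<circ> cinv c)"
    and ok: "\<And>x. x \<in> K \<Longrightarrow> f x \<in> cdom c' \<and> (1 - \<mu> x) *\<^sub>R cmap c' (f x) + \<mu> x *\<^sub>R u x \<in> cimg c'"
  shows "continuous_on UNIV (chart_interp c' \<mu> K f u)"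
    and "open Q \<Longrightarrow> smooth_map_on A B f Q \<Longrightarrow> smooth_map_on A B (chart_interp c' \<mu> K f u) Q"
    and "open Q \<Longrightarrow> Q \<subseteq> K \<Longrightarrow> (\<And>x. x \<in> Q \<Longrightarrow> \<mu> x = 1) \<Longrightarrow> smooth_map_on A B (chart_interp c' \<mu> K f u) Q"
proof -
  note chc = smooth_atlas_chart[OF A] and chc' = smooth_atlas_chart[OF B]
  let ?F = "chart_interp c' \<mu> K f u"
  define comb where "comb x = (1 - \<mu> x) *\<^sub>R cmap c' (f x) + \<mu> x *\<^sub>R u x" for x
  have \<mu>c: "continuous_on UNIV \<mu>" by (rule smooth_function_continuous[OF A(1) \<mu>(1)])
  have uc: "continuous_on D u"
  proof -
    have "continuous_on D (\<lambda>x. (u \<circ> cinv c) (cmap c x))"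
      by (rule continuous_on_compose2[OF ck_on_continuous[OF smooth_onD[OF u, of 0]]
          continuous_on_subset[OF chart_simps(6)[OF chc] D(2)]]) auto
    then show ?thesis by (rule continuous_on_eq) (use D(2) chart_simps(3)[OF chc] in auto)
  qed
  define V where "V = D \<inter> f -` cdom c'"
  have V: "open V"
    unfolding V_def using D(1) continuous_on_subset[OF f] chart_simps(1)[OF chc']
    by (simp add: continuous_open_preimage)
  have comb_cont: "continuous_on V comb"
    unfolding comb_def
    by (intro continuous_intros continuous_on_subset[OF \<mu>c] continuous_on_subset[OF uc]
        continuous_on_compose2[OF chart_simps(6)[OF chc']] continuous_on_subset[OF f]) (auto simp: V_def)
  \<comment> \<open>The interpolation formula makes sense on the open set \<open>U\<close> around
    \<open>K\<close> and agrees there with the definition by cases, also off \<open>K\<close>. With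
    the complement of \<open>K\<close> this covers the manifold by two open sets.\<close>
  define U where "U = V \<inter> comb -` cimg c'"
  have U: "open U"
    unfolding U_def by (rule continuous_open_preimage[OF comb_cont V chart_simps(2)[OF chc']])
  have KU: "K \<subseteq> U" using ok K(2) by (auto simp: U_def V_def comb_def)
  have FU: "?F x = cinv c' (comb x)" if "x \<in> U" for x
    using that \<mu>(2)[of x] chart_simps(3)[OF chc'] by (auto simp: chart_interp_def comb_def U_def V_def)
  have FK: "?F x = f x" if "x \<in> - K" for x using that by (simp add: chart_interp_def)
  have cover: "U \<union> - K = UNIV" using KU by blast
  have oK: "open (- K)" using K(1) by (simp add: compact_imp_closed open_Compl)
  have cU: "continuous_on U ?F"
  proof (rule continuous_on_eq)
    show "continuous_on U (\<lambda>x. cinv c' (comb x))"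
      by (rule continuous_on_compose2[OF chart_simps(7)[OF chc'] continuous_on_subset[OF comb_cont]])
         (auto simp: U_def)
  qed (simp add: FU)
  have "continuous_on (- K) ?F"
    by (rule continuous_on_eq[OF continuous_on_subset[OF f]]) (simp_all add: FK)
  then show cF: "continuous_on UNIV ?F"
    using continuous_on_open_Un[OF U oK cU] cover by simp
  have smooth_U: "smooth_map_on A B ?F Q'"
    if Q': "open Q'" "Q' \<subseteq> U" and cs: "smooth_on (cmap c ` Q') (\<lambda>y. comb (cinv c y))" for Q'
  proof (rule smooth_map_on_chart[OF A B Q'(1)])
    have Q'D: "Q' \<subseteq> cdom c" using Q'(2) D(2) by (auto simp: U_def V_def)
    then show "Q' \<subseteq> cdom c" .
    show "continuous_on Q' ?F" by (rule continuous_on_subset[OF cF]) simp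
    show "?F ` Q' \<subseteq> cdom c'"
    proof
      fix z assume "z \<in> ?F ` Q'"
      then obtain x where x: "x \<in> U" "z = ?F x" using Q'(2) by blast
      then have "comb x \<in> cimg c'" by (simp add: U_def)
      then show "z \<in> cdom c'" unfolding x(2) FU[OF x(1)] by (rule chart_simps(5)[OF chc'])
    qed
    have o: "open (cmap c ` Q')" using chart_open_image[OF chc Q'(1)] Q'D by (simp add: Int_absorb1)
    show "smooth_on (cmap c ` Q') (rep c c' ?F)"
    proof (rule smooth_on_cong[OF o _ cs])
      fix y assume "y \<in> cmap c ` Q'"
      then obtain q where q: "q \<in> Q'" "y = cmap c q" by blast
      then have "q \<in> U" "q \<in> cdom c" using Q'(2) Q'D by auto
      then show "comb (cinv c y) = rep c c' ?F y"
        using chart_simps(4)[OF chc'] by (simp add: rep_def q(2) chart_simps(3)[OF chc] FU) (simp add: U_def)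
    qed
  qed
  have imU: "cmap c ` Q' \<subseteq> cmap c ` D" "Q' \<subseteq> cdom c" "cmap c ` Q' \<subseteq> cimg c" if "Q' \<subseteq> U" for Q'
    using that D(2) by (auto simp: U_def V_def)
  {
    assume Q: "open Q" "smooth_map_on A B f Q"
    show "smooth_map_on A B ?F Q"
    proof (rule smooth_map_on_local[OF A(1) B(1) cF])
      fix p assume p: "p \<in> Q"
      show "\<exists>Q'. open Q' \<and> p \<in> Q' \<and> smooth_map_on A B ?F Q'"
      proof (cases "p \<in> K")
        case True
        let ?Q = "Q \<inter> U"
        have oQ: "open ?Q" using Q(1) U by blast
        have o: "open (cmap c ` ?Q)" using chart_open_image[OF chc oQ] imU(2)[of ?Q] by (simp add: Int_absorb1)
        have "smooth_on (cmap c ` ?Q) (\<lambda>y. (1 - \<mu> (cinv c y)) *\<^sub>R rep c c' f y + \<mu> (cinv c y) *\<^sub>R (u \<circ> cinv c) y)"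
        proof (rule smooth_onI)
          fix k
          have 1: "ck_on k (cmap c ` ?Q) (\<lambda>y. \<mu> (cinv c y))"
            by (rule ck_on_subset[OF smooth_functionD[OF \<mu>(1) A(2)]]) (use imU(3)[of ?Q] in auto)
          have 2: "ck_on k (cmap c ` ?Q) (u \<circ> cinv c)"
            by (rule ck_on_subset[OF smooth_onD[OF u]]) (use imU(1)[of ?Q] in auto)
          have "smooth_on (cmap c ` (cdom c \<inter> Q \<inter> f -` cdom c')) (rep c c' f)"
            using Q(2) A(2) B(2) unfolding smooth_map_on_def by blast
          then have 3: "ck_on k (cmap c ` ?Q) (rep c c' f)"
            by (intro ck_on_subset[OF smooth_onD]) (use imU(2)[of ?Q] in \<open>auto simp: U_def V_def\<close>)
          show "ck_on k (cmap c ` ?Q) (\<lambda>y. (1 - \<mu> (cinv c y)) *\<^sub>R rep c c' f y + \<mu> (cinv c y) *\<^sub>R (u \<circ> cinv c) y)"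
            by (intro ck_on_add ck_on_scaleR ck_on_diff ck_on_const o 1 2 3)
        qed
        then have "smooth_on (cmap c ` ?Q) (\<lambda>y. comb (cinv c y))"
          by (simp add: comb_def rep_def)
        then have "smooth_map_on A B ?F ?Q" by (intro smooth_U oQ) auto
        then show ?thesis using oQ p True KU by blast
      next
        case False
        have "smooth_map_on A B ?F (Q \<inter> - K)"
          by (rule smooth_map_on_cong[OF A(1) B(1) _ continuous_on_subset[OF f] _ smooth_map_on_subset[OF Q(2)]])
             (use Q(1) oK FK in auto)
        then show ?thesis using p False Q(1) oK by blast
      qed
    qed
  }
  {
    assume Q: "open Q" "Q \<subseteq> K" and one: "\<And>x. x \<in> Q \<Longrightarrow> \<mu> x = 1"
    have QU: "Q \<subseteq> U" using Q(2) KU by blast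
    have o: "open (cmap c ` Q)" using chart_open_image[OF chc Q(1)] imU(2)[OF QU] by (simp add: Int_absorb1)
    have "smooth_on (cmap c ` Q) (\<lambda>y. comb (cinv c y))"
    proof (rule smooth_on_cong[OF o _ smooth_on_subset[OF u imU(1)[OF QU]]])
      fix y assume "y \<in> cmap c ` Q"
      then show "(u \<circ> cinv c) y = comb (cinv c y)"
        using imU(2)[OF QU] one by (auto simp: comb_def chart_simps(3)[OF chc])
    qed
    then show "smooth_map_on A B ?F Q" by (rule smooth_U[OF Q(1) QU])
  }
qed

text \<open>Openness around the graph gives a radius at each point of \<open>K\<close>, compactness
  makes it uniform. The radius is halved because the centre of the ball moves with the
  point.\<close>

lemma compact_uniform_graph_neighbourhood:
  fixes g :: "'a::t2_space \<Rightarrow> 'b::topological_space" and c' :: "('b, 'f::euclidean_space) chart"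
  assumes c': "is_chart c'" and g: "continuous_on UNIV g" and Om: "open \<O>" "\<And>x. (x, g x) \<in> \<O>"
    and K: "compact K" and W: "open W" "W \<subseteq> cimg c'" "\<And>x. x \<in> K \<Longrightarrow> g x \<in> cdom c' \<and> cmap c' (g x) \<in> W"
  obtains \<epsilon> where "\<epsilon> > 0"
    "\<And>x z. x \<in> K \<Longrightarrow> dist z (cmap c' (g x)) < \<epsilon> \<Longrightarrow> z \<in> W \<and> (x, cinv c' z) \<in> \<O>"
proof -
  let ?h = "\<lambda>(x, z). (x, cinv c' z)"
  let ?S = "(UNIV \<times> W) \<inter> ?h -` \<O>"
  have "continuous_on (UNIV \<times> W) ?h"
    unfolding case_prod_unfold
    by (intro continuous_intros continuous_on_compose2[OF chart_simps(7)[OF c']]) (use W(2) in auto)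
  then have S: "open ?S"
    using Om(1) W(1) by (intro continuous_open_preimage open_Times) auto
  have "\<exists>X r. open X \<and> x \<in> X \<and> r > 0 \<and> (\<forall>x'\<in>X. g x' \<in> cdom c' \<and> (\<forall>z. dist z (cmap c' (g x')) < r \<longrightarrow> (x', z) \<in> ?S))"
    if x: "x \<in> K" for x
  proof -
    let ?u = "cmap c' (g x)"
    have "(x, ?u) \<in> ?S" using W(3)[OF x] Om(2)[of x] chart_simps(3)[OF c'] by simp
    then obtain X1 Z where XZ: "open X1" "open Z" "x \<in> X1" "?u \<in> Z" "X1 \<times> Z \<subseteq> ?S"
      using S by (metis open_prod_elim mem_Sigma_iff)
    obtain r where r: "r > 0" "ball ?u r \<subseteq> Z" using XZ(2,4) open_contains_ball by blast
    let ?D = "g -` cdom c'"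
    have D: "open ?D" using continuous_open_vimage[OF chart_simps(1)[OF c']] g
      by (simp add: chart_simps(1)[OF c'] open_vimage)
    have "continuous_on ?D (\<lambda>x. cmap c' (g x))"
      by (rule continuous_on_compose2[OF chart_simps(6)[OF c'] continuous_on_subset[OF g]]) auto
    then have X2: "open (?D \<inter> (\<lambda>x. cmap c' (g x)) -` ball ?u (r/2))"
      by (rule continuous_open_preimage[OF _ D open_ball])
    let ?X = "X1 \<inter> (?D \<inter> (\<lambda>x. cmap c' (g x)) -` ball ?u (r/2))"
    have "(x', z) \<in> ?S" if x': "x' \<in> ?X" and z: "dist z (cmap c' (g x')) < r/2" for x' z
    proof -
      have "dist ?u z < r" using x' z dist_triangle_half_l[of ?u "cmap c' (g x')" r z] by (auto simp: dist_commute)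
      then have "z \<in> Z" using r(2) by auto
      then show ?thesis using XZ(5) x' by blast
    qed
    moreover have "open ?X" "x \<in> ?X" using XZ X2 r(1) W(3)[OF x] by auto
    ultimately show ?thesis using r(1) by (intro exI[of _ ?X] exI[of _ "r/2"]) auto
  qed
  then obtain X r where X: "\<And>x. x \<in> K \<Longrightarrow> open (X x)" "\<And>x. x \<in> K \<Longrightarrow> x \<in> X x" "\<And>x. x \<in> K \<Longrightarrow> r x > 0"
    "\<And>x x' z. x \<in> K \<Longrightarrow> x' \<in> X x \<Longrightarrow> dist z (cmap c' (g x')) < r x \<Longrightarrow> (x', z) \<in> ?S"
    by metis
  obtain P where P: "finite P" "P \<subseteq> K" "K \<subseteq> (\<Union>x\<in>P. X x)"
    by (rule compactE_image[OF K, of K X]) (use X(1,2) in auto)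
  \<comment> \<open>The element 1 keeps the set nonempty when \<open>P\<close> is empty.\<close>
  define \<epsilon> where "\<epsilon> = Min (insert 1 (r ` P))"
  show ?thesis
  proof
    show "\<epsilon> > 0" unfolding \<epsilon>_def using P X(3) by (subst Min_gr_iff) auto
    fix x z assume "x \<in> K" and z: "dist z (cmap c' (g x)) < \<epsilon>"
    then obtain p where p: "p \<in> P" "x \<in> X p" using P(3) by blast
    have "\<epsilon> \<le> r p" unfolding \<epsilon>_def using P(1) p(1) by (intro Min_le) auto
    then have "(x, z) \<in> ?S" using X(4)[of p x z] p P(2) z by auto
    then show "z \<in> W \<and> (x, cinv c' z) \<in> \<O>" by simp
  qed
qed

text \<open>Over \<open>K\<close> the new neighbourhood forces coordinates within \<epsilon> of
  those of \<open>g\<close>; over the open complement of \<open>K\<close> it imposes only \<O>.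
  Since balls are convex, interpolating over \<open>K\<close> between values allowed by \<O>' stays
  in \<O>.\<close>

lemma shrink_graph_neighbourhood:
  fixes g :: "'a::t2_space \<Rightarrow> 'b::topological_space" and c' :: "('b, 'f::euclidean_space) chart"
  assumes c': "is_chart c'" and g: "continuous_on UNIV g" and Om: "open \<O>" "\<And>x. (x, g x) \<in> \<O>"
    and K: "compact K" and W: "open W" "W \<subseteq> cimg c'" "\<And>x. x \<in> K \<Longrightarrow> g x \<in> cdom c' \<and> cmap c' (g x) \<in> W"
  obtains \<epsilon> \<O>' where "\<epsilon> > 0" "open \<O>'" "\<And>x. (x, g x) \<in> \<O>'" "\<O>' \<subseteq> \<O>"
    "\<And>x y. x \<in> K \<Longrightarrow> (x, y) \<in> \<O>' \<Longrightarrow> y \<in> cdom c' \<and> dist (cmap c' y) (cmap c' (g x)) < \<epsilon>"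
    "\<And>x z. x \<in> K \<Longrightarrow> dist z (cmap c' (g x)) < \<epsilon> \<Longrightarrow> z \<in> W \<and> (x, cinv c' z) \<in> \<O>"
proof -
  obtain \<epsilon> where \<epsilon>: "\<epsilon> > 0"
    "\<And>x z. x \<in> K \<Longrightarrow> dist z (cmap c' (g x)) < \<epsilon> \<Longrightarrow> z \<in> W \<and> (x, cinv c' z) \<in> \<O>"
    using compact_uniform_graph_neighbourhood[OF c' g Om K W] by metis
  let ?D = "(g -` cdom c') \<times> cdom c'"
  let ?E = "?D \<inter> (\<lambda>(x, y). dist (cmap c' y) (cmap c' (g x))) -` {..<\<epsilon>}"
  have D: "open ?D"
    using g by (intro open_Times open_vimage chart_simps(1)[OF c'])
  have "continuous_on ?D (\<lambda>(x, y). dist (cmap c' y) (cmap c' (g x)))"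
    unfolding case_prod_unfold
    by (intro continuous_on_dist continuous_on_compose2[OF chart_simps(6)[OF c']]
        continuous_on_compose2[OF g] continuous_on_fst continuous_on_snd continuous_on_id) auto
  then have E: "open ?E" by (rule continuous_open_preimage[OF _ D open_lessThan])
  let ?O = "\<O> \<inter> ((- K) \<times> UNIV \<union> ?E)"
  show ?thesis
  proof
    show "\<epsilon> > 0" by fact
    show "open ?O" using Om(1) E open_Times[OF open_Compl[OF compact_imp_closed[OF K]] open_UNIV]
      by (metis open_Int open_Un)
    show "(x, g x) \<in> ?O" for x using Om(2) W(3) \<epsilon>(1) by auto
  qed (use \<epsilon>(2) in auto)
qed

section \<open>Homotopy invariance\<close>

definition pulled_integral ::
  "('a::{t2_space, second_countable_topology}, real^4) chart set \<Rightarrow>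
   ('b::{t2_space, second_countable_topology}, 'f::euclidean_space) chart set \<Rightarrow> ('b, 'f) field2 \<Rightarrow> ('a \<Rightarrow> 'b) \<Rightarrow> real" where
  "pulled_integral A B \<omega> f = form_integral A (wedge2 (pullback2 A B f \<omega>) (pullback2 A B f \<omega>))"

text \<open>The data of one modification step: a chart \<open>c\<close> of the source with a bump function supported
  in \<open>K\<close> and equal to 1 on \<open>Q\<close>, and a convex set \<open>W\<close> of coordinates in the chart \<open>c'\<close> of the target
  into which \<open>g\<close> maps \<open>K\<close>.\<close>

type_synonym ('a, 'e, 'b, 'f) step =
  "('a, 'e) chart \<times> ('b, 'f) chart \<times> ('a \<Rightarrow> real) \<times> 'a set \<times> 'a set \<times> 'f set"

fun admissible_step ::
  "('a::{t2_space, second_countable_topology}, 'e::euclidean_space) chart set \<Rightarrow>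
   ('b::{t2_space, second_countable_topology}, 'f::euclidean_space) chart set \<Rightarrow> ('a \<Rightarrow> 'b) \<Rightarrow>
   ('a, 'e, 'b, 'f) step \<Rightarrow> bool" where
  "admissible_step A B g (c, c', \<mu>, K, Q, W) \<longleftrightarrow>
     c \<in> A \<and> c' \<in> B \<and> smooth_function A \<mu> \<and> (\<forall>x. 0 \<le> \<mu> x \<and> \<mu> x \<le> 1) \<and>
     compact K \<and> K \<subseteq> cdom c \<and> (\<forall>x. x \<notin> K \<longrightarrow> \<mu> x = 0) \<and> open Q \<and> Q \<subseteq> K \<and> (\<forall>x\<in>Q. \<mu> x = 1) \<and>
     open W \<and> convex W \<and> W \<subseteq> cimg c' \<and> (\<forall>x\<in>K. g x \<in> cdom c' \<and> cmap c' (g x) \<in> W)"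

fun step_core :: "('a, 'e, 'b, 'f) step \<Rightarrow> 'a set" where
  "step_core (c, c', \<mu>, K, Q, W) = Q"

lemma exists_admissible_steps:
  fixes A :: "('a::{t2_space, second_countable_topology}, 'e::euclidean_space) chart set"
    and B :: "('b::{t2_space, second_countable_topology}, 'f::euclidean_space) chart set"
  assumes A: "smooth_atlas A" and M: "compact (UNIV :: 'a set)" and B: "smooth_atlas B" and g: "continuous_on UNIV g"
  obtains T where "finite T" "\<And>t. t \<in> T \<Longrightarrow> admissible_step A B g t" "(\<Union>t\<in>T. step_core t) = UNIV"
proof -
  have "\<exists>t. admissible_step A B g t \<and> p \<in> step_core t \<and> open (step_core t)" for p
  proof -
    obtain c where c: "c \<in> A" "p \<in> cdom c" using smooth_atlas_cover[OF A] by blast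
    obtain c' where c': "c' \<in> B" "g p \<in> cdom c'" using smooth_atlas_cover[OF B] by blast
    note ch' = smooth_atlas_chart[OF B c'(1)]
    obtain r where r: "r > 0" "ball (cmap c' (g p)) r \<subseteq> cimg c'"
      using chart_simps(2)[OF ch'] c'(2) open_contains_ball by blast
    let ?W = "ball (cmap c' (g p)) r"
    have "open (g -` (cdom c' \<inter> cmap c' -` ?W))"
      by (rule open_vimage[OF chart_open_preimage[OF ch' open_ball] g])
    moreover have "p \<in> g -` (cdom c' \<inter> cmap c' -` ?W)" using c' r(1) by simp
    ultimately obtain \<mu> K Q where "smooth_function A \<mu>" "\<And>x. 0 \<le> \<mu> x" "\<And>x. \<mu> x \<le> 1"
      "compact K" "K \<subseteq> cdom c" "K \<subseteq> g -` (cdom c' \<inter> cmap c' -` ?W)" "\<And>x. x \<notin> K \<Longrightarrow> \<mu> x = 0"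
      "open Q" "p \<in> Q" "Q \<subseteq> K" "\<And>x. x \<in> Q \<Longrightarrow> \<mu> x = 1"
      using exists_manifold_bump[OF A c] by metis
    then show ?thesis
      using c c' r(2) by (intro exI[of _ "(c, c', \<mu>, K, Q, ?W)"]) auto
  qed
  then obtain t where t: "\<And>p. admissible_step A B g (t p)" "\<And>p. p \<in> step_core (t p)" "\<And>p. open (step_core (t p))"
    by metis
  obtain P where P: "finite P" "UNIV \<subseteq> (\<Union>p\<in>P. step_core (t p))"
    by (rule compactE_image[OF M, of UNIV "\<lambda>p. step_core (t p)"]) (use t(2,3) in auto)
  show ?thesis by (rule that[of "t ` P"]) (use P t(1) in auto)
qed

section \<open>Equality of the integrals of nearby and of homotopic maps\<close>

context
  fixes A :: "('a::{t2_space, second_countable_topology}, real^4) chart set"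
    and B :: "('b::{t2_space, second_countable_topology}, 'f::euclidean_space) chart set" and \<omega> :: "('b, 'f) field2"
  assumes orient: "oriented_atlas A" and M: "compact (UNIV :: 'a set)"
    and B: "smooth_atlas B" and \<omega>: "closed_smooth_form2 B \<omega>"
begin

lemmas source_atlas = oriented_atlas_smooth[OF orient M]
lemmas source_chart = smooth_atlas_chart[OF source_atlas] and target_chart = smooth_atlas_chart[OF B]

lemma pulled_integral_local_change:
  assumes f: "smooth_map A B f" and f': "smooth_map A B f'" and c: "c \<in> A" "c' \<in> B"
    and K: "compact K" "K \<subseteq> cdom c" and eq: "\<And>x. x \<notin> K \<Longrightarrow> f x = f' x"
    and W: "open W" "convex W" "W \<subseteq> cimg c'"
    and fK: "\<And>x. x \<in> K \<Longrightarrow> f x \<in> cdom c' \<and> cmap c' (f x) \<in> W"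
    and fK': "\<And>x. x \<in> K \<Longrightarrow> f' x \<in> cdom c' \<and> cmap c' (f' x) \<in> W"
  shows "pulled_integral A B \<omega> f = pulled_integral A B \<omega> f'"
proof -
  let ?\<alpha> = "pullback2 A B f \<omega>" and ?\<alpha>' = "pullback2 A B f' \<omega>"
  let ?\<eta> = "\<lambda>p w x y z. 1 * wedge2 ?\<alpha> ?\<alpha> p w x y z + (- 1) * wedge2 ?\<alpha>' ?\<alpha>' p w x y z"
  have cont: "continuous_form4 A (wedge2 ?\<alpha> ?\<alpha>)" "continuous_form4 A (wedge2 ?\<alpha>' ?\<alpha>')"
    using continuous_form4_wedge2[OF source_atlas] continuous_form2_pullback[OF source_atlas B \<omega>] f f' by blast+
  have cf: "continuous_on UNIV f" "smooth_map_on A B f UNIV" "continuous_on UNIV f'" "smooth_map_on A B f' UNIV"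
    using f f' by (auto simp: smooth_map_iff)
  have loc: "local4 A d ?\<eta> y = local4 A d (wedge2 ?\<alpha> ?\<alpha>) y - local4 A d (wedge2 ?\<alpha>' ?\<alpha>') y" for d y
    by (simp add: local4_def Let_def)
  \<comment> \<open>Off \<open>K\<close> the maps coincide on an open set, hence so do their
    derivatives and the pulled-back forms.\<close>
  have supp: "supported_in A ?\<eta> K"
    unfolding supported_in_def
  proof (intro ballI)
    fix d p assume d: "d \<in> A" and p: "p \<in> cdom d - K"
    obtain d' where d': "d' \<in> B" "f p \<in> cdom d'" using smooth_atlas_cover[OF B] by blast
    have fp: "f' p = f p" using eq p by simp
    have o: "open (cmap d ` (cdom d \<inter> - K))"
      using K(1) by (intro chart_open_image[OF source_chart[OF d]]) (simp add: compact_imp_closed open_Compl)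
    have reps: "rep d d' f y = rep d d' f' y" if "y \<in> cmap d ` (cdom d \<inter> - K)" for y
      using that eq by (auto simp: rep_def chart_simps(3)[OF source_chart[OF d]])
    have "frechet_derivative (rep d d' f) (at (cmap d p)) = frechet_derivative (rep d d' f') (at (cmap d p))"
      by (rule frechet_derivative_cong_open[OF o _ reps]) (use p in blast)
    moreover have "rep d d' f (cmap d p) = rep d d' f' (cmap d p)" by (rule reps) (use p in blast)
    moreover have "local2 A d ?\<alpha> (cmap d p) u v = pull2 (rep d d' f) (local2 B d' \<omega>) (cmap d p) u v"
      "local2 A d ?\<alpha>' (cmap d p) u v = pull2 (rep d d' f') (local2 B d' \<omega>) (cmap d p) u v" for u v
      using p d' fp chart_simps(3)[OF source_chart[OF d], of p]
      by (intro local2_pullback2[OF source_atlas d _ B d'(1) _ f] local2_pullback2[OF source_atlas d _ B d'(1) _ f']; auto)+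
    ultimately have "local2 A d ?\<alpha> (cmap d p) = local2 A d ?\<alpha>' (cmap d p)"
      by (simp add: fun_eq_iff pull2_def)
    then show "local4 A d ?\<eta> (cmap d p) = 0" unfolding loc local4_wedge2 by simp
  qed
  \<comment> \<open>The open set on which both maps land in \<open>W\<close>. It contains
    \<open>K\<close>, so restricting the integral to its coordinate image loses nothing and brings
    the Euclidean statement into force.\<close>
  define V where "V = f -` (cdom c' \<inter> cmap c' -` W) \<inter> f' -` (cdom c' \<inter> cmap c' -` W)"
  have V: "open V"
    unfolding V_def
    by (intro open_Int open_vimage chart_open_preimage[OF target_chart[OF c(2)] W(1)] cf)
  define U where "U = cmap c ` (cdom c \<inter> V)"
  have U: "open U" unfolding U_def by (rule chart_open_image[OF source_chart[OF c(1)] V])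
  have KU: "cmap c ` K \<subseteq> U" using K(2) fK fK' by (auto simp: U_def V_def)
  have cK: "compact (cmap c ` K)" by (rule chart_compact_image[OF source_chart[OF c(1)] K])
  have conth: "continuous_form4 A ?\<eta>" by (rule continuous_form4_lincomb[OF orient M cont])
  have zero: "local4 A c ?\<eta> y = 0" if "y \<in> cimg c - U" for y
    by (rule local4_integrand(5)[OF orient M conth supp K(1) c(1) K(2)]) (use that KU in blast)
  have Usub: "U \<subseteq> cimg c" "U \<subseteq> cmap c ` (cdom c \<inter> UNIV \<inter> f -` cdom c')" "U \<subseteq> cmap c ` (cdom c \<inter> UNIV \<inter> f' -` cdom c')"
    by (auto simp: U_def V_def)
  have sm: "smooth_on U (rep c c' f)" "smooth_on U (rep c c' f')"
    using cf(2,4) c smooth_on_subset[OF _ Usub(2)] smooth_on_subset[OF _ Usub(3)]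
    unfolding smooth_map_on_def by blast+
  have im: "rep c c' f ` U \<subseteq> W" "rep c c' f' ` U \<subseteq> W"
    by (auto simp: U_def V_def rep_def chart_simps(3)[OF source_chart[OF c(1)]])
  have \<Omega>: "smooth_form2 W (local2 B c' \<omega>)" "closed_on W (local2 B c' \<omega>)"
    using \<omega> c(2) W(3) smooth_on_subset[of "cimg c'" _ W]
    unfolding closed_smooth_form2_def smooth_form2_def closed_on_def by blast+
  have reps: "rep c c' f y = rep c c' f' y" if y: "y \<in> U - cmap c ` K" for y
  proof -
    obtain q where q: "q \<in> cdom c" "y = cmap c q" using y by (auto simp: U_def)
    then have "q \<notin> K" using y by blast
    then show ?thesis using eq q by (simp add: rep_def chart_simps(3)[OF source_chart[OF c(1)]])
  qed
  have "pulled_integral A B \<omega> f - pulled_integral A B \<omega> f' = form_integral A ?\<eta>"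
    using form_integral_lincomb[OF orient M cont, of 1 "-1"] by (simp add: pulled_integral_def)
  also have "\<dots> = integral (cimg c) (local4 A c ?\<eta>)"
    by (rule form_integral_supported[OF orient M conth supp K c(1)])
  also have "\<dots> = integral U (local4 A c ?\<eta>)"
    by (rule integral_spike_set) (use zero Usub(1) in \<open>auto intro!: negligible_subset[OF negligible_empty]\<close>)
  also have "\<dots> = integral U (\<lambda>x.
      wedge_sq (pull2 (rep c c' f) (local2 B c' \<omega>) x) (axis 1 1) (axis 2 1) (axis 3 1) (axis 4 1)
      - wedge_sq (pull2 (rep c c' f') (local2 B c' \<omega>) x) (axis 1 1) (axis 2 1) (axis 3 1) (axis 4 1))"
  proof (rule integral_cong)
    fix y assume "y \<in> U"
    then obtain q where q: "q \<in> cdom c" "f q \<in> cdom c'" "f' q \<in> cdom c'" "y = cmap c q"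
      by (auto simp: U_def V_def)
    then have y: "y \<in> cimg c" "f (cinv c y) \<in> cdom c'" "f' (cinv c y) \<in> cdom c'"
      by (auto simp: chart_simps(3)[OF source_chart[OF c(1)]])
    have "local2 A c ?\<alpha> y = pull2 (rep c c' f) (local2 B c' \<omega>) y"
      "local2 A c ?\<alpha>' y = pull2 (rep c c' f') (local2 B c' \<omega>) y"
      using local2_pullback2[OF source_atlas c(1) y(1) B c(2) y(2) f] local2_pullback2[OF source_atlas c(1) y(1) B c(2) y(3) f']
      by (simp_all add: fun_eq_iff)
    then show "local4 A c ?\<eta> y =
      wedge_sq (pull2 (rep c c' f) (local2 B c' \<omega>) y) (axis 1 1) (axis 2 1) (axis 3 1) (axis 4 1)
      - wedge_sq (pull2 (rep c c' f') (local2 B c' \<omega>) y) (axis 1 1) (axis 2 1) (axis 3 1) (axis 4 1)"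
      unfolding loc local4_wedge2 by simp
  qed
  also have "\<dots> = 0"
    by (rule integral_wedge_pull2_eq[OF U cK KU W(1,2) \<Omega> sm(1) im(1) sm(2) im(2) reps])
  finally show ?thesis by simp
qed

text \<open>Two neighbourhoods appear because every step costs room: the graphs of the given maps
  lie in \<O>', that of the result in \<O>. The result is a hybrid that keeps the integral of f and
  has already become f' on the cores.\<close>

definition replaceable :: "('a, real^4, 'b, 'f) step set \<Rightarrow> ('a \<times> 'b) set \<Rightarrow> ('a \<times> 'b) set \<Rightarrow> bool" where
  "replaceable T \<O>' \<O> \<longleftrightarrow>
    (\<forall>f f'. smooth_map A B f \<longrightarrow> smooth_map A B f' \<longrightarrow> (\<forall>x. (x, f x) \<in> \<O>') \<longrightarrow> (\<forall>x. (x, f' x) \<in> \<O>') \<longrightarrow>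
      (\<exists>f''. smooth_map A B f'' \<and> (\<forall>x. (x, f'' x) \<in> \<O>) \<and> pulled_integral A B \<omega> f'' = pulled_integral A B \<omega> f \<and>
        (\<forall>t\<in>T. \<forall>x\<in>step_core t. f'' x = f' x)))"

lemma replaceableE:
  assumes "replaceable T \<O>' \<O>" "smooth_map A B f" "smooth_map A B f'" "\<And>x. (x, f x) \<in> \<O>'" "\<And>x. (x, f' x) \<in> \<O>'"
  obtains f'' where "smooth_map A B f''" "\<And>x. (x, f'' x) \<in> \<O>" "pulled_integral A B \<omega> f'' = pulled_integral A B \<omega> f"
    "\<And>t x. t \<in> T \<Longrightarrow> x \<in> step_core t \<Longrightarrow> f'' x = f' x"
  using assms unfolding replaceable_def by metis

text \<open>The new step is carried out last: its own shrunken neighbourhood is the target for the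
  steps in \<open>T\<close>, and their result is then interpolated towards f', with weight 1 on the
  new core.\<close>

lemma smooth_map_replace:
  assumes g: "continuous_on UNIV g" and T: "finite T" "\<And>t. t \<in> T \<Longrightarrow> admissible_step A B g t"
    and Om: "open \<O>" "\<And>x. (x, g x) \<in> \<O>"
  shows "\<exists>\<O>'. open \<O>' \<and> (\<forall>x. (x, g x) \<in> \<O>') \<and> \<O>' \<subseteq> \<O> \<and> replaceable T \<O>' \<O>"
  using T Om
proof (induction T arbitrary: \<O> rule: finite_induct)
  case empty
  have "replaceable {} \<O> \<O>" unfolding replaceable_def by auto
  with empty show ?case by blast
next
  case (insert t T)
  obtain c c' \<mu> K Q W where t: "t = (c, c', \<mu>, K, Q, W)" by (cases t) auto
  have c: "c \<in> A" "c' \<in> B" and \<mu>: "smooth_function A \<mu>" "\<And>x. 0 \<le> \<mu> x" "\<And>x. \<mu> x \<le> 1" "\<And>x. x \<notin> K \<Longrightarrow> \<mu> x = 0"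
    and K: "compact K" "K \<subseteq> cdom c" and Q: "Q \<subseteq> K" "\<And>x. x \<in> Q \<Longrightarrow> \<mu> x = 1"
    and W: "open W" "convex W" "W \<subseteq> cimg c'" "\<And>x. x \<in> K \<Longrightarrow> g x \<in> cdom c' \<and> cmap c' (g x) \<in> W"
    using insert.prems(1)[of t] by (auto simp: t)
  obtain \<epsilon> \<O>1 where \<epsilon>: "\<epsilon> > 0" and O1: "open \<O>1" "\<And>x. (x, g x) \<in> \<O>1" "\<O>1 \<subseteq> \<O>"
    "\<And>x y. x \<in> K \<Longrightarrow> (x, y) \<in> \<O>1 \<Longrightarrow> y \<in> cdom c' \<and> dist (cmap c' y) (cmap c' (g x)) < \<epsilon>"
    and near: "\<And>x z. x \<in> K \<Longrightarrow> dist z (cmap c' (g x)) < \<epsilon> \<Longrightarrow> z \<in> W \<and> (x, cinv c' z) \<in> \<O>"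
    using shrink_graph_neighbourhood[OF target_chart[OF c(2)] g insert.prems(2,3) K(1) W(1,3,4)] by metis
  obtain \<O>' where O': "open \<O>'" "\<forall>x. (x, g x) \<in> \<O>'" "\<O>' \<subseteq> \<O>1" and IH: "replaceable T \<O>' \<O>1"
    using insert.IH[OF insert.prems(1) O1(1,2)] by auto
  have "\<exists>h. smooth_map A B h \<and> (\<forall>x. (x, h x) \<in> \<O>) \<and> pulled_integral A B \<omega> h = pulled_integral A B \<omega> f \<and>
        (\<forall>s\<in>insert t T. \<forall>x\<in>step_core s. h x = f' x)"
    if f: "smooth_map A B f" and f': "smooth_map A B f'" and graph: "\<forall>x. (x, f x) \<in> \<O>'" "\<forall>x. (x, f' x) \<in> \<O>'" for f f'
  proof -
    obtain f'' where f'': "smooth_map A B f''" "\<And>x. (x, f'' x) \<in> \<O>1"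
      "pulled_integral A B \<omega> f'' = pulled_integral A B \<omega> f" "\<And>s x. s \<in> T \<Longrightarrow> x \<in> step_core s \<Longrightarrow> f'' x = f' x"
      using replaceableE[OF IH f f'] graph by metis
    have n'': "f'' x \<in> cdom c'" "dist (cmap c' (f'' x)) (cmap c' (g x)) < \<epsilon>" if "x \<in> K" for x
      using O1(4)[OF that f''(2)] by auto
    have n': "f' x \<in> cdom c'" "dist (cmap c' (f' x)) (cmap c' (g x)) < \<epsilon>" if "x \<in> K" for x
      using O1(4)[OF that, of "f' x"] graph(2) O'(3) by auto
    define comb where "comb x = (1 - \<mu> x) *\<^sub>R cmap c' (f'' x) + \<mu> x *\<^sub>R cmap c' (f' x)" for x
    have comb: "dist (comb x) (cmap c' (g x)) < \<epsilon>" if "x \<in> K" for x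
      using convexD_alt[OF convex_ball, of "cmap c' (f'' x)" "cmap c' (g x)" \<epsilon> "cmap c' (f' x)" "\<mu> x"]
        n''(2)[OF that] n'(2)[OF that] \<mu>(2,3)
      by (simp add: comb_def dist_commute)
    define h where "h = chart_interp c' \<mu> K f'' (cmap c' \<circ> f')"
    define D where "D = cdom c \<inter> f' -` cdom c'"
    have cf': "continuous_on UNIV f'" "smooth_map_on A B f' UNIV" "continuous_on UNIV f''" "smooth_map_on A B f'' UNIV"
      using f' f''(1) by (auto simp: smooth_map_iff)
    have D: "open D" "D \<subseteq> cdom c" "K \<subseteq> D"
      unfolding D_def using chart_simps(1)[OF source_chart[OF c(1)]] chart_simps(1)[OF target_chart[OF c(2)]] cf'(1) K(2) n'(1)
      by (auto intro!: open_Int open_vimage)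
    have "smooth_on (cmap c ` (cdom c \<inter> UNIV \<inter> f' -` cdom c')) (rep c c' f')"
      using cf'(2) c unfolding smooth_map_on_def by blast
    then have u: "smooth_on (cmap c ` D) ((cmap c' \<circ> f') \<circ> cinv c)" by (simp add: D_def rep_def)
    have ok: "f'' x \<in> cdom c' \<and> (1 - \<mu> x) *\<^sub>R cmap c' (f'' x) + \<mu> x *\<^sub>R (cmap c' \<circ> f') x \<in> cimg c'"
      if "x \<in> K" for x
      using n''(1)[OF that] near[OF that comb[OF that]] W(3) by (auto simp: comb_def)
    note interp = chart_interp_smooth[OF source_atlas c(1) B c(2) K(1) D(3,1,2) \<mu>(1) _ cf'(3) u]
    have I: "continuous_on UNIV h" "smooth_map_on A B h UNIV"
      unfolding h_def by (rule interp(1) interp(2)[OF _ _ open_UNIV cf'(4)]; use \<mu>(4) ok in blast)+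
    have h: "smooth_map A B h"
      unfolding smooth_map_iff using I by blast
    have hK: "h x = cinv c' (comb x)" if "x \<in> K" for x using that by (simp add: h_def chart_interp_def comb_def)
    have hout: "h x = f'' x" if "x \<notin> K" for x using that by (simp add: h_def chart_interp_def)
    \<comment> \<open>A convex combination of equal coordinates changes nothing, so agreement with
      f' reached by earlier steps survives.\<close>
    have hf': "h x = f' x" if "f'' x = f' x \<or> \<mu> x = 1" for x
    proof (cases "x \<in> K")
      case True
      have "comb x = cmap c' (f' x)" using that by (auto simp: comb_def scaleR_left_diff_distrib)
      then show ?thesis using hK[OF True] chart_simps(3)[OF target_chart[OF c(2)] n'(1)[OF True]] by simp
    next
      case False
      then show ?thesis using hout \<mu>(4) that by auto
    qed
    have "pulled_integral A B \<omega> h = pulled_integral A B \<omega> f''"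
    proof (rule pulled_integral_local_change[OF h f''(1) c K hout W(1-3)])
      fix x assume x: "x \<in> K"
      show "f'' x \<in> cdom c' \<and> cmap c' (f'' x) \<in> W" using n''[OF x] near[OF x] by blast
      have "comb x \<in> W" using near[OF x comb[OF x]] by blast
      then show "h x \<in> cdom c' \<and> cmap c' (h x) \<in> W"
        using W(3) chart_simps(4,5)[OF target_chart[OF c(2)], of "comb x"] by (auto simp: hK[OF x])
    qed
    moreover have "(x, h x) \<in> \<O>" for x
      using near[of x, OF _ comb] hK[of x] hout[of x] f''(2)[of x] O1(3) by (cases "x \<in> K") auto
    moreover have "h x = f' x" if "s \<in> insert t T" "x \<in> step_core s" for s x
    proof (cases "s \<in> T")
      case True
      show ?thesis by (rule hf') (use f''(4)[OF True that(2)] in simp)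
    next
      case False
      then have "x \<in> Q" using that by (auto simp: t)
      then show ?thesis using hf' Q(2) by blast
    qed
    ultimately show ?thesis using h f''(3) by (intro exI[of _ h]) auto
  qed
  then have "replaceable (insert t T) \<O>' \<O>" unfolding replaceable_def by auto
  with O' O1(3) show ?case by (intro exI[of _ \<O>']) auto
qed

lemma pulled_integral_locally_constant:
  assumes g: "continuous_on UNIV g"
  obtains \<O> where "open \<O>" "\<And>x. (x, g x) \<in> \<O>"
    "\<And>f f'. smooth_map A B f \<Longrightarrow> smooth_map A B f' \<Longrightarrow> (\<And>x. (x, f x) \<in> \<O>) \<Longrightarrow> (\<And>x. (x, f' x) \<in> \<O>) \<Longrightarrow>
      pulled_integral A B \<omega> f = pulled_integral A B \<omega> f'"
proof -
  obtain T where T: "finite T" "\<And>t. t \<in> T \<Longrightarrow> admissible_step A B g t" "(\<Union>t\<in>T. step_core t) = UNIV"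
    using exists_admissible_steps[OF source_atlas M B g] by metis
  obtain \<O> where Om: "open \<O>" "\<forall>x. (x, g x) \<in> \<O>" and rep: "replaceable T \<O> UNIV"
    using smooth_map_replace[OF g T(1,2) open_UNIV UNIV_I] by auto
  show ?thesis
  proof (rule that[of \<O>])
    fix f f' assume f: "smooth_map A B f" "smooth_map A B f'" "\<And>x. (x, f x) \<in> \<O>" "\<And>x. (x, f' x) \<in> \<O>"
    obtain f'' where f'': "pulled_integral A B \<omega> f'' = pulled_integral A B \<omega> f"
      "\<And>t x. t \<in> T \<Longrightarrow> x \<in> step_core t \<Longrightarrow> f'' x = f' x"
      using replaceableE[OF rep f] by metis
    have "f'' = f'"
    proof
      fix x
      have "x \<in> (\<Union>t\<in>T. step_core t)" using T(3) by simp
      then show "f'' x = f' x" using f''(2) by blast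
    qed
    then show "pulled_integral A B \<omega> f = pulled_integral A B \<omega> f'" using f''(1) by simp
  qed (use Om in auto)
qed

text \<open>The steps are ordered as in \<open>smooth_map_replace\<close>, but the interpolation
  runs towards polynomials: it makes the map smooth on the new core and preserves smoothness on the
  old ones, which are open.\<close>

lemma smoothing_on_cores:
  assumes g: "continuous_on UNIV g" and T: "finite T" "\<And>t. t \<in> T \<Longrightarrow> admissible_step A B g t"
    and Om: "open \<O>" "\<And>x. (x, g x) \<in> \<O>"
  shows "\<exists>f. continuous_on UNIV f \<and> (\<forall>x. (x, f x) \<in> \<O>) \<and> (\<forall>t\<in>T. smooth_map_on A B f (step_core t))"
  using T Om
proof (induction T arbitrary: \<O> rule: finite_induct)
  case empty
  then show ?case using g by blast
next
  case (insert t T)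
  obtain c c' \<mu> K Q W where t: "t = (c, c', \<mu>, K, Q, W)" by (cases t) auto
  have c: "c \<in> A" "c' \<in> B" and \<mu>: "smooth_function A \<mu>" "\<And>x. 0 \<le> \<mu> x" "\<And>x. \<mu> x \<le> 1" "\<And>x. x \<notin> K \<Longrightarrow> \<mu> x = 0"
    and K: "compact K" "K \<subseteq> cdom c" and Q: "open Q" "Q \<subseteq> K" "\<And>x. x \<in> Q \<Longrightarrow> \<mu> x = 1"
    and W: "open W" "convex W" "W \<subseteq> cimg c'" "\<And>x. x \<in> K \<Longrightarrow> g x \<in> cdom c' \<and> cmap c' (g x) \<in> W"
    using insert.prems(1)[of t] by (auto simp: t)
  obtain \<epsilon> \<O>1 where \<epsilon>: "\<epsilon> > 0" and O1: "open \<O>1" "\<And>x. (x, g x) \<in> \<O>1" "\<O>1 \<subseteq> \<O>"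
    "\<And>x y. x \<in> K \<Longrightarrow> (x, y) \<in> \<O>1 \<Longrightarrow> y \<in> cdom c' \<and> dist (cmap c' y) (cmap c' (g x)) < \<epsilon>"
    and near: "\<And>x z. x \<in> K \<Longrightarrow> dist z (cmap c' (g x)) < \<epsilon> \<Longrightarrow> z \<in> W \<and> (x, cinv c' z) \<in> \<O>"
    using shrink_graph_neighbourhood[OF target_chart[OF c(2)] g insert.prems(2,3) K(1) W(1,3,4)] by metis
  obtain f where f: "continuous_on UNIV f" "\<And>x. (x, f x) \<in> \<O>1" "\<And>s. s \<in> T \<Longrightarrow> smooth_map_on A B f (step_core s)"
    using insert.IH[OF insert.prems(1) O1(1,2)] by blast
  have cK: "compact (cmap c ` K)" by (rule chart_compact_image[OF source_chart[OF c(1)] K])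
  have "continuous_on (cmap c ` K) (\<lambda>y. cmap c' (g (cinv c y)))"
  proof (rule continuous_on_compose2[OF chart_simps(6)[OF target_chart[OF c(2)]]])
    show "continuous_on (cmap c ` K) (\<lambda>y. g (cinv c y))"
      by (rule continuous_on_compose2[OF g continuous_on_subset[OF chart_simps(7)[OF source_chart[OF c(1)]]]]) (use K(2) in auto)
    show "(\<lambda>y. g (cinv c y)) ` (cmap c ` K) \<subseteq> cdom c'"
      using K(2) W(4) by (auto simp: subset_eq chart_simps(3)[OF source_chart[OF c(1)]])
  qed
  \<comment> \<open>The polynomial approximates the coordinates of \<open>g\<close> rather than of
    \<open>f\<close>: \<epsilon> is measured from \<open>g\<close>, and both ends of the
    interpolation have to lie in that ball.\<close>
  then obtain P where P: "polynomial_function P" "\<And>y. y \<in> cmap c ` K \<Longrightarrow> norm (cmap c' (g (cinv c y)) - P y) < \<epsilon>"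
    using Stone_Weierstrass_polynomial_function[OF cK _ \<epsilon>] by metis
  have nP: "dist (P (cmap c x)) (cmap c' (g x)) < \<epsilon>" if "x \<in> K" for x
  proof -
    have "cinv c (cmap c x) = x" using that K(2) chart_simps(3)[OF source_chart[OF c(1)]] by blast
    then show ?thesis using P(2)[of "cmap c x"] that by (simp add: dist_norm norm_minus_commute)
  qed
  have nf: "f x \<in> cdom c'" "dist (cmap c' (f x)) (cmap c' (g x)) < \<epsilon>" if "x \<in> K" for x
    using O1(4)[OF that f(2)] by auto
  define comb where "comb x = (1 - \<mu> x) *\<^sub>R cmap c' (f x) + \<mu> x *\<^sub>R P (cmap c x)" for x
  have comb: "dist (comb x) (cmap c' (g x)) < \<epsilon>" if "x \<in> K" for x
    using convexD_alt[OF convex_ball, of "cmap c' (f x)" "cmap c' (g x)" \<epsilon> "P (cmap c x)" "\<mu> x"]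
      nf(2)[OF that] nP[OF that] \<mu>(2,3)
    by (simp add: comb_def dist_commute)
  define h where "h = chart_interp c' \<mu> K f (P \<circ> cmap c)"
  have u: "smooth_on (cmap c ` cdom c) ((P \<circ> cmap c) \<circ> cinv c)"
  proof (rule smooth_on_cong[OF chart_simps(2)[OF source_chart[OF c(1)]]])
    show "smooth_on (cimg c) P"
      using ck_on_polynomial_function[OF chart_simps(2)[OF source_chart[OF c(1)]] P(1)] by (rule smooth_onI)
  qed (simp add: chart_simps(4)[OF source_chart[OF c(1)]])
  have ok: "f x \<in> cdom c' \<and> (1 - \<mu> x) *\<^sub>R cmap c' (f x) + \<mu> x *\<^sub>R (P \<circ> cmap c) x \<in> cimg c'"
    if "x \<in> K" for x
    using nf(1)[OF that] near[OF that comb[OF that]] W(3) by (auto simp: comb_def)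
  note interp = chart_interp_smooth[OF source_atlas c(1) B c(2) K chart_simps(1)[OF source_chart[OF c(1)]] order_refl \<mu>(1) _ f(1) u]
  have "continuous_on UNIV h" unfolding h_def by (rule interp(1)) (use \<mu>(4) ok in blast)+
  moreover have "(x, h x) \<in> \<O>" for x
    using near[of x, OF _ comb] f(2)[of x] O1(3)
    by (cases "x \<in> K") (auto simp: h_def chart_interp_def comb_def)
  moreover have "smooth_map_on A B h (step_core s)" if "s \<in> insert t T" for s
  proof (cases "s = t")
    case True
    have "smooth_map_on A B h Q" unfolding h_def by (rule interp(3)[OF _ _ Q(1,2)]) (use \<mu>(4) ok Q(3) in blast)+
    then show ?thesis using True by (simp add: t)
  next
    case False
    then have s: "s \<in> T" using that by simp
    have "open (step_core s)" using insert.prems(1)[of s] s by (cases s) auto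
    show ?thesis
      unfolding h_def
      by (rule interp(2)[OF _ _ _ f(3)[OF s]]) (use \<mu>(4) ok \<open>open (step_core s)\<close> in blast)+
  qed
  ultimately show ?case by blast
qed

lemma smooth_approximation:
  assumes g: "continuous_on UNIV g" and Om: "open \<O>" "\<And>x. (x, g x) \<in> \<O>"
  obtains f where "smooth_map A B f" "\<And>x. (x, f x) \<in> \<O>"
proof -
  obtain T where T: "finite T" "\<And>t. t \<in> T \<Longrightarrow> admissible_step A B g t" "(\<Union>t\<in>T. step_core t) = UNIV"
    using exists_admissible_steps[OF source_atlas M B g] by metis
  obtain f where f: "continuous_on UNIV f" "\<And>x. (x, f x) \<in> \<O>" "\<And>t. t \<in> T \<Longrightarrow> smooth_map_on A B f (step_core t)"
    using smoothing_on_cores[OF g T(1,2) Om] by blast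
  have "smooth_map_on A B f UNIV"
  proof (rule smooth_map_on_local[OF source_atlas B f(1)])
    fix p
    have "p \<in> (\<Union>t\<in>T. step_core t)" using T(3) by simp
    then obtain t where t: "t \<in> T" "p \<in> step_core t" by blast
    have "open (step_core t)" using T(2)[OF t(1)] by (cases t) auto
    then show "\<exists>Q'. open Q' \<and> p \<in> Q' \<and> smooth_map_on A B f Q'" using t f(3) by blast
  qed
  then show ?thesis using that[of f] f(1,2) by (simp add: smooth_map_iff)
qed

lemma pulled_integral_homotopic:
  assumes \<phi>: "smooth_map A B \<phi>" and \<psi>: "smooth_map A B \<psi>"
    and hom: "homotopic_with_canon (\<lambda>_. True) UNIV UNIV \<phi> \<psi>"
  shows "pulled_integral A B \<omega> \<psi> = pulled_integral A B \<omega> \<phi>"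
proof -
  obtain h where h: "continuous_on ({0..1::real} \<times> UNIV) h" "\<And>x. h (0, x) = \<phi> x" "\<And>x. h (1, x) = \<psi> x"
    using hom prod_topology_subtopology_eu[of "{0..1::real}" "UNIV :: 'a set"]
    by (auto simp: homotopic_with_def)
  \<comment> \<open>Clamping the parameter extends the homotopy to the whole line, so that local
    constancy can be used there without endpoints.\<close>
  define H where "H s x = h (max 0 (min 1 s), x)" for s :: real and x
  have H: "continuous_on UNIV (\<lambda>(s, x). H s x)"
    unfolding H_def case_prod_unfold
    by (rule continuous_on_compose2[OF h(1)]) (auto intro!: continuous_intros)
  have Hs: "continuous_on UNIV (H s)" for s
    using continuous_on_compose2[OF H, of UNIV "\<lambda>x. (s, x)"]
    by (simp add: continuous_on_Pair)
  have "\<exists>\<O>. open \<O> \<and> (\<forall>x. (x, H s x) \<in> \<O>) \<and> (\<forall>f f'. smooth_map A B f \<longrightarrow> smooth_map A B f' \<longrightarrow>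
      (\<forall>x. (x, f x) \<in> \<O>) \<longrightarrow> (\<forall>x. (x, f' x) \<in> \<O>) \<longrightarrow> pulled_integral A B \<omega> f = pulled_integral A B \<omega> f')" for s
    by (rule pulled_integral_locally_constant[OF Hs, of s]) blast
  then obtain \<O> where Om: "\<And>s. open (\<O> s)" "\<And>s x. (x, H s x) \<in> \<O> s"
    and const: "\<And>s f f'. smooth_map A B f \<Longrightarrow> smooth_map A B f' \<Longrightarrow> (\<And>x. (x, f x) \<in> \<O> s) \<Longrightarrow> (\<And>x. (x, f' x) \<in> \<O> s) \<Longrightarrow>
      pulled_integral A B \<omega> f = pulled_integral A B \<omega> f'"
    by metis
  have "\<exists>f. smooth_map A B f \<and> (\<forall>x. (x, f x) \<in> \<O> s)" for s
    by (rule smooth_approximation[OF Hs Om(1,2), of s]) blast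
  then obtain F where F: "\<And>s. smooth_map A B (F s)" "\<And>s x. (x, F s x) \<in> \<O> s" by metis
  \<comment> \<open>\<open>F s\<close> is an arbitrary smooth map near \<open>H s\<close>; by
    \<open>const\<close> every other choice in \<open>\<O> s\<close> gives the same value.\<close>
  define \<Phi> where "\<Phi> s = pulled_integral A B \<omega> (F s)" for s
  have "\<forall>\<^sub>F s in at t. \<Phi> t = \<Phi> s" for t
  proof -
    let ?S = "(\<lambda>(s, x). (x, H s x)) -` \<O> t"
    have "open ?S"
      using Om(1)[of t] H by (intro open_vimage) (auto simp: case_prod_unfold intro!: continuous_intros)
    moreover have "{t} \<times> UNIV \<subseteq> ?S" using Om(2) by auto
    \<comment> \<open>Compactness of the source gives a whole neighbourhood of parameters s for
      which the graph of \<open>H s\<close> lies in the set chosen for t.\<close>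
    ultimately obtain X where X: "t \<in> X" "open X" "X \<times> UNIV \<subseteq> ?S"
      using Elementary_Topology.tube_lemma[OF M, of ?S t] by blast
    have "\<Phi> t = \<Phi> s" if s: "s \<in> X" for s
    proof -
      \<comment> \<open>A smooth map with graph in both neighbourhoods then compares the values at s
        and t.\<close>
      have "(x, H s x) \<in> \<O> s \<inter> \<O> t" for x
      proof -
        have "(s, x) \<in> ?S" using X(3) s by blast
        then show ?thesis using Om(2) by simp
      qed
      then obtain f where f: "smooth_map A B f" "\<And>x. (x, f x) \<in> \<O> s \<inter> \<O> t"
        using smooth_approximation[OF Hs, of "\<O> s \<inter> \<O> t" s] Om(1) by blast
      have "\<Phi> t = pulled_integral A B \<omega> f" "\<Phi> s = pulled_integral A B \<omega> f"
        unfolding \<Phi>_def using F f by (auto intro!: const)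
      then show ?thesis by simp
    qed
    then show ?thesis using X(1,2) eventually_at_topological by blast
  qed
  then have "\<Phi> 0 = \<Phi> 1"
    by (intro connected_local_const[of UNIV 0 1 \<Phi>]) auto
  \<comment> \<open>At the ends of the homotopy the given maps are themselves smooth choices in the
    respective neighbourhoods.\<close>
  moreover have "H 0 = \<phi>" "H 1 = \<psi>" using h(2,3) by (auto simp: H_def)
  then have "\<Phi> 0 = pulled_integral A B \<omega> \<phi>" "\<Phi> 1 = pulled_integral A B \<omega> \<psi>"
    unfolding \<Phi>_def using F \<phi> \<psi> Om(2)[of _ 0] Om(2)[of _ 1] by (auto intro!: const)
  ultimately show ?thesis by simp
qed

end

theorem proposition4p4:
  fixes A :: "('a::{t2_space, second_countable_topology}, real^4) chart set"
    and g :: "('a, real^4) field2"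
    and B :: "('b::{t2_space, second_countable_topology}, complex^'m) chart set"
    and h :: "('b, complex^'m) field2"
    and J :: "'b \<Rightarrow> ('b, complex^'m) tangent \<Rightarrow> ('b, complex^'m) tangent"
    and \<phi> :: "'a \<Rightarrow> 'b"
  assumes "compact (UNIV :: 'a set)" and "oriented_atlas A" and "riemannian_metric A g"
    and "compact (UNIV :: 'b set)" and "kaehler_manifold B h J"
    and "smooth_map A B \<phi>"
  shows "let \<omega> = kaehler_form h J;
             rhs = (\<lambda>\<psi>. 1 / 2 * \<bar>form_integral A (pullback4 A B \<psi> (wedge2 \<omega> \<omega>))\<bar>)
         in energy A g B \<omega> \<phi> \<ge> rhs \<phi> \<and>
            (energy A g B \<omega> \<phi> = rhs \<phi> \<longleftrightarrow>
               self_dual A g (pullback2 A B \<phi> \<omega>) \<or> anti_self_dual A g (pullback2 A B \<phi> \<omega>)) \<and>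
            (\<forall>\<psi>. smooth_map A B \<psi> \<and> homotopic_with_canon (\<lambda>_. True) UNIV UNIV \<phi> \<psi> \<longrightarrow>
               rhs \<psi> = rhs \<phi>)"
proof -
  define \<omega> where "\<omega> = kaehler_form h J"
  have A: "smooth_atlas A" using assms(2) by (simp add: oriented_atlas_def)
  have B: "smooth_atlas B" using assms(5) by (simp add: kaehler_manifold_def holomorphic_atlas_def)
  have \<omega>: "closed_smooth_form2 B \<omega>"
    unfolding \<omega>_def by (rule closed_smooth_form2_kaehler[OF assms(5)])
  have F: "form_integral A (pullback4 A B \<psi> (wedge2 \<omega> \<omega>)) = pulled_integral A B \<omega> \<psi>" for \<psi>
    by (simp add: pullback4_wedge2 pulled_integral_def)
  note ineq = form_integral_energy_wedge[OF assms(2,1,3) continuous_form2_pullback[OF A B \<omega> assms(6)],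
      folded pulled_integral_def]
  have hom: "pulled_integral A B \<omega> \<psi> = pulled_integral A B \<omega> \<phi>"
    if "smooth_map A B \<psi>" "homotopic_with_canon (\<lambda>_. True) UNIV UNIV \<phi> \<psi>" for \<psi>
    by (rule pulled_integral_homotopic[OF assms(2,1) B \<omega> assms(6) that])
  have "energy A g B \<omega> \<phi> \<ge> 1 / 2 * \<bar>pulled_integral A B \<omega> \<phi>\<bar>"
    unfolding energy_def using ineq(1,3) by (simp add: abs_le_iff)
  \<comment> \<open>The integral N of the squared norm dominates both W and -W, so N = |W| holds
    exactly when N = W or N = -W, which are the two kinds of duality.\<close>
  moreover have "energy A g B \<omega> \<phi> = 1 / 2 * \<bar>pulled_integral A B \<omega> \<phi>\<bar> \<longleftrightarrow>
      self_dual A g (pullback2 A B \<phi> \<omega>) \<or> anti_self_dual A g (pullback2 A B \<phi> \<omega>)"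
    unfolding energy_def using ineq by (auto simp: abs_real_def)
  ultimately show ?thesis
    using hom by (simp add: Let_def F flip: \<omega>_def)
qed

end
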